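(* Let $G$ and $H$ be connected regular graphs such that $G$ has no nonlocal symmetry and $H$ has no quantum symmetry. Let $\sigma_G=\{\lambda_i\mid i=1,\dots,n\}$ be the set of distinct eigenvalues of $A_G$ and $\sigma_H=\{\mu_j\mid j=1,\dots,m\}$ the set of distinct eigenvalues of $A_H$. Then: (i) the cartesian product $G\square H$ has no nonlocal symmetry if $\{\lambda_i-\lambda_j\mid i,j=1,\dots,n\}\cap\{\mu_k-\mu_l\mid k,l=1,\dots,m\}=\{0\}$; (ii) the tensor product $G\times H$ has no nonlocal symmetry if $\sigma_G$ and $\sigma_H$ do not contain $0$ and $\left\{\frac{\lambda_i}{\lambda_j}\mid i,j=1,\dots,n\right\}\cap\left\{\frac{\mu_k}{\mu_l}\mid k,l=1,\dots,m\right\}=\{1\}$.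
   Context: Graphs are finite and simple, with adjacency matrix $A_G$. $G\square H$ is the graph on $V(G)\times V(H)$ with adjacency matrix $A_G\otimes\mathbf 1+\mathbf 1\otimes A_H$; $G\times H$ is the graph on $V(G)\times V(H)$ with adjacency matrix $A_G\otimes A_H$. For a graph $G$, $C(\mathrm{Qut}(G))$ is the universal unital $C^*$-algebra generated by $u_{ij}$, $i,j\in V(G)$, subject to $u_{ij}=u_{ij}^*=u_{ij}^2$, $\sum_ku_{ik}=\mathbf 1=\sum_ku_{ki}$ and $UA_G=A_GU$, where $U=(u_{ij})$. $G$ has no quantum symmetry if $C(\mathrm{Qut}(G))$ is commutative. In the $G$-automorphism game Alice and Bob receive vertices $i,j\in V(G)$ and answer with vertices $l,k\in V(G)$ respectively (without communicating); they win iff $\mathrm{rel}(i,j)=\mathrm{rel}(l,k)$, where $\mathrm{rel}$ records whether two vertices are equal, distinct and adjacent, or distinct and non-adjacent. A correlation is a function $p:V(G)^4\to[0,1]$, written $p(l,k|i,j)$, with $\sum_{l,k}p(l,k|i,j)=1$ for all $i,j$; it is winning if $p(l,k|i,j)=0$ whenever $\mathrm{rel}(i,j)\ne\mathrm{rel}(l,k)$. The winning classical correlations are the convex combinations of the correlations $p_\pi$, $\pi\in\mathrm{Aut}(G)$, where $p_\pi(l,k|i,j)=1$ if $l=\pi(i)$, $k=\pi(j)$ and $0$ otherwise. A quantum correlation is one of the form $p(l,k|i,j)=\psi^*M_{il}N_{jk}\psi$ with $\psi$ a unit vector in a Hilbert space $\mathcal H$ and $M_{il},N_{jk}\in B(\mathcal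 H)$ positive semidefinite, $\sum_lM_{il}=\mathbf 1=\sum_kN_{jk}$, and $M_{il}N_{jk}=N_{jk}M_{il}$ for all indices. $G$ has nonlocal symmetry if there is a winning quantum correlation for the $G$-automorphism game that is not classical. It is known that the winning quantum correlations of this game are exactly $p(l,k|i,j)=\tau(u_{il}u_{jk})$ for tracial states $\tau$ on $C(\mathrm{Qut}(G))$. *)

theory Defs
  imports
    "HOL-Analysis.Analysis"
    "HOL-Algebra.QuotRing"
    "HOL-Algebra.Module"
    "HOL-Library.Poly_Mapping"
begin

section \<open>Finite simple graphs\<close>

text \<open>
  The vertex set is a finite type and the graph is its adjacency relation. (Types are nonempty, in
  accordance with the convention that a connected graph has a vertex.)
\<close>

type_synonym 'v graph = "'v \<Rightarrow> 'v \<Rightarrow> bool"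

definition simple_graph :: "'v::finite graph \<Rightarrow> bool" where
  "simple_graph G \<longleftrightarrow> symp G \<and> irreflp G"

definition connected_graph :: "'v::finite graph \<Rightarrow> bool" where
  "connected_graph G \<longleftrightarrow> (\<forall>i j. G\<^sup>*\<^sup>* i j)"

definition regular_graph :: "'v::finite graph \<Rightarrow> bool" where
  "regular_graph G \<longleftrightarrow> (\<exists>d. \<forall>i. card {j. G i j} = d)"

definition adj_matrix :: "'v::finite graph \<Rightarrow> 'a::zero_neq_one ^ 'v ^ 'v" where
  "adj_matrix G = (\<chi> i j. if G i j then 1 else 0)"

definition graph_eigenvalues :: "'v::finite graph \<Rightarrow> complex set" where
  "graph_eigenvalues G = {c. \<exists>x. x \<noteq> 0 \<and> adj_matrix G *v x = c *s x}"

definition graph_aut :: "'v::finite graph \<Rightarrow> ('v \<Rightarrow> 'v) set" where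
  "graph_aut G = {\<pi>. bij \<pi> \<and> (\<forall>i j. G (\<pi> i) (\<pi> j) \<longleftrightarrow> G i j)}"

definition cart_product :: "'v::finite graph \<Rightarrow> 'w::finite graph \<Rightarrow> ('v \<times> 'w) graph" where
  "cart_product G H = (\<lambda>(i, a) (j, b). G i j \<and> a = b \<or> i = j \<and> H a b)"

definition tensor_product :: "'v::finite graph \<Rightarrow> 'w::finite graph \<Rightarrow> ('v \<times> 'w) graph" where
  "tensor_product G H = (\<lambda>(i, a) (j, b). G i j \<and> H a b)"

text \<open>The adjacency matrices are \<open>A\<^sub>G \<otimes> 1 + 1 \<otimes> A\<^sub>H\<close> and \<open>A\<^sub>G \<otimes> A\<^sub>H\<close>.\<close>

lemma adj_matrix_cart_product:
  assumes "simple_graph G" "simple_graph H"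
  shows "(adj_matrix (cart_product G H) :: 'a::semiring_1 ^ _ ^ _) $ (i, a) $ (j, b) =
    adj_matrix G $ i $ j * mat 1 $ a $ b + mat 1 $ i $ j * adj_matrix H $ a $ b"
  using assms
  by (auto simp: adj_matrix_def cart_product_def mat_def simple_graph_def irreflp_def)

lemma adj_matrix_tensor_product:
  "(adj_matrix (tensor_product G H) :: 'a::semiring_1 ^ _ ^ _) $ (i, a) $ (j, b) =
    adj_matrix G $ i $ j * adj_matrix H $ a $ b"
  by (auto simp: adj_matrix_def tensor_product_def)


section \<open>Universal unital C*-algebras\<close>

text \<open>
  The free unital *-algebra on a set of generators \<open>'g\<close> consists of the finitely supported complex
  functions on words in the letters \<open>g\<close> and \<open>g\<^sup>*\<close>. Words are lists, wrapped because the convolution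
  product of finitely supported functions wants an additively written monoid.
\<close>

datatype 'g letter = Gen 'g | Adj 'g

datatype 'g gword = GWord (letters: "'g letter list")

instantiation gword :: (type) monoid_add
begin

definition zero_gword :: "'a gword" where
  "0 = GWord []"

definition plus_gword :: "'a gword \<Rightarrow> 'a gword \<Rightarrow> 'a gword" where
  "v + w = GWord (letters v @ letters w)"

instance
  by standard (simp_all add: zero_gword_def plus_gword_def)

end

type_synonym 'g free_star_algebra = "'g gword \<Rightarrow>\<^sub>0 complex"

definition gen :: "'g \<Rightarrow> 'g free_star_algebra" where
  "gen g = Poly_Mapping.single (GWord [Gen g]) 1"

definition scalar :: "complex \<Rightarrow> 'g free_star_algebra" where
  "scalar c = Poly_Mapping.single 0 c"

fun adj_letter :: "'g letter \<Rightarrow> 'g letter" where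
  "adj_letter (Gen g) = Adj g"
| "adj_letter (Adj g) = Gen g"

definition adj_word :: "'g gword \<Rightarrow> 'g gword" where
  "adj_word w = GWord (rev (map adj_letter (letters w)))"

text \<open>The coefficient of \<open>x\<^sup>*\<close> at a word \<open>w\<close> is the conjugate of that of \<open>x\<close> at \<open>w\<^sup>*\<close>.\<close>

definition star :: "'g free_star_algebra \<Rightarrow> 'g free_star_algebra" where
  "star x = Poly_Mapping.map cnj (Poly_Mapping.map_key adj_word x)"

definition cstar_seminorm :: "('g free_star_algebra \<Rightarrow> real) \<Rightarrow> bool" where
  "cstar_seminorm p \<longleftrightarrow>
    (\<forall>x. 0 \<le> p x) \<and>
    (\<forall>x y. p (x + y) \<le> p x + p y) \<and>
    (\<forall>c x. p (scalar c * x) = cmod c * p x) \<and>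
    (\<forall>x y. p (x * y) \<le> p x * p y) \<and>
    (\<forall>x. p (star x * x) = (p x)\<^sup>2)"

text \<open>
  The universal C*-algebra with relations \<open>r = 0\<close>, \<open>r \<in> R\<close>, is the Hausdorff completion of the free
  *-algebra with respect to the largest C*-seminorm vanishing on \<open>R\<close>, realised as Cauchy sequences
  modulo null sequences. It exists if the supremum below is finite everywhere, which is proved for
  the quantum automorphism group in \<open>bdd_above_qut_seminorms\<close>. Only its ring structure is recorded,
  since that is what commutativity refers to.
\<close>

definition rel_seminorms :: "'g free_star_algebra set \<Rightarrow> ('g free_star_algebra \<Rightarrow> real) set" where
  "rel_seminorms R = {p. cstar_seminorm p \<and> (\<forall>r\<in>R. p r = 0)}"

definition universal_norm :: "'g free_star_algebra set \<Rightarrow> 'g free_star_algebra \<Rightarrow> real" where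
  "universal_norm R x = (SUP p\<in>rel_seminorms R. p x)"

definition cauchy_ring :: "'g free_star_algebra set \<Rightarrow> (nat \<Rightarrow> 'g free_star_algebra) ring" where
  "cauchy_ring R =
    \<lparr>carrier = {X. \<forall>e>0. \<exists>N. \<forall>m\<ge>N. \<forall>n\<ge>N. universal_norm R (X m - X n) < e},
     mult = (\<lambda>X Y n. X n * Y n), one = (\<lambda>_. 1),
     zero = (\<lambda>_. 0), add = (\<lambda>X Y n. X n + Y n)\<rparr>"

definition null_sequences :: "'g free_star_algebra set \<Rightarrow> (nat \<Rightarrow> 'g free_star_algebra) set" where
  "null_sequences R = {X. (\<lambda>n. universal_norm R (X n)) \<longlonglongrightarrow> 0}"

definition universal_cstar_algebra ::
    "'g free_star_algebra set \<Rightarrow> (nat \<Rightarrow> 'g free_star_algebra) set ring" where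
  "universal_cstar_algebra R = cauchy_ring R Quot null_sequences R"


section \<open>The quantum automorphism group\<close>

definition qut_matrix :: "('v::finite \<times> 'v) free_star_algebra ^ 'v ^ 'v" where
  "qut_matrix = (\<chi> i j. gen (i, j))"

definition qut_relations :: "'v::finite graph \<Rightarrow> ('v \<times> 'v) free_star_algebra set" where
  "qut_relations G =
    (\<Union>i j. {qut_matrix $ i $ j - star (qut_matrix $ i $ j),
            qut_matrix $ i $ j - qut_matrix $ i $ j * qut_matrix $ i $ j}) \<union>
    (\<Union>i. {(\<Sum>k\<in>UNIV. qut_matrix $ i $ k) - 1, (\<Sum>k\<in>UNIV. qut_matrix $ k $ i) - 1}) \<union>
    (\<Union>i j. {(qut_matrix ** adj_matrix G) $ i $ j - (adj_matrix G ** qut_matrix) $ i $ j})"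

definition C_Qut :: "'v::finite graph \<Rightarrow> (nat \<Rightarrow> ('v \<times> 'v) free_star_algebra) set ring" where
  "C_Qut G = universal_cstar_algebra (qut_relations G)"

definition no_quantum_symmetry :: "'v::finite graph \<Rightarrow> bool" where
  "no_quantum_symmetry G \<longleftrightarrow>
    (\<forall>x\<in>carrier (C_Qut G). \<forall>y\<in>carrier (C_Qut G). x \<otimes>\<^bsub>C_Qut G\<^esub> y = y \<otimes>\<^bsub>C_Qut G\<^esub> x)"

lemma adj_word_adj_word [simp]: "adj_word (adj_word w) = w"
proof -
  have "map (adj_letter \<circ> adj_letter) xs = xs" for xs :: "'a letter list"
  proof (induction xs)
    case (Cons x xs)
    then show ?case by (cases x) auto
  qed simp
  then show ?thesis
    by (cases w) (simp add: adj_word_def rev_map)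
qed

lemma lookup_star: "Poly_Mapping.lookup (star x) w = cnj (Poly_Mapping.lookup x (adj_word w))"
proof -
  have "inj (adj_word :: 'a gword \<Rightarrow> 'a gword)"
    by (metis adj_word_adj_word injI)
  then show ?thesis
    by (simp add: star_def Poly_Mapping.map.rep_eq map_key.rep_eq when_def)
qed

lemma star_single: "star (Poly_Mapping.single w c) = Poly_Mapping.single (adj_word w) (cnj c)"
  by (rule poly_mapping_eqI) (auto simp: lookup_star lookup_single when_def)

lemma star_1: "star 1 = 1"
  unfolding single_one [symmetric] star_single
  by (simp add: adj_word_def zero_gword_def)

lemma cstar_seminorm_1_le: "cstar_seminorm p \<Longrightarrow> p 1 \<le> 1"
proof -
  assume "cstar_seminorm p"
  then have "p (star 1 * 1) = (p 1)\<^sup>2"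
    unfolding cstar_seminorm_def by blast
  then have "p 1 = 0 \<or> p 1 = 1"
    by (simp add: star_1 power2_eq_square)
  then show ?thesis by auto
qed

lemma cstar_seminorm_diff_eq_0:
  assumes "cstar_seminorm p" "p (x - y) = 0"
  shows "p x = p y"
proof -
  have sc: "p (scalar (- 1) * (x - y)) = 0" and tri: "\<And>u v. p (u + v) \<le> p u + p v"
    using assms unfolding cstar_seminorm_def by auto
  have "scalar (- 1) * (x - y) = y - x"
    unfolding scalar_def single_uminus by simp
  then have "p (y - x) = 0" using sc by simp
  then show ?thesis
    using tri [of "x - y" y] tri [of "y - x" x] assms(2) by simp
qed

lemma qut_seminorm_letter_le:
  assumes p: "p \<in> rel_seminorms (qut_relations G)"
  shows "p (Poly_Mapping.single (GWord [a]) 1) \<le> 1"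
proof -
  have cp: "cstar_seminorm p" and rel: "\<And>r. r \<in> qut_relations G \<Longrightarrow> p r = 0"
    using p unfolding rel_seminorms_def by auto
  have nn: "0 \<le> p x" and sub: "p (x * y) \<le> p x * p y" and cst: "p (star x * x) = (p x)\<^sup>2" for x y
    using cp unfolding cstar_seminorm_def by auto
  obtain i j where a: "a = Gen (i, j) \<or> a = Adj (i, j)"
    by (metis letter.exhaust surj_pair)
  define u where "u = gen (i, j)"
  have "u - star u \<in> qut_relations G" "u - u * u \<in> qut_relations G"
    unfolding qut_relations_def u_def qut_matrix_def by auto
  then have r: "p (u - star u) = 0" "p (u - u * u) = 0"
    using rel by auto
  have "p (u * u - star u * u) = p ((u - star u) * u)"
    by (simp add: algebra_simps)
  then have "p (u * u - star u * u) = 0"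
    using sub [of "u - star u" u] nn [of "(u - star u) * u"] r by simp
  then have "p u = (p u)\<^sup>2"
    using cstar_seminorm_diff_eq_0 [OF cp] r(2) cst [of u] by metis
  then have "p u \<le> 1"
    by (cases "p u = 0") (auto simp: power2_eq_square)
  moreover have "p (star u) = p u"
    using cstar_seminorm_diff_eq_0 [OF cp r(1)] by simp
  moreover have "star u = Poly_Mapping.single (GWord [Adj (i, j)]) 1"
    by (simp add: u_def gen_def star_single adj_word_def)
  ultimately show ?thesis
    using a by (auto simp: u_def gen_def)
qed

lemma qut_seminorm_word_le:
  assumes p: "p \<in> rel_seminorms (qut_relations G)"
  shows "p (Poly_Mapping.single (GWord as) 1) \<le> 1"
proof (induction as)
  case Nil
  have "p 1 \<le> 1"
    using p by (intro cstar_seminorm_1_le) (simp add: rel_seminorms_def)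
  then show ?case
    unfolding single_one [symmetric] zero_gword_def .
next
  case (Cons a as)
  have nn: "0 \<le> p x" and sub: "p (x * y) \<le> p x * p y" for x y
    using p unfolding rel_seminorms_def cstar_seminorm_def by auto
  have "Poly_Mapping.single (GWord (a # as)) 1 =
      Poly_Mapping.single (GWord [a]) 1 * Poly_Mapping.single (GWord as) (1 :: complex)"
    by (simp add: mult_single plus_gword_def)
  then have "p (Poly_Mapping.single (GWord (a # as)) 1) \<le>
      p (Poly_Mapping.single (GWord [a]) 1) * p (Poly_Mapping.single (GWord as) 1)"
    using sub by simp
  also have "\<dots> \<le> 1 * 1"
    by (intro mult_mono qut_seminorm_letter_le [OF p] Cons nn) simp
  finally show ?case by simp
qed

lemma qut_seminorm_bound:
  "\<exists>B. \<forall>p\<in>rel_seminorms (qut_relations G). p x \<le> B"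
proof (induction x rule: update_induct)
  case const
  have "p 0 = 0" if "p \<in> rel_seminorms (qut_relations G)" for p
  proof -
    have "p (scalar 0 * 0) = cmod 0 * p 0"
      using that unfolding rel_seminorms_def cstar_seminorm_def by blast
    then show ?thesis by simp
  qed
  then show ?case by (metis order_refl)
next
  case (update f w c)
  then obtain A where A: "\<forall>p\<in>rel_seminorms (qut_relations G). p f \<le> A" by blast
  have "p (Poly_Mapping.update w c f) \<le> A + cmod c" if p: "p \<in> rel_seminorms (qut_relations G)" for p
  proof -
    have hom: "p (scalar c * x) = cmod c * p x" and tri: "p (x + y) \<le> p x + p y" for x y
      using p unfolding rel_seminorms_def cstar_seminorm_def by auto
    have "Poly_Mapping.single w c = scalar c * Poly_Mapping.single w 1"
      by (simp add: scalar_def mult_single)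
    then have "p (Poly_Mapping.single w c) = cmod c * p (Poly_Mapping.single w 1)"
      using hom by simp
    also have "\<dots> \<le> cmod c * 1"
      using qut_seminorm_word_le [OF p, of "letters w"] by (intro mult_left_mono) auto
    finally have "p (Poly_Mapping.single w c) \<le> cmod c" by simp
    moreover have "Poly_Mapping.update w c f = f + Poly_Mapping.single w c"
      using update(1) by (intro poly_mapping_eqI)
        (auto simp: lookup_update lookup_add lookup_single when_def in_keys_iff)
    ultimately show ?thesis using tri [of f "Poly_Mapping.single w c"] A p by fastforce
  qed
  then show ?case by blast
qed

lemma bdd_above_qut_seminorms:
  "bdd_above ((\<lambda>p. p x) ` rel_seminorms (qut_relations G))"
  using qut_seminorm_bound [of G x] unfolding bdd_above_def by blast

lemma qut_norm_upper:
  "p \<in> rel_seminorms (qut_relations G) \<Longrightarrow> p x \<le> universal_norm (qut_relations G) x"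
  unfolding universal_norm_def by (rule cSUP_upper [OF _ bdd_above_qut_seminorms])

lemma qut_norm_least:
  assumes "\<And>p. p \<in> rel_seminorms (qut_relations G) \<Longrightarrow> p x \<le> B"
  shows "universal_norm (qut_relations G) x \<le> B"
proof -
  have "(\<lambda>_. 0) \<in> rel_seminorms (qut_relations G)"
    by (simp add: rel_seminorms_def cstar_seminorm_def)
  then show ?thesis
    unfolding universal_norm_def using assms by (intro cSUP_least) auto
qed

lemma qut_norm_nonneg: "0 \<le> universal_norm (qut_relations G) x"
  using qut_norm_upper [of "\<lambda>_. 0" G x]
  by (simp add: rel_seminorms_def cstar_seminorm_def)

lemma qut_norm_triangle:
  "universal_norm (qut_relations G) (x + y) \<le>
    universal_norm (qut_relations G) x + universal_norm (qut_relations G) y"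
proof (rule qut_norm_least)
  fix p assume p: "p \<in> rel_seminorms (qut_relations G)"
  then have "p (x + y) \<le> p x + p y"
    unfolding rel_seminorms_def cstar_seminorm_def by auto
  also have "\<dots> \<le> universal_norm (qut_relations G) x + universal_norm (qut_relations G) y"
    by (intro add_mono qut_norm_upper p)
  finally show "p (x + y) \<le>
    universal_norm (qut_relations G) x + universal_norm (qut_relations G) y" .
qed

lemma qut_norm_mult:
  "universal_norm (qut_relations G) (x * y) \<le>
    universal_norm (qut_relations G) x * universal_norm (qut_relations G) y"
proof (rule qut_norm_least)
  fix p assume p: "p \<in> rel_seminorms (qut_relations G)"
  then have nn: "0 \<le> p x" for x
    unfolding rel_seminorms_def cstar_seminorm_def by auto
  have "p (x * y) \<le> p x * p y"
    using p unfolding rel_seminorms_def cstar_seminorm_def by auto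
  also have "p x * p y \<le> universal_norm (qut_relations G) x * universal_norm (qut_relations G) y"
    by (intro mult_mono qut_norm_upper p nn qut_norm_nonneg)
  finally show "p (x * y) \<le>
    universal_norm (qut_relations G) x * universal_norm (qut_relations G) y" .
qed

lemma qut_norm_minus:
  "universal_norm (qut_relations G) (- x) = universal_norm (qut_relations G) x"
proof -
  have "p (- x) = p x" if "p \<in> rel_seminorms (qut_relations G)" for p
  proof -
    have "p (scalar (- 1) * x) = cmod (- 1) * p x"
      using that unfolding rel_seminorms_def cstar_seminorm_def by blast
    moreover have "scalar (- 1) * x = - x"
      unfolding scalar_def single_uminus by simp
    ultimately show ?thesis by simp
  qed
  then show ?thesis
    unfolding universal_norm_def by (intro SUP_cong) auto
qed

text \<open>
  These properties of the norm make the null sequences a two-sided ideal of the ring of Cauchy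
  sequences, so that \<open>C_Qut G\<close> is a ring.
\<close>

context
  fixes G :: "'v::finite graph"
begin

private abbreviation "nrm \<equiv> universal_norm (qut_relations G)"
private abbreviation "R \<equiv> cauchy_ring (qut_relations G)"

private lemma nrm_0: "nrm 0 = 0"
proof (rule antisym [OF _ qut_norm_nonneg])
  show "nrm 0 \<le> 0"
  proof (rule qut_norm_least)
    fix p assume "p \<in> rel_seminorms (qut_relations G)"
    then have "p (scalar 0 * 0) = cmod 0 * p 0"
      unfolding rel_seminorms_def cstar_seminorm_def by blast
    then show "p 0 \<le> 0" by simp
  qed
qed

private lemma nrm_diff: "nrm (x - y) \<le> nrm x + nrm y"
  using qut_norm_triangle [of G x "- y"] by (simp add: qut_norm_minus)

private lemma carrier_iff:
  "X \<in> carrier R \<longleftrightarrow> (\<forall>e>0. \<exists>N. \<forall>m\<ge>N. \<forall>n\<ge>N. nrm (X m - X n) < e)"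
  by (simp add: cauchy_ring_def)

private lemma cauchy_bounded:
  assumes "X \<in> carrier R"
  obtains B where "B > 0" "\<And>n. nrm (X n) \<le> B"
proof -
  obtain N where N: "\<And>n. n \<ge> N \<Longrightarrow> nrm (X n - X N) < 1"
    using assms unfolding carrier_iff by (metis order_refl zero_less_one)
  define B where "B = (\<Sum>k\<le>N. nrm (X k)) + 1"
  have le: "nrm (X k) \<le> (\<Sum>k\<le>N. nrm (X k))" if "k \<le> N" for k
    using that by (intro member_le_sum) (auto simp: qut_norm_nonneg)
  have "nrm (X n) \<le> B" for n
  proof (cases "n \<le> N")
    case True
    then show ?thesis using le [of n] by (simp add: B_def)
  next
    case False
    have "nrm (X n) \<le> nrm (X n - X N) + nrm (X N)"
      using qut_norm_triangle [of G "X n - X N" "X N"] by simp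
    then show ?thesis using N [of n] le [of N] False by (simp add: B_def)
  qed
  moreover have "B > 0"
    unfolding B_def by (intro add_nonneg_pos sum_nonneg) (auto simp: qut_norm_nonneg)
  ultimately show thesis using that by blast
qed

private lemma carrier_add:
  assumes "X \<in> carrier R" "Y \<in> carrier R"
  shows "(\<lambda>n. X n + Y n) \<in> carrier R"
  unfolding carrier_iff
proof (intro allI impI)
  fix e :: real assume "e > 0"
  then have e: "e / 2 > 0" by simp
  obtain N1 where N1: "\<forall>m\<ge>N1. \<forall>n\<ge>N1. nrm (X m - X n) < e / 2"
    using assms(1) e unfolding carrier_iff by blast
  obtain N2 where N2: "\<forall>m\<ge>N2. \<forall>n\<ge>N2. nrm (Y m - Y n) < e / 2"
    using assms(2) e unfolding carrier_iff by blast
  have "nrm (X m + Y m - (X n + Y n)) < e" if "m \<ge> max N1 N2" "n \<ge> max N1 N2" for m n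
  proof -
    have "nrm (X m - X n) < e / 2" "nrm (Y m - Y n) < e / 2"
      using N1 N2 that by auto
    then show ?thesis
      using qut_norm_triangle [of G "X m - X n" "Y m - Y n"] by (simp add: algebra_simps)
  qed
  then show "\<exists>N. \<forall>m\<ge>N. \<forall>n\<ge>N. nrm (X m + Y m - (X n + Y n)) < e" by blast
qed

private lemma carrier_uminus:
  assumes "X \<in> carrier R"
  shows "(\<lambda>n. - X n) \<in> carrier R"
proof -
  have "nrm (- X m - - X n) = nrm (X m - X n)" for m n
    using qut_norm_minus [of G "X m - X n"] by simp
  then show ?thesis using assms unfolding carrier_iff by simp
qed

private lemma carrier_mult:
  assumes "X \<in> carrier R" "Y \<in> carrier R"
  shows "(\<lambda>n. X n * Y n) \<in> carrier R"
  unfolding carrier_iff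
proof (intro allI impI)
  fix e :: real assume "e > 0"
  obtain A where A: "A > 0" "\<And>n. nrm (X n) \<le> A" using cauchy_bounded [OF assms(1)] by blast
  obtain B where B: "B > 0" "\<And>n. nrm (Y n) \<le> B" using cauchy_bounded [OF assms(2)] by blast
  have e: "e / (2 * B) > 0" "e / (2 * A) > 0" using \<open>e > 0\<close> A B by auto
  obtain N1 where N1: "\<forall>m\<ge>N1. \<forall>n\<ge>N1. nrm (X m - X n) < e / (2 * B)"
    using assms(1) e unfolding carrier_iff by blast
  obtain N2 where N2: "\<forall>m\<ge>N2. \<forall>n\<ge>N2. nrm (Y m - Y n) < e / (2 * A)"
    using assms(2) e unfolding carrier_iff by blast
  have "nrm (X m * Y m - X n * Y n) < e" if mn: "m \<ge> max N1 N2" "n \<ge> max N1 N2" for m n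
  proof -
    have "nrm ((X m - X n) * Y m) \<le> nrm (X m - X n) * B"
      using qut_norm_mult [of G "X m - X n" "Y m"] B(2) [of m]
      by (meson mult_left_mono order_trans qut_norm_nonneg)
    also have "\<dots> < e / (2 * B) * B"
      using N1 mn B(1) by (intro mult_strict_right_mono) auto
    finally have 1: "nrm ((X m - X n) * Y m) < e / 2" using B(1) by simp
    have "nrm (X n * (Y m - Y n)) \<le> A * nrm (Y m - Y n)"
      using qut_norm_mult [of G "X n" "Y m - Y n"] A(2) [of n]
      by (meson mult_right_mono order_trans qut_norm_nonneg)
    also have "\<dots> < A * (e / (2 * A))"
      using N2 mn A(1) by (intro mult_strict_left_mono) auto
    finally have 2: "nrm (X n * (Y m - Y n)) < e / 2" using A(1) by simp
    have "X m * Y m - X n * Y n = (X m - X n) * Y m + X n * (Y m - Y n)"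
      by (simp add: algebra_simps)
    then show ?thesis
      using 1 2 qut_norm_triangle [of G "(X m - X n) * Y m" "X n * (Y m - Y n)"] by simp
  qed
  then show "\<exists>N. \<forall>m\<ge>N. \<forall>n\<ge>N. nrm (X m * Y m - X n * Y n) < e" by blast
qed

private lemma carrier_const: "(\<lambda>_. c) \<in> carrier R"
  by (simp add: carrier_iff nrm_0)

lemma ring_cauchy_ring: "ring (cauchy_ring (qut_relations G))"
proof (rule ringI)
  show "abelian_group R"
  proof (rule abelian_groupI)
    fix X assume "X \<in> carrier R"
    then show "\<exists>Y\<in>carrier R. Y \<oplus>\<^bsub>R\<^esub> X = \<zero>\<^bsub>R\<^esub>"
      by (intro bexI [OF _ carrier_uminus]) (auto simp: cauchy_ring_def)
  qed (use carrier_add carrier_const in \<open>auto simp: cauchy_ring_def add_ac\<close>)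
  show "Group.monoid R"
    by (rule monoidI) (use carrier_mult carrier_const in \<open>auto simp: cauchy_ring_def mult.assoc\<close>)
qed (auto simp: cauchy_ring_def algebra_simps)

private lemma null_sequences_subset: "null_sequences (qut_relations G) \<subseteq> carrier R"
proof
  fix X assume "X \<in> null_sequences (qut_relations G)"
  then have X: "(\<lambda>n. nrm (X n)) \<longlonglongrightarrow> 0" by (simp add: null_sequences_def)
  show "X \<in> carrier R"
    unfolding carrier_iff
  proof (intro allI impI)
    fix e :: real assume "e > 0"
    then obtain N where N: "\<And>n. n \<ge> N \<Longrightarrow> nrm (X n) < e / 2"
      using order_tendstoD(2) [OF X, of "e / 2"] unfolding eventually_sequentially by auto
    have "nrm (X m - X n) < e" if "m \<ge> N" "n \<ge> N" for m n
      using N [OF that(1)] N [OF that(2)] nrm_diff [of "X m" "X n"] by simp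
    then show "\<exists>N. \<forall>m\<ge>N. \<forall>n\<ge>N. nrm (X m - X n) < e" by blast
  qed
qed

private lemma null_sequences_le:
  assumes "f \<longlonglongrightarrow> 0" "\<And>n. nrm (X n) \<le> f n"
  shows "X \<in> null_sequences (qut_relations G)"
  unfolding null_sequences_def
  using tendsto_sandwich [OF _ _ tendsto_const assms(1), of "\<lambda>n. nrm (X n)"] assms(2)
  by (simp add: qut_norm_nonneg)

lemma ideal_null_sequences:
  "ideal (null_sequences (qut_relations G)) (cauchy_ring (qut_relations G))"
proof (rule idealI [OF ring_cauchy_ring])
  interpret ring R by (rule ring_cauchy_ring)
  show "subgroup (null_sequences (qut_relations G)) (add_monoid R)"
  proof (rule add.subgroupI)
    show "null_sequences (qut_relations G) \<subseteq> carrier R" by (rule null_sequences_subset)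
    have "(\<lambda>_. 0) \<in> null_sequences (qut_relations G)"
      by (simp add: null_sequences_def nrm_0)
    then show "null_sequences (qut_relations G) \<noteq> {}" by blast
  next
    fix X assume X: "X \<in> null_sequences (qut_relations G)"
    then have "X \<in> carrier R" using null_sequences_subset by blast
    then have "\<ominus>\<^bsub>R\<^esub> X = (\<lambda>n. - X n)"
      by (intro minus_equality carrier_uminus) (auto simp: cauchy_ring_def)
    then show "\<ominus>\<^bsub>R\<^esub> X \<in> null_sequences (qut_relations G)"
      using X by (simp add: null_sequences_def qut_norm_minus)
  next
    fix X Y assume "X \<in> null_sequences (qut_relations G)" "Y \<in> null_sequences (qut_relations G)"
    then have "(\<lambda>n. nrm (X n) + nrm (Y n)) \<longlonglongrightarrow> 0"
      using tendsto_add_zero by (auto simp: null_sequences_def)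
    then have "(\<lambda>n. X n + Y n) \<in> null_sequences (qut_relations G)"
      by (rule null_sequences_le) (rule qut_norm_triangle)
    then show "X \<oplus>\<^bsub>R\<^esub> Y \<in> null_sequences (qut_relations G)"
      by (simp add: cauchy_ring_def)
  qed
next
  fix X Y assume X: "X \<in> null_sequences (qut_relations G)" and Y: "Y \<in> carrier R"
  obtain B where B: "\<And>n. nrm (Y n) \<le> B" using cauchy_bounded [OF Y] by blast
  have lim: "(\<lambda>n. B * nrm (X n)) \<longlonglongrightarrow> 0"
    using X by (intro tendsto_mult_right_zero) (simp add: null_sequences_def)
  have "nrm (Y n * X n) \<le> B * nrm (X n)" for n
    using qut_norm_mult [of G "Y n" "X n"] B [of n]
    by (meson mult_right_mono order_trans qut_norm_nonneg)
  then have "(\<lambda>n. Y n * X n) \<in> null_sequences (qut_relations G)"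
    by (rule null_sequences_le [OF lim])
  then show "Y \<otimes>\<^bsub>R\<^esub> X \<in> null_sequences (qut_relations G)"
    by (simp add: cauchy_ring_def)
  have "nrm (X n * Y n) \<le> B * nrm (X n)" for n
    using qut_norm_mult [of G "X n" "Y n"] mult_left_mono [OF B [of n] qut_norm_nonneg [of G "X n"]]
    by (simp add: mult.commute)
  then have "(\<lambda>n. X n * Y n) \<in> null_sequences (qut_relations G)"
    by (rule null_sequences_le [OF lim])
  then show "X \<otimes>\<^bsub>R\<^esub> Y \<in> null_sequences (qut_relations G)"
    by (simp add: cauchy_ring_def)
qed

lemma ring_C_Qut: "ring (C_Qut G)"
  unfolding C_Qut_def universal_cstar_algebra_def
  by (rule ideal.quotient_is_ring [OF ideal_null_sequences])

end

section \<open>Complex Hilbert spaces\<close>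

definition complex_field :: "complex ring" where
  "complex_field = \<lparr>carrier = UNIV, mult = (*), one = 1, zero = 0, add = (+)\<rparr>"

lemma cring_complex_field: "cring complex_field"
proof (rule cringI)
  show "abelian_group complex_field"
    by (rule abelian_groupI)
      (auto simp: complex_field_def add_ac intro: exI[of _ "- _ :: complex"] add.left_inverse)
  show "comm_monoid complex_field"
    by (rule comm_monoidI) (auto simp: complex_field_def mult_ac)
qed (auto simp: complex_field_def algebra_simps)

text \<open>
  In the record below, the fields \<open>mult\<close> and \<open>one\<close> inherited from the type of modules are unused.
  The inner product is linear in its second argument.
\<close>

record 'h hilbert_space = "(complex, 'h) module" +
  cinner :: "'h \<Rightarrow> 'h \<Rightarrow> complex"

definition hnorm :: "'h hilbert_space \<Rightarrow> 'h \<Rightarrow> real" where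
  "hnorm S x = sqrt (Re (cinner S x x))"

definition complex_hilbert_space :: "'h hilbert_space \<Rightarrow> bool" where
  "complex_hilbert_space S \<longleftrightarrow>
    module complex_field S \<and>
    (\<forall>x\<in>carrier S. \<forall>y\<in>carrier S. cinner S x y = cnj (cinner S y x)) \<and>
    (\<forall>x\<in>carrier S. \<forall>y\<in>carrier S. \<forall>z\<in>carrier S.
      cinner S x (y \<oplus>\<^bsub>S\<^esub> z) = cinner S x y + cinner S x z) \<and>
    (\<forall>x\<in>carrier S. \<forall>y\<in>carrier S. \<forall>c. cinner S x (c \<odot>\<^bsub>S\<^esub> y) = c * cinner S x y) \<and>
    (\<forall>x\<in>carrier S. x \<noteq> \<zero>\<^bsub>S\<^esub> \<longrightarrow> 0 < Re (cinner S x x)) \<and>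
    (\<forall>X. (\<forall>n. X n \<in> carrier S) \<and>
         (\<forall>e>0. \<exists>N::nat. \<forall>m\<ge>N. \<forall>n\<ge>N. hnorm S (X m \<ominus>\<^bsub>S\<^esub> X n) < e) \<longrightarrow>
         (\<exists>x\<in>carrier S. (\<lambda>n. hnorm S (X n \<ominus>\<^bsub>S\<^esub> x)) \<longlonglongrightarrow> 0))"

definition bounded_operator :: "'h hilbert_space \<Rightarrow> ('h \<Rightarrow> 'h) \<Rightarrow> bool" where
  "bounded_operator S T \<longleftrightarrow>
    T \<in> carrier S \<rightarrow> carrier S \<and>
    (\<forall>x\<in>carrier S. \<forall>y\<in>carrier S. T (x \<oplus>\<^bsub>S\<^esub> y) = T x \<oplus>\<^bsub>S\<^esub> T y) \<and>
    (\<forall>x\<in>carrier S. \<forall>c. T (c \<odot>\<^bsub>S\<^esub> x) = c \<odot>\<^bsub>S\<^esub> T x) \<and>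
    (\<exists>B. \<forall>x\<in>carrier S. hnorm S (T x) \<le> B * hnorm S x)"

definition positive_operator :: "'h hilbert_space \<Rightarrow> ('h \<Rightarrow> 'h) \<Rightarrow> bool" where
  "positive_operator S T \<longleftrightarrow>
    bounded_operator S T \<and>
    (\<forall>x\<in>carrier S. cinner S x (T x) \<in> \<real> \<and> 0 \<le> Re (cinner S x (T x)))"


section \<open>The automorphism game\<close>

datatype vertex_rel = Equal | Adjacent | Nonadjacent

definition rel :: "'v::finite graph \<Rightarrow> 'v \<Rightarrow> 'v \<Rightarrow> vertex_rel" where
  "rel G i j = (if i = j then Equal else if G i j then Adjacent else Nonadjacent)"

text \<open>The probability \<open>p(l,k|i,j)\<close> is written \<open>p l k i j\<close>.\<close>

type_synonym 'v correlation = "'v \<Rightarrow> 'v \<Rightarrow> 'v \<Rightarrow> 'v \<Rightarrow> real"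

definition correlation :: "'v::finite correlation \<Rightarrow> bool" where
  "correlation p \<longleftrightarrow>
    (\<forall>l k i j. p l k i j \<in> {0..1}) \<and> (\<forall>i j. (\<Sum>l\<in>UNIV. \<Sum>k\<in>UNIV. p l k i j) = 1)"

definition winning :: "'v::finite graph \<Rightarrow> 'v correlation \<Rightarrow> bool" where
  "winning G p \<longleftrightarrow> (\<forall>l k i j. rel G i j \<noteq> rel G l k \<longrightarrow> p l k i j = 0)"

definition aut_correlation :: "('v::finite \<Rightarrow> 'v) \<Rightarrow> 'v correlation" where
  "aut_correlation \<pi> l k i j = (if l = \<pi> i \<and> k = \<pi> j then 1 else 0)"

definition winning_classical :: "'v::finite graph \<Rightarrow> 'v correlation \<Rightarrow> bool" where
  "winning_classical G p \<longleftrightarrow>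
    (\<exists>c. (\<forall>\<pi>\<in>graph_aut G. 0 \<le> c \<pi>) \<and> (\<Sum>\<pi>\<in>graph_aut G. c \<pi>) = 1 \<and>
      (\<forall>l k i j. p l k i j = (\<Sum>\<pi>\<in>graph_aut G. c \<pi> * aut_correlation \<pi> l k i j)))"

text \<open>
  HOL cannot quantify over all Hilbert spaces at once; the Hilbert space here ranges over all those
  whose underlying set is contained in the type \<open>'h\<close>, with arbitrary linear structure and inner
  product. Absence of nonlocal symmetry should therefore be concluded for an arbitrary type \<open>'h\<close>, but
  assuming it for \<open>nat \<Rightarrow> complex\<close> suffices: a correlation is already realised on the closed subspace
  generated by the vector \<open>\<psi>\<close> and the operators, which is separable and hence in bijection with a
  subset of that type.
\<close>

definition quantum_correlation :: "'h itself \<Rightarrow> 'v::finite correlation \<Rightarrow> bool" where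
  "quantum_correlation _ p \<longleftrightarrow> correlation p \<and>
    (\<exists>(S :: 'h hilbert_space) \<psi> M N.
      complex_hilbert_space S \<and> \<psi> \<in> carrier S \<and> hnorm S \<psi> = 1 \<and>
      (\<forall>i l. positive_operator S (M i l)) \<and>
      (\<forall>j k. positive_operator S (N j k)) \<and>
      (\<forall>i. \<forall>x\<in>carrier S. (\<Oplus>\<^bsub>S\<^esub>l\<in>UNIV. M i l x) = x) \<and>
      (\<forall>j. \<forall>x\<in>carrier S. (\<Oplus>\<^bsub>S\<^esub>k\<in>UNIV. N j k x) = x) \<and>
      (\<forall>i l j k. \<forall>x\<in>carrier S. M i l (N j k x) = N j k (M i l x)) \<and>
      (\<forall>l k i j. of_real (p l k i j) = cinner S \<psi> (M i l (N j k \<psi>))))"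

definition nonlocal_symmetry :: "'h itself \<Rightarrow> 'v::finite graph \<Rightarrow> bool" where
  "nonlocal_symmetry \<H> G \<longleftrightarrow>
    (\<exists>p. quantum_correlation \<H> p \<and> winning G p \<and> \<not> winning_classical G p)"

end

theory Submission
  imports Defs "HOL-Library.Function_Algebras"
begin

text \<open>
  A winning correlation \<open>\<langle>\<psi>, M\<^sub>i\<^sub>l N\<^sub>j\<^sub>k \<psi>\<rangle>\<close> for a graph \<open>K\<close> satisfies \<open>M\<^sub>i\<^sub>l \<psi> = N\<^sub>i\<^sub>l \<psi>\<close>, and on the
  invariant subspace of the \<open>T \<psi>\<close>, \<open>T\<close> commuting with all \<open>M\<^sub>i\<^sub>l\<close>, the operators \<open>M\<^sub>i\<^sub>l\<close> form a magic unitary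
  that commutes with \<open>A\<^sub>K\<close>. If \<open>K\<close> is one of the two products, the condition on the spectra makes each
  eigenspace of \<open>A\<^sub>K\<close> a tensor product of eigenspaces, so that this magic unitary also commutes with
  \<open>J \<otimes> 1\<close> and \<open>1 \<otimes> J\<close>, \<open>J\<close> being the all-ones matrix, which spans the projection onto the Perron vector
  of a connected regular graph. It follows that \<open>M\<^sub>(\<^sub>i\<^sub>,\<^sub>a\<^sub>)\<^sub>(\<^sub>j\<^sub>,\<^sub>b\<^sub>) = v\<^sub>i\<^sub>j w\<^sub>a\<^sub>b = w\<^sub>a\<^sub>b v\<^sub>i\<^sub>j\<close> with magic unitaries \<open>v\<close>, \<open>w\<close> for
  \<open>G\<close> and \<open>H\<close>. As \<open>H\<close> has no quantum symmetry the projections \<open>w\<^sub>a\<^sub>b\<close> commute with each other and with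
  \<open>v\<close>; their joint eigenvectors decompose the correlation into products of an automorphism of \<open>H\<close> with
  a winning quantum correlation of \<open>G\<close>, which is classical by assumption.
\<close>

text \<open>On the whole Hilbert space the \<open>M i l\<close> are merely positive; winning yields
  operator identities at \<psi> alone. Operators commuting with all \<open>M i l\<close> carry these
  identities along the orbit of \<psi>, but that orbit need not be closed. Representations are
  therefore developed on inner product spaces without completeness, and the C*-seminorm that is
  compared with the universal norm is the operator norm on such a space. The two hypotheses enter at
  different levels. Commutativity for \<open>H\<close> is a statement about operators and is what
  allows \<psi> to be split; classicality for \<open>G\<close> is a statement about numbers, so it
  can only be applied afterwards, to the correlation seen from each piece of \<psi>. That
  correlation must live on the type \<open>nat \<Rightarrow> complex\<close>, which is why an
  arbitrary model is first moved there. Both products are treated at once through a function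
  \<open>F\<close> giving the eigenvalue of \<open>x \<otimes> y\<close>: a sum or a product. The
  spectral condition says that \<open>F\<close> is injective on pairs of eigenvalues. Commutation of
  operator matrices is reduced to real matrices by testing against vectors.\<close>

lemma nonneg_quadratic_imp_linear_coeff_0:
  fixes a b :: real
  assumes q: "\<And>t. 0 \<le> 2 * t * a + t * t * b" and a: "0 \<le> a" and b: "0 \<le> b"
  shows "a = 0"
proof -
  \<comment> \<open>At t = -a / (b + 1), where b + 1 stays positive even for b = 0, the quadratic
    has numerator -a^2 (b + 2).\<close>
  have "0 \<le> (- 2 * a * a * (b + 1) + a * a * b) / (b + 1)\<^sup>2"
    using q [of "- a / (b + 1)"] b by (simp add: divide_simps power2_eq_square)
  then have "0 \<le> - 2 * a * a * (b + 1) + a * a * b"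
    using b by (simp add: zero_le_divide_iff)
  then have "a * a * (b + 2) \<le> 0" by (simp add: algebra_simps)
  then show ?thesis using b by (auto simp: mult_le_0_iff zero_le_mult_iff)
qed

section \<open>Complex inner product spaces\<close>

text \<open>The vectors form a subset \<open>V\<close> of an ambient group so that passing to an
  invariant subspace changes only \<open>V\<close>, not the operators or the inner product.
  Completeness is split off into \<open>hilb\<close> because such a subspace need not be
  closed.\<close>

locale ip_space = vector_space sc
  for sc :: "complex \<Rightarrow> 'x::ab_group_add \<Rightarrow> 'x" +
  fixes V :: "'x set" and ip :: "'x \<Rightarrow> 'x \<Rightarrow> complex"
  assumes sub: "subspace V"
    and ip_cnj: "x \<in> V \<Longrightarrow> y \<in> V \<Longrightarrow> ip x y = cnj (ip y x)"
    and ip_add: "x \<in> V \<Longrightarrow> y \<in> V \<Longrightarrow> z \<in> V \<Longrightarrow> ip x (y + z) = ip x y + ip x z"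
    and ip_sc: "x \<in> V \<Longrightarrow> y \<in> V \<Longrightarrow> ip x (sc c y) = c * ip x y"
    and ip_pos: "x \<in> V \<Longrightarrow> x \<noteq> 0 \<Longrightarrow> 0 < Re (ip x x)"
begin

lemma zeroV [simp]: "0 \<in> V"
  and addV [simp]: "x \<in> V \<Longrightarrow> y \<in> V \<Longrightarrow> x + y \<in> V"
  and scV [simp]: "x \<in> V \<Longrightarrow> sc c x \<in> V"
  and diffV [simp]: "x \<in> V \<Longrightarrow> y \<in> V \<Longrightarrow> x - y \<in> V"
  and sumV [simp]: "(\<And>i. i \<in> A \<Longrightarrow> f i \<in> V) \<Longrightarrow> sum f A \<in> V"
  using sub by (auto simp: subspace_0 subspace_add subspace_scale subspace_diff subspace_sum)

lemma ip_0_right [simp]: "x \<in> V \<Longrightarrow> ip x 0 = 0"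
  using ip_sc [of x 0 0] by simp

lemma ip_0_left [simp]: "x \<in> V \<Longrightarrow> ip 0 x = 0"
  using ip_cnj [of 0 x] by simp

lemma ip_add_left: "x \<in> V \<Longrightarrow> y \<in> V \<Longrightarrow> z \<in> V \<Longrightarrow> ip (y + z) x = ip y x + ip z x"
  using ip_cnj [of "y + z" x] ip_cnj [of y x] ip_cnj [of z x] by (simp add: ip_add)

lemma ip_sc_left: "x \<in> V \<Longrightarrow> y \<in> V \<Longrightarrow> ip (sc c y) x = cnj c * ip y x"
  using ip_cnj [of "sc c y" x] ip_cnj [of y x] by (simp add: ip_sc)

lemma ip_diff: "x \<in> V \<Longrightarrow> y \<in> V \<Longrightarrow> z \<in> V \<Longrightarrow> ip x (y - z) = ip x y - ip x z"
  using ip_add [of x "y - z" z] by (simp add: algebra_simps)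

lemma ip_diff_left: "x \<in> V \<Longrightarrow> y \<in> V \<Longrightarrow> z \<in> V \<Longrightarrow> ip (y - z) x = ip y x - ip z x"
  using ip_add_left [of x "y - z" z] by (simp add: algebra_simps)

lemma ip_sum: "x \<in> V \<Longrightarrow> (\<And>i. i \<in> A \<Longrightarrow> f i \<in> V) \<Longrightarrow> ip x (sum f A) = (\<Sum>i\<in>A. ip x (f i))"
  by (induction A rule: infinite_finite_induct) (simp_all add: ip_add)

lemma ip_sum_left:
  "x \<in> V \<Longrightarrow> (\<And>i. i \<in> A \<Longrightarrow> f i \<in> V) \<Longrightarrow> ip (sum f A) x = (\<Sum>i\<in>A. ip (f i) x)"
  by (induction A rule: infinite_finite_induct) (simp_all add: ip_add_left)

lemma ip_nonneg: "x \<in> V \<Longrightarrow> 0 \<le> Re (ip x x)"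
  using ip_pos [of x] by (cases "x = 0") auto

lemma ip_zero_iff: "x \<in> V \<Longrightarrow> Re (ip x x) = 0 \<longleftrightarrow> x = 0"
  using ip_pos [of x] by (cases "x = 0") auto

text \<open>Testing with z = x - y makes the real part a squared norm, so real parts suffice. This
  is how operator identities are later read off from real matrices.\<close>

lemma eq_by_ip:
  assumes "x \<in> V" "y \<in> V" "\<And>z. z \<in> V \<Longrightarrow> Re (ip z x) = Re (ip z y)"
  shows "x = y"
  using assms(3) [of "x - y"] ip_zero_iff [of "x - y"] assms by (simp add: ip_diff)

lemma Re_ip_commute: "x \<in> V \<Longrightarrow> y \<in> V \<Longrightarrow> Re (ip x y) = Re (ip y x)"
  using ip_cnj [of x y] by simp

lemma Re_Cauchy_Schwarz:
  assumes "x \<in> V" "y \<in> V"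
  shows "(Re (ip x y))\<^sup>2 \<le> Re (ip x x) * Re (ip y y)"
proof (cases "y = 0")
  case True
  then show ?thesis using assms by simp
next
  case False
  define a where "a = Re (ip y y)"
  define b where "b = Re (ip x y)"
  have a: "a > 0" using ip_pos [of y] assms False by (simp add: a_def)
  define t where "t = b / a"
  define z where "z = x - sc (of_real t) y"
  have z: "z \<in> V" using assms by (simp add: z_def)
  have "0 \<le> Re (ip z z)" by (rule ip_nonneg [OF z])
  also have "Re (ip z z) = Re (ip x x) - 2 * t * b + t * t * a"
    using assms Re_ip_commute [of x y]
    by (simp add: z_def ip_diff ip_diff_left ip_sc ip_sc_left a_def b_def algebra_simps)
  also have "\<dots> = Re (ip x x) - b\<^sup>2 / a"
    using a by (simp add: t_def power2_eq_square field_simps)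
  finally show ?thesis
    using a by (simp add: field_simps a_def [symmetric] b_def [symmetric])
qed

definition nrm :: "'x \<Rightarrow> real" where "nrm x = sqrt (Re (ip x x))"

lemma nrm_0 [simp]: "nrm 0 = 0"
  by (simp add: nrm_def)

lemma nrm_nonneg: "x \<in> V \<Longrightarrow> 0 \<le> nrm x"
  by (simp add: nrm_def ip_nonneg)

lemma nrm_sq: "x \<in> V \<Longrightarrow> (nrm x)\<^sup>2 = Re (ip x x)"
  by (simp add: nrm_def ip_nonneg)

lemma nrm_sc: "x \<in> V \<Longrightarrow> nrm (sc c x) = cmod c * nrm x"
proof -
  assume x: "x \<in> V"
  have "ip (sc c x) (sc c x) = of_real ((cmod c)\<^sup>2) * ip x x"
    using x complex_norm_square [of c] by (simp add: ip_sc ip_sc_left mult_ac)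
  then have "Re (ip (sc c x) (sc c x)) = (cmod c)\<^sup>2 * Re (ip x x)"
    by (simp only: Re_complex_of_real times_complex.simps Im_complex_of_real)
  then show ?thesis
    by (simp add: nrm_def real_sqrt_mult)
qed

lemma Re_ip_le: "x \<in> V \<Longrightarrow> y \<in> V \<Longrightarrow> \<bar>Re (ip x y)\<bar> \<le> nrm x * nrm y"
  using real_sqrt_le_mono [OF Re_Cauchy_Schwarz [of x y]] by (simp add: nrm_def real_sqrt_mult)

lemma nrm_triangle: "x \<in> V \<Longrightarrow> y \<in> V \<Longrightarrow> nrm (x + y) \<le> nrm x + nrm y"
proof (rule power2_le_imp_le)
  assume xy: "x \<in> V" "y \<in> V"
  then have "(nrm (x + y))\<^sup>2 = (nrm x)\<^sup>2 + 2 * Re (ip x y) + (nrm y)\<^sup>2"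
    using Re_ip_commute [of x y] by (simp add: nrm_sq ip_add ip_add_left)
  also have "\<dots> \<le> (nrm x + nrm y)\<^sup>2"
    using Re_ip_le [OF xy] by (simp add: power2_sum)
  finally show "(nrm (x + y))\<^sup>2 \<le> (nrm x + nrm y)\<^sup>2" .
  show "0 \<le> nrm x + nrm y" using xy by (simp add: nrm_nonneg)
qed

lemma nrm_sum:
  "(\<And>i. i \<in> A \<Longrightarrow> f i \<in> V) \<Longrightarrow> nrm (sum f A) \<le> (\<Sum>i\<in>A. nrm (f i))"
proof (induction A rule: infinite_finite_induct)
  case (insert a A)
  then show ?case using nrm_triangle [of "f a" "sum f A"] by simp
qed simp_all

lemma ip_lim_zero:
  assumes z: "z \<in> V" and X: "\<And>n. X n \<in> V" "\<And>n. ip z (X n) = 0"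
    and x: "x \<in> V" "(\<lambda>n. nrm (X n - x)) \<longlonglongrightarrow> 0"
  shows "ip z x = 0"
proof -
  \<comment> \<open>\<open>Re_ip_le\<close> bounds real parts only; the multiples of z by 1 and \<i>
    recover the real and the imaginary part of \<open>ip z x\<close>.\<close>
  have *: "Re (ip (sc c z) x) = 0" for c
  proof -
    have "norm (Re (ip (sc c z) x)) \<le> nrm (sc c z) * nrm (X n - x)" for n
      using Re_ip_le [of "sc c z" "X n - x"] z X x by (simp add: ip_diff ip_sc_left)
    moreover have "(\<lambda>n. nrm (sc c z) * nrm (X n - x)) \<longlonglongrightarrow> 0"
      using x(2) by (rule tendsto_mult_right_zero)
    ultimately have "(\<lambda>n::nat. Re (ip (sc c z) x)) \<longlonglongrightarrow> 0"
      using Lim_null_comparison [of "\<lambda>n. Re (ip (sc c z) x)" "\<lambda>n. nrm (sc c z) * nrm (X n - x)" sequentially]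
      by simp
    then show ?thesis by (simp add: LIMSEQ_const_iff)
  qed
  then show ?thesis
    using * [of 1] * [of "\<i>"] z x by (simp add: ip_sc_left complex_eq_iff)
qed

definition lin_op :: "('x \<Rightarrow> 'x) \<Rightarrow> bool" where
  "lin_op T \<longleftrightarrow> (\<forall>x\<in>V. T x \<in> V) \<and> (\<forall>x\<in>V. \<forall>y\<in>V. T (x + y) = T x + T y) \<and>
     (\<forall>x\<in>V. \<forall>c. T (sc c x) = sc c (T x))"

lemma lin_opD:
  assumes "lin_op T"
  shows "x \<in> V \<Longrightarrow> T x \<in> V"
    and "x \<in> V \<Longrightarrow> y \<in> V \<Longrightarrow> T (x + y) = T x + T y"
    and "x \<in> V \<Longrightarrow> T (sc c x) = sc c (T x)"
  using assms by (auto simp: lin_op_def)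

lemma lin_op_0: "lin_op T \<Longrightarrow> T 0 = 0"
  using lin_opD(3) [of T 0 0] by simp

lemma lin_op_diff: "lin_op T \<Longrightarrow> x \<in> V \<Longrightarrow> y \<in> V \<Longrightarrow> T (x - y) = T x - T y"
  using lin_opD(2) [of T "x - y" y] by (simp add: algebra_simps)

lemma lin_op_sum:
  "lin_op T \<Longrightarrow> (\<And>i. i \<in> A \<Longrightarrow> f i \<in> V) \<Longrightarrow> T (sum f A) = (\<Sum>i\<in>A. T (f i))"
  by (induction A rule: infinite_finite_induct) (simp_all add: lin_op_0 lin_opD)

lemma lin_op_comp: "lin_op S \<Longrightarrow> lin_op T \<Longrightarrow> lin_op (\<lambda>x. S (T x))"
  by (auto simp: lin_op_def)

lemma lin_op_sumI: "(\<And>i. i \<in> A \<Longrightarrow> lin_op (T i)) \<Longrightarrow> lin_op (\<lambda>x. \<Sum>i\<in>A. T i x)"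
  unfolding lin_op_def by (auto simp: sum.distrib scale_sum_right)

definition pos_op :: "('x \<Rightarrow> 'x) \<Rightarrow> bool" where
  "pos_op T \<longleftrightarrow> lin_op T \<and> (\<exists>B. \<forall>x\<in>V. nrm (T x) \<le> B * nrm x) \<and>
     (\<forall>x\<in>V. ip x (T x) \<in> \<real> \<and> 0 \<le> Re (ip x (T x)))"

lemma pos_op_lin: "pos_op T \<Longrightarrow> lin_op T"
  by (simp add: pos_op_def)

lemma pos_op_ip: "pos_op T \<Longrightarrow> x \<in> V \<Longrightarrow> ip x (T x) \<in> \<real>" "pos_op T \<Longrightarrow> x \<in> V \<Longrightarrow> 0 \<le> Re (ip x (T x))"
  by (auto simp: pos_op_def)

lemma pos_op_sum:
  assumes "\<And>i. i \<in> A \<Longrightarrow> pos_op (T i)"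
  shows "pos_op (\<lambda>x. \<Sum>i\<in>A. T i x)"
  unfolding pos_op_def
proof (intro conjI ballI)
  have lin: "lin_op (T i)" if "i \<in> A" for i using assms that pos_op_lin by blast
  show "lin_op (\<lambda>x. \<Sum>i\<in>A. T i x)" using lin by (rule lin_op_sumI)
  obtain B where B: "\<And>i x. i \<in> A \<Longrightarrow> x \<in> V \<Longrightarrow> nrm (T i x) \<le> B i * nrm x"
    using assms unfolding pos_op_def by metis
  have "nrm (\<Sum>i\<in>A. T i x) \<le> (\<Sum>i\<in>A. B i) * nrm x" if "x \<in> V" for x
  proof -
    have "nrm (\<Sum>i\<in>A. T i x) \<le> (\<Sum>i\<in>A. nrm (T i x))"
      using lin_opD(1) [OF lin] that by (intro nrm_sum) auto
    also have "\<dots> \<le> (\<Sum>i\<in>A. B i * nrm x)" using B that by (intro sum_mono) auto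
    finally show ?thesis by (simp add: sum_distrib_right)
  qed
  then show "\<exists>B. \<forall>x\<in>V. nrm (\<Sum>i\<in>A. T i x) \<le> B * nrm x" by blast
  fix x assume x: "x \<in> V"
  have "ip x (\<Sum>i\<in>A. T i x) = (\<Sum>i\<in>A. ip x (T i x))"
    using lin_opD(1) [OF lin] x by (intro ip_sum) auto
  then show "ip x (\<Sum>i\<in>A. T i x) \<in> \<real>" "0 \<le> Re (ip x (\<Sum>i\<in>A. T i x))"
    using pos_op_ip assms x by (auto intro!: sum_nonneg)
qed

text \<open>Polarization: evaluate the form at \<open>x + y\<close> and \<open>x + \<i>y\<close>.\<close>

lemma pos_op_selfadj:
  assumes T: "pos_op T" and x: "x \<in> V" and y: "y \<in> V"
  shows "ip x (T y) = ip (T x) y"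
proof -
  note lin = pos_op_lin [OF T]
  have Tx: "T x \<in> V" "T y \<in> V" using lin_opD(1) [OF lin] x y by auto
  have real: "Im (ip z (T z)) = 0" if "z \<in> V" for z
    using pos_op_ip(1) [OF T that] by (simp add: complex_is_Real_iff)
  have "ip (x + y) (T (x + y)) = ip x (T x) + ip x (T y) + ip y (T x) + ip y (T y)"
    using x y Tx by (simp add: lin_opD [OF lin] ip_add ip_add_left)
  with real [of "x + y"] real [of x] real [of y] x y
  have im: "Im (ip x (T y)) + Im (ip y (T x)) = 0" by simp
  have "ip (x + sc \<i> y) (T (x + sc \<i> y)) = ip x (T x) + \<i> * ip x (T y) - \<i> * ip y (T x) + ip y (T y)"
    using x y Tx by (simp add: lin_opD [OF lin] ip_add ip_add_left ip_sc ip_sc_left algebra_simps)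
  with real [of "x + sc \<i> y"] real [of x] real [of y] x y
  have re: "Re (ip x (T y)) - Re (ip y (T x)) = 0" by simp
  have "ip x (T y) = cnj (ip y (T x))"
    using im re by (simp add: complex_eq_iff)
  then show ?thesis using ip_cnj [of "T x" y] Tx y by simp
qed

text \<open>The nonnegative form of \<open>T\<close> attains its minimum 0 at x, so its first
  variation in the direction \<open>T x\<close>, which is twice the squared norm of
  \<open>T x\<close>, must vanish.\<close>

lemma pos_op_null:
  assumes T: "pos_op T" and x: "x \<in> V" and 0: "Re (ip x (T x)) = 0"
  shows "T x = 0"
proof -
  note lin = pos_op_lin [OF T]
  define y where "y = T x"
  have y: "y \<in> V" "T y \<in> V" using lin_opD(1) [OF lin] x by (auto simp: y_def)
  define a where "a = Re (ip y y)"
  define b where "b = Re (ip y (T y))"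
  have b: "b \<ge> 0" using pos_op_ip(2) [OF T y(1)] by (simp add: b_def)
  have a: "a \<ge> 0" using ip_nonneg [OF y(1)] by (simp add: a_def)
  have "0 \<le> 2 * t * a + t * t * b" for t :: real
  proof -
    have "ip x (T y) = ip y y" using pos_op_selfadj [OF T x y(1)] by (simp add: y_def)
    then have "Re (ip (x + sc (of_real t) y) (T (x + sc (of_real t) y))) = 2 * t * a + t * t * b"
      using x y 0 by (simp add: lin_opD [OF lin] ip_add ip_add_left ip_sc ip_sc_left a_def b_def
          y_def [symmetric] algebra_simps)
    then show ?thesis using pos_op_ip(2) [OF T, of "x + sc (of_real t) y"] x y by simp
  qed
  from nonneg_quadratic_imp_linear_coeff_0 [OF this a b] have "a = 0" .
  then show ?thesis using ip_zero_iff [OF y(1)] by (simp add: a_def y_def)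
qed

end

locale hilb = ip_space +
  assumes complete: "(\<And>n. X n \<in> V) \<Longrightarrow> (\<And>e. e > 0 \<Longrightarrow> \<exists>N::nat. \<forall>m\<ge>N. \<forall>n\<ge>N. nrm (X m - X n) < e) \<Longrightarrow>
    \<exists>x\<in>V. (\<lambda>n. nrm (X n - x)) \<longlonglongrightarrow> 0"

locale qmodel = hilb sc V ip
  for sc :: "complex \<Rightarrow> 'x::ab_group_add \<Rightarrow> 'x" and V ip +
  fixes \<psi> :: 'x and M N :: "'n::finite \<Rightarrow> 'n \<Rightarrow> 'x \<Rightarrow> 'x" and p :: "'n correlation"
  assumes psi: "\<psi> \<in> V" and psi1: "Re (ip \<psi> \<psi>) = 1"
    and M_pos: "pos_op (M i l)" and N_pos: "pos_op (N i l)"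
    and M_sum: "x \<in> V \<Longrightarrow> (\<Sum>l\<in>UNIV. M i l x) = x"
    and N_sum: "x \<in> V \<Longrightarrow> (\<Sum>l\<in>UNIV. N i l x) = x"
    and MN: "x \<in> V \<Longrightarrow> M i l (N j k x) = N j k (M i l x)"
    and p_eq: "of_real (p l k i j) = ip \<psi> (M i l (N j k \<psi>))"

section \<open>Realising correlations on function spaces\<close>

text \<open>A bare type \<open>'h\<close> carries no group structure of its own. Function spaces
  with pointwise operations do, so Hilbert spaces given by records are moved there.\<close>

definition fscale :: "complex \<Rightarrow> ('k \<Rightarrow> complex) \<Rightarrow> 'k \<Rightarrow> complex" where
  "fscale c f = (\<lambda>n. c * f n)"

lemma vector_space_fscale: "vector_space fscale"
  by standard (simp_all add: fscale_def fun_eq_iff algebra_simps)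

locale complex_hilbert =
  fixes S :: "'h hilbert_space"
  assumes chs: "complex_hilbert_space S"
begin

sublocale module complex_field S
  using chs by (simp add: complex_hilbert_space_def)

lemma ci_cnj: "x \<in> carrier S \<Longrightarrow> y \<in> carrier S \<Longrightarrow> cinner S x y = cnj (cinner S y x)"
  and ci_add: "x \<in> carrier S \<Longrightarrow> y \<in> carrier S \<Longrightarrow> z \<in> carrier S \<Longrightarrow>
      cinner S x (y \<oplus>\<^bsub>S\<^esub> z) = cinner S x y + cinner S x z"
  and ci_smult: "x \<in> carrier S \<Longrightarrow> y \<in> carrier S \<Longrightarrow> cinner S x (c \<odot>\<^bsub>S\<^esub> y) = c * cinner S x y"
  and ci_pos: "x \<in> carrier S \<Longrightarrow> x \<noteq> \<zero>\<^bsub>S\<^esub> \<Longrightarrow> 0 < Re (cinner S x x)"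
  using chs unfolding complex_hilbert_space_def by blast+

lemma ci_complete:
  assumes "\<And>n. X n \<in> carrier S"
    and "\<And>e. e > 0 \<Longrightarrow> \<exists>N::nat. \<forall>m\<ge>N. \<forall>n\<ge>N. hnorm S (X m \<ominus>\<^bsub>S\<^esub> X n) < e"
  shows "\<exists>x\<in>carrier S. (\<lambda>n. hnorm S (X n \<ominus>\<^bsub>S\<^esub> x)) \<longlonglongrightarrow> 0"
proof -
  have "(\<forall>n. X n \<in> carrier S) \<and>
      (\<forall>e>0. \<exists>N::nat. \<forall>m\<ge>N. \<forall>n\<ge>N. hnorm S (X m \<ominus>\<^bsub>S\<^esub> X n) < e) \<longrightarrow>
      (\<exists>x\<in>carrier S. (\<lambda>n. hnorm S (X n \<ominus>\<^bsub>S\<^esub> x)) \<longlonglongrightarrow> 0)"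
    using chs unfolding complex_hilbert_space_def by blast
  then show ?thesis using assms by simp
qed

lemma smultC [simp]: "x \<in> carrier S \<Longrightarrow> c \<odot>\<^bsub>S\<^esub> x \<in> carrier S"
  using smult_closed [of c x] by (simp add: complex_field_def)

lemma ci_zero: "x \<in> carrier S \<Longrightarrow> cinner S x \<zero>\<^bsub>S\<^esub> = 0"
  using ci_add [of x "\<zero>\<^bsub>S\<^esub>" "\<zero>\<^bsub>S\<^esub>"] by simp

text \<open>The Riesz-type map into functionals: as the inner product is linear in its second
  argument, the record's operations become pointwise ones, and positive definiteness makes the map
  injective. The value 0 off the carrier sends the zero vector to the zero function.\<close>

definition embed :: "'h \<Rightarrow> 'h \<Rightarrow> complex" where
  "embed x = (\<lambda>y. if y \<in> carrier S then cinner S y x else 0)"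

lemma embed_add: "x \<in> carrier S \<Longrightarrow> y \<in> carrier S \<Longrightarrow> embed (x \<oplus>\<^bsub>S\<^esub> y) = embed x + embed y"
  by (auto simp: embed_def fun_eq_iff ci_add)

lemma embed_smult: "x \<in> carrier S \<Longrightarrow> embed (c \<odot>\<^bsub>S\<^esub> x) = fscale c (embed x)"
  by (auto simp: embed_def fun_eq_iff ci_smult fscale_def)

lemma embed_zero: "embed \<zero>\<^bsub>S\<^esub> = 0"
  by (auto simp: embed_def fun_eq_iff ci_zero)

lemma embed_minus: "x \<in> carrier S \<Longrightarrow> y \<in> carrier S \<Longrightarrow> embed (x \<ominus>\<^bsub>S\<^esub> y) = embed x - embed y"
  using embed_add [of "x \<ominus>\<^bsub>S\<^esub> y" y] by (simp add: a_minus_def a_assoc l_neg)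

lemma embed_inj: "inj_on embed (carrier S)"
proof (rule inj_onI)
  fix x y assume x: "x \<in> carrier S" and y: "y \<in> carrier S" and eq: "embed x = embed y"
  define z where "z = x \<ominus>\<^bsub>S\<^esub> y"
  have z: "z \<in> carrier S" using x y by (simp add: z_def)
  have "embed z = 0" using embed_minus [OF x y] eq by (simp add: z_def)
  then have "cinner S z z = 0" using z by (metis embed_def zero_fun_apply)
  then have "z = \<zero>\<^bsub>S\<^esub>" using ci_pos [OF z] by auto
  then show "x = y" using x y by (metis z_def a_minus_def add.inv_closed minus_equality minus_minus)
qed

definition unembed :: "('h \<Rightarrow> complex) \<Rightarrow> 'h" where "unembed = inv_into (carrier S) embed"

lemma unembed_embed [simp]: "x \<in> carrier S \<Longrightarrow> unembed (embed x) = x"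
  by (simp add: unembed_def embed_inj)

lemma embed_finsum:
  "finite A \<Longrightarrow> (\<And>i. i \<in> A \<Longrightarrow> f i \<in> carrier S) \<Longrightarrow> embed (\<Oplus>\<^bsub>S\<^esub>i\<in>A. f i) = (\<Sum>i\<in>A. embed (f i))"
proof (induction A rule: finite_induct)
  case (insert a A)
  then have "(\<Oplus>\<^bsub>S\<^esub>i\<in>insert a A. f i) = f a \<oplus>\<^bsub>S\<^esub> (\<Oplus>\<^bsub>S\<^esub>i\<in>A. f i)"
    by (intro finsum_insert) auto
  then show ?case using insert by (simp add: embed_add finsum_closed Pi_def)
qed (simp add: embed_zero)

lemma hilb_embed: "hilb fscale (embed ` carrier S) (\<lambda>f g. cinner S (unembed f) (unembed g))"
proof -
  interpret vector_space fscale by (rule vector_space_fscale)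
  have "subspace (embed ` carrier S)"
    unfolding subspace_def using image_eqI [of 0 embed "\<zero>\<^bsub>S\<^esub>" "carrier S"]
    by (auto simp: embed_add [symmetric] embed_smult [symmetric] embed_zero)
  then interpret ip_space fscale "embed ` carrier S" "\<lambda>f g. cinner S (unembed f) (unembed g)"
    by unfold_locales
      (auto simp: embed_add [symmetric] embed_smult [symmetric] embed_zero [symmetric]
        ci_add ci_smult intro: ci_cnj ci_pos)
  have nrm_embed: "nrm (embed x) = hnorm S x" if "x \<in> carrier S" for x
    using that by (simp add: nrm_def hnorm_def)
  show ?thesis
  proof unfold_locales
    fix X assume X: "\<And>n::nat. X n \<in> embed ` carrier S"
      and cau: "\<And>e. 0 < e \<Longrightarrow> \<exists>N. \<forall>m\<ge>N. \<forall>n\<ge>N. nrm (X m - X n) < e"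
    define Y where "Y n = unembed (X n)" for n
    have Y: "Y n \<in> carrier S" "X n = embed (Y n)" for n
      using X [of n] by (auto simp: Y_def)
    have d: "nrm (X m - embed y) = hnorm S (Y m \<ominus>\<^bsub>S\<^esub> y)" if "y \<in> carrier S" for m y
      using that Y by (simp add: embed_minus [symmetric] nrm_embed)
    have "\<exists>x\<in>carrier S. (\<lambda>n. hnorm S (Y n \<ominus>\<^bsub>S\<^esub> x)) \<longlonglongrightarrow> 0"
      by (rule ci_complete) (use Y cau d in \<open>auto simp: Y(2)\<close>)
    then show "\<exists>x\<in>embed ` carrier S. (\<lambda>n. nrm (X n - x)) \<longlonglongrightarrow> 0"
      using d by auto
  qed
qed

end

lemma quantum_correlation_qmodel:
  assumes "quantum_correlation TYPE('h) p"
  shows "\<exists>V ip \<psi> M N. qmodel (fscale :: _ \<Rightarrow> ('h \<Rightarrow> complex) \<Rightarrow> _) V ip \<psi> M N p"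
proof -
  from assms obtain S :: "'h hilbert_space" and \<psi> M N where S: "complex_hilbert_space S"
    and psi: "\<psi> \<in> carrier S" "hnorm S \<psi> = 1"
    and M: "\<forall>i l. positive_operator S (M i l)" and N: "\<forall>j k. positive_operator S (N j k)"
    and Ms: "\<forall>i. \<forall>x\<in>carrier S. (\<Oplus>\<^bsub>S\<^esub>l\<in>UNIV. M i l x) = x"
    and Ns: "\<forall>i. \<forall>x\<in>carrier S. (\<Oplus>\<^bsub>S\<^esub>l\<in>UNIV. N i l x) = x"
    and MN: "\<forall>i l j k. \<forall>x\<in>carrier S. M i l (N j k x) = N j k (M i l x)"
    and p: "\<forall>l k i j. of_real (p l k i j) = cinner S \<psi> (M i l (N j k \<psi>))"
    unfolding quantum_correlation_def by (elim conjE exE) (rule that)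
  note M = M [rule_format] and N = N [rule_format] and Ms = Ms [rule_format]
    and Ns = Ns [rule_format] and MN = MN [rule_format] and p = p [rule_format]
  interpret S: complex_hilbert S by standard (rule S)
  interpret hilb fscale "S.embed ` carrier S" "\<lambda>f g. cinner S (S.unembed f) (S.unembed g)"
    by (rule S.hilb_embed)
  have nrm_embed: "nrm (S.embed x) = hnorm S x" if "x \<in> carrier S" for x
    using that by (simp add: nrm_def hnorm_def)
  define L where "L T f = S.embed (T (S.unembed f))" for T f
  have closed: "T x \<in> carrier S" if "positive_operator S T" "x \<in> carrier S" for T x
    using that by (auto simp: positive_operator_def bounded_operator_def)
  have L: "pos_op (L T)" if T: "positive_operator S T" for T
  proof -
    note c = closed [OF T]
    obtain B where B: "\<And>x. x \<in> carrier S \<Longrightarrow> hnorm S (T x) \<le> B * hnorm S x"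
      using T unfolding positive_operator_def bounded_operator_def by blast
    have "lin_op (L T)"
      using T c unfolding lin_op_def positive_operator_def bounded_operator_def
      by (auto simp: L_def S.embed_add [symmetric] S.embed_smult [symmetric])
    moreover have "\<exists>B. \<forall>f\<in>S.embed ` carrier S. nrm (L T f) \<le> B * nrm f"
      using c B by (intro exI [of _ B]) (auto simp: L_def nrm_embed)
    ultimately show ?thesis
      using T c unfolding pos_op_def positive_operator_def by (simp add: L_def)
  qed
  have "qmodel fscale (S.embed ` carrier S) (\<lambda>f g. cinner S (S.unembed f) (S.unembed g)) (S.embed \<psi>)
     (\<lambda>i l. L (M i l)) (\<lambda>i l. L (N i l)) p"
  proof unfold_locales
    show "Re (cinner S (S.unembed (S.embed \<psi>)) (S.unembed (S.embed \<psi>))) = 1"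
      using psi by (simp add: hnorm_def)
    show "(\<Sum>l\<in>UNIV. L (M i l) x) = x" if "x \<in> S.embed ` carrier S" for i x
      using that closed [OF M] by (auto simp: L_def S.embed_finsum [symmetric] Ms)
    show "(\<Sum>l\<in>UNIV. L (N i l) x) = x" if "x \<in> S.embed ` carrier S" for i x
      using that closed [OF N] by (auto simp: L_def S.embed_finsum [symmetric] Ns)
    show "L (M i l) (L (N j k) x) = L (N j k) (L (M i l) x)" if "x \<in> S.embed ` carrier S" for i l j k x
      using that closed [OF M] closed [OF N] MN by (auto simp: L_def)
    show "of_real (p l k i j) = cinner S (S.unembed (S.embed \<psi>)) (S.unembed (L (M i l) (L (N j k) (S.embed \<psi>))))" for l k i j
      using psi closed [OF M] closed [OF N] by (simp add: L_def p)
  qed (use psi L M N in auto)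
  then show ?thesis by blast
qed

text \<open>
  The vectors orthogonal to every vector orthogonal to all words applied to \<open>\<psi>\<close> form a closed
  invariant subspace, which a vector determines through its inner products with the countably many
  words.
\<close>

context qmodel
begin

definition word :: "(('n \<times> 'n) + ('n \<times> 'n)) list \<Rightarrow> 'x" where
  "word w = foldr (\<lambda>a. case a of Inl (i, l) \<Rightarrow> M i l | Inr (i, l) \<Rightarrow> N i l) w \<psi>"

definition word_closure :: "'x set" where
  "word_closure = {x \<in> V. \<forall>z\<in>V. (\<forall>w. ip z (word w) = 0) \<longrightarrow> ip z x = 0}"

definition coeffs :: "'x \<Rightarrow> nat \<Rightarrow> complex" where
  "coeffs x = (\<lambda>n. ip (word (from_nat n)) x)"

lemma word_V [simp]: "word w \<in> V"
proof (induction w)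
  case (Cons a w)
  have "word (a # w) = (case a of Inl (i, l) \<Rightarrow> M i l | Inr (i, l) \<Rightarrow> N i l) (word w)"
    by (simp add: word_def)
  then show ?case
    using Cons lin_opD(1) [OF pos_op_lin [OF M_pos]] lin_opD(1) [OF pos_op_lin [OF N_pos]]
    by (auto split: sum.split prod.split)
qed (simp add: word_def psi)

lemma word_closure_V: "x \<in> word_closure \<Longrightarrow> x \<in> V"
  by (simp add: word_closure_def)

lemma word_word_closure: "word w \<in> word_closure"
  by (auto simp: word_closure_def)

lemma psi_word_closure: "\<psi> \<in> word_closure"
  using word_word_closure [of "[]"] by (simp add: word_def)

text \<open>Self-adjointness moves \<open>T\<close> onto the test vector z, and \<open>T z\<close>
  is again orthogonal to all words because \<open>T\<close> maps words to words.\<close>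

lemma op_word_closure:
  assumes T: "pos_op T" and Tw: "\<And>w. T (word w) \<in> range word" and x: "x \<in> word_closure"
  shows "T x \<in> word_closure"
proof -
  note TV = lin_opD(1) [OF pos_op_lin [OF T]]
  have "ip z (T x) = 0" if z: "z \<in> V" "\<And>w. ip z (word w) = 0" for z
  proof -
    have "ip (T z) (word w) = 0" for w
      using pos_op_selfadj [OF T z(1) word_V [of w]] Tw [of w] z(2) by auto
    then have "ip (T z) x = 0" using x z TV by (auto simp: word_closure_def)
    then show ?thesis using pos_op_selfadj [OF T z(1)] word_closure_V [OF x] by simp
  qed
  then show ?thesis using x TV by (simp add: word_closure_def)
qed

lemma M_word_closure: "x \<in> word_closure \<Longrightarrow> M i l x \<in> word_closure" and N_word_closure: "x \<in> word_closure \<Longrightarrow> N i l x \<in> word_closure"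
proof -
  have "M i l (word w) = word (Inl (i, l) # w)" "N i l (word w) = word (Inr (i, l) # w)" for w
    by (simp_all add: word_def)
  then show "x \<in> word_closure \<Longrightarrow> M i l x \<in> word_closure" "x \<in> word_closure \<Longrightarrow> N i l x \<in> word_closure"
    using op_word_closure [OF M_pos] op_word_closure [OF N_pos] by (metis rangeI)+
qed

lemma subspace_word_closure: "subspace word_closure"
  by (auto simp: subspace_def word_closure_def ip_add ip_sc)

lemma coeffs_add: "x \<in> V \<Longrightarrow> y \<in> V \<Longrightarrow> coeffs (x + y) = coeffs x + coeffs y"
  by (auto simp: coeffs_def fun_eq_iff ip_add)

lemma coeffs_sc: "x \<in> V \<Longrightarrow> coeffs (sc c x) = fscale c (coeffs x)"
  by (auto simp: coeffs_def fun_eq_iff ip_sc fscale_def)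

lemma coeffs_diff: "x \<in> V \<Longrightarrow> y \<in> V \<Longrightarrow> coeffs (x - y) = coeffs x - coeffs y"
  by (auto simp: coeffs_def fun_eq_iff ip_diff)

lemma coeffs_0: "coeffs 0 = 0"
  by (auto simp: coeffs_def fun_eq_iff)

lemma coeffs_inj: "inj_on coeffs word_closure"
proof (rule inj_onI)
  fix x y assume x: "x \<in> word_closure" and y: "y \<in> word_closure" and eq: "coeffs x = coeffs y"
  have z: "x - y \<in> word_closure" using x y subspace_word_closure subspace_diff by blast
  have "coeffs (x - y) = 0" using eq x y by (simp add: coeffs_diff word_closure_V)
  then have "ip (word (from_nat n)) (x - y) = 0" for n
    by (metis coeffs_def zero_fun_apply)
  then have "ip (word w) (x - y) = 0" for w
    by (metis from_nat_to_nat)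
  then have "ip (x - y) (word w) = 0" for w
    using ip_cnj [of "x - y" "word w"] word_closure_V [OF z] by simp
  then have "ip (x - y) (x - y) = 0" using z by (auto simp: word_closure_def)
  then show "x = y" using ip_zero_iff [OF word_closure_V [OF z]] by simp
qed

definition of_coeffs :: "(nat \<Rightarrow> complex) \<Rightarrow> 'x" where "of_coeffs = inv_into word_closure coeffs"

lemma of_coeffs [simp]: "x \<in> word_closure \<Longrightarrow> of_coeffs (coeffs x) = x"
  by (simp add: of_coeffs_def coeffs_inj)

lemma coeffs_sum: "(\<And>i. i \<in> A \<Longrightarrow> f i \<in> V) \<Longrightarrow> coeffs (sum f A) = (\<Sum>i\<in>A. coeffs (f i))"
  by (induction A rule: infinite_finite_induct) (simp_all add: coeffs_0 coeffs_add)

text \<open>Completeness is inherited because \<open>word_closure\<close> is a double orthogonal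
  complement: by \<open>ip_lim_zero\<close> a limit taken in \<open>V\<close> satisfies the same
  orthogonality conditions.\<close>

lemma hilb_coeffs: "hilb fscale (coeffs ` word_closure) (\<lambda>f g. ip (of_coeffs f) (of_coeffs g))"
proof -
  interpret F: vector_space "fscale :: _ \<Rightarrow> (nat \<Rightarrow> complex) \<Rightarrow> _" by (rule vector_space_fscale)
  have word_closure: "0 \<in> word_closure" "x \<in> word_closure \<Longrightarrow> y \<in> word_closure \<Longrightarrow> x + y \<in> word_closure" "x \<in> word_closure \<Longrightarrow> sc c x \<in> word_closure"
    "x \<in> word_closure \<Longrightarrow> y \<in> word_closure \<Longrightarrow> x - y \<in> word_closure" for x y c
    using subspace_word_closure by (auto simp: subspace_0 subspace_add subspace_scale subspace_diff)
  have "F.subspace (coeffs ` word_closure)"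
    unfolding F.subspace_def using word_closure word_closure_V image_eqI [of 0 coeffs 0 word_closure]
    by (auto simp: coeffs_add [symmetric] coeffs_sc [symmetric] coeffs_0)
  then interpret C: ip_space fscale "coeffs ` word_closure" "\<lambda>f g. ip (of_coeffs f) (of_coeffs g)"
    using word_closure by unfold_locales
      (auto simp: coeffs_add [symmetric] coeffs_sc [symmetric] word_closure_V ip_add ip_sc coeffs_0
         intro: ip_cnj ip_pos)
  have nrm_coeffs: "C.nrm (coeffs x) = nrm x" if "x \<in> word_closure" for x
    using that by (simp add: nrm_def C.nrm_def)
  show ?thesis
  proof unfold_locales
    fix X assume X: "\<And>n::nat. X n \<in> coeffs ` word_closure"
      and cau: "\<And>e. 0 < e \<Longrightarrow> \<exists>N. \<forall>m\<ge>N. \<forall>n\<ge>N. C.nrm (X m - X n) < e"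
    define Y where "Y n = of_coeffs (X n)" for n
    have Y: "Y n \<in> word_closure" "X n = coeffs (Y n)" for n
      using X [of n] by (auto simp: Y_def)
    have d: "C.nrm (X m - coeffs y) = nrm (Y m - y)" if "y \<in> word_closure" for m y
      using that Y word_closure word_closure_V by (simp add: coeffs_diff [symmetric] nrm_coeffs)
    have "\<exists>x\<in>V. (\<lambda>n. nrm (Y n - x)) \<longlonglongrightarrow> 0"
      by (rule complete) (use Y cau d word_closure_V in \<open>auto simp: Y(2)\<close>)
    then obtain x where x: "x \<in> V" "(\<lambda>n. nrm (Y n - x)) \<longlonglongrightarrow> 0" by blast
    have "ip z x = 0" if "z \<in> V" "\<And>w. ip z (word w) = 0" for z
      using Y(1) that by (intro ip_lim_zero [OF that(1) _ _ x]) (auto simp: word_closure_def)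
    then have "x \<in> word_closure" using x by (simp add: word_closure_def)
    then show "\<exists>x\<in>coeffs ` word_closure. (\<lambda>n. C.nrm (X n - x)) \<longlonglongrightarrow> 0"
      using d x by auto
  qed
qed

lemma qmodel_coeffs:
  "\<exists>V ip \<psi> M N. qmodel (fscale :: _ \<Rightarrow> (nat \<Rightarrow> complex) \<Rightarrow> _) V ip \<psi> M N p"
proof -
  interpret C: hilb fscale "coeffs ` word_closure" "\<lambda>f g. ip (of_coeffs f) (of_coeffs g)"
    by (rule hilb_coeffs)
  have nrm_coeffs: "C.nrm (coeffs x) = nrm x" if "x \<in> word_closure" for x
    using that by (simp add: nrm_def C.nrm_def)
  define L where "L T f = coeffs (T (of_coeffs f))" for T f
  have word_closure: "x \<in> word_closure \<Longrightarrow> y \<in> word_closure \<Longrightarrow> x + y \<in> word_closure" "x \<in> word_closure \<Longrightarrow> sc c x \<in> word_closure" for x y c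
    using subspace_word_closure by (auto simp: subspace_add subspace_scale)
  have L: "C.pos_op (L T)" if T: "pos_op T" and c: "\<And>x. x \<in> word_closure \<Longrightarrow> T x \<in> word_closure" for T
  proof -
    obtain B where B: "\<And>x. x \<in> V \<Longrightarrow> nrm (T x) \<le> B * nrm x"
      using T by (auto simp: pos_op_def)
    have "C.lin_op (L T)"
      using c word_closure_V word_closure lin_opD [OF pos_op_lin [OF T]] unfolding C.lin_op_def
      by (auto simp: L_def coeffs_add [symmetric] coeffs_sc [symmetric])
    moreover have "\<exists>B. \<forall>f\<in>coeffs ` word_closure. C.nrm (L T f) \<le> B * C.nrm f"
      using c B word_closure_V by (intro exI [of _ B]) (auto simp: L_def nrm_coeffs)
    ultimately show ?thesis
      using T c word_closure_V unfolding pos_op_def C.pos_op_def by (simp add: L_def)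
  qed
  have "qmodel fscale (coeffs ` word_closure) (\<lambda>f g. ip (of_coeffs f) (of_coeffs g)) (coeffs \<psi>)
     (\<lambda>i l. L (M i l)) (\<lambda>i l. L (N i l)) p"
  proof unfold_locales
    show "(\<Sum>l\<in>UNIV. L (M i l) x) = x" if "x \<in> coeffs ` word_closure" for i x
      using that M_word_closure word_closure_V by (auto simp: L_def coeffs_sum [symmetric] M_sum)
    show "(\<Sum>l\<in>UNIV. L (N i l) x) = x" if "x \<in> coeffs ` word_closure" for i x
      using that N_word_closure word_closure_V by (auto simp: L_def coeffs_sum [symmetric] N_sum)
    show "L (M i l) (L (N j k) x) = L (N j k) (L (M i l) x)" if "x \<in> coeffs ` word_closure" for i l j k x
      using that M_word_closure N_word_closure MN word_closure_V by (auto simp: L_def)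
    show "of_real (p l k i j) = ip (of_coeffs (coeffs \<psi>)) (of_coeffs (L (M i l) (L (N j k) (coeffs \<psi>))))" for l k i j
      using psi_word_closure M_word_closure N_word_closure by (simp add: L_def p_eq)
  qed (use psi_word_closure psi1 L M_pos N_pos M_word_closure N_word_closure in auto)
  then show ?thesis by blast
qed

end

definition fun_space ::
    "('k \<Rightarrow> complex) set \<Rightarrow> (('k \<Rightarrow> complex) \<Rightarrow> ('k \<Rightarrow> complex) \<Rightarrow> complex) \<Rightarrow> ('k \<Rightarrow> complex) hilbert_space" where
  "fun_space V ip =
    \<lparr>carrier = V, mult = (\<lambda>_ _. 0), one = 0, zero = 0, add = (+), smult = fscale, cinner = ip\<rparr>"

lemma fun_space_simps [simp]:
  "carrier (fun_space V ip) = V" "zero (fun_space V ip) = 0" "add (fun_space V ip) = (+)"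
  "smult (fun_space V ip) = fscale" "cinner (fun_space V ip) = ip"
  by (simp_all add: fun_space_def)

context
  fixes V and ip :: "('k \<Rightarrow> complex) \<Rightarrow> ('k \<Rightarrow> complex) \<Rightarrow> complex"
  assumes h: "hilb fscale V ip"
begin

interpretation hilb fscale V ip by (rule h)

lemma module_fun_space: "module complex_field (fun_space V ip)"
proof (rule moduleI)
  show "cring complex_field" by (rule cring_complex_field)
  show "abelian_group (fun_space V ip)"
  proof (rule abelian_groupI)
    fix x assume "x \<in> carrier (fun_space V ip)"
    then show "\<exists>y\<in>carrier (fun_space V ip). y \<oplus>\<^bsub>fun_space V ip\<^esub> x = \<zero>\<^bsub>fun_space V ip\<^esub>"
      using scV [of x "- 1"] by (intro bexI [of _ "- x"]) auto
  qed (auto simp: add_ac)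
qed (simp_all add: complex_field_def scale_left_distrib scale_right_distrib)

interpretation F: module complex_field "fun_space V ip" by (rule module_fun_space)

lemma fun_space_minus: "x \<in> V \<Longrightarrow> y \<in> V \<Longrightarrow> x \<ominus>\<^bsub>fun_space V ip\<^esub> y = x - y"
proof -
  assume x: "x \<in> V" and y: "y \<in> V"
  have "- y \<in> V" using y scV [of y "- 1"] by simp
  then have "\<ominus>\<^bsub>fun_space V ip\<^esub> y = - y"
    using y by (intro F.minus_equality) auto
  then show ?thesis by (simp add: a_minus_def)
qed

lemma fun_space_hnorm: "hnorm (fun_space V ip) = nrm"
  by (simp add: fun_eq_iff hnorm_def nrm_def)

lemma fun_space_finsum:
  "finite A \<Longrightarrow> (\<And>i. i \<in> A \<Longrightarrow> f i \<in> V) \<Longrightarrow> (\<Oplus>\<^bsub>fun_space V ip\<^esub>i\<in>A. f i) = (\<Sum>i\<in>A. f i)"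
proof (induction A rule: finite_induct)
  case (insert a A)
  then have "(\<Oplus>\<^bsub>fun_space V ip\<^esub>i\<in>insert a A. f i) = f a \<oplus>\<^bsub>fun_space V ip\<^esub> (\<Oplus>\<^bsub>fun_space V ip\<^esub>i\<in>A. f i)"
    by (intro F.finsum_insert) auto
  then show ?case using insert by simp
qed simp

lemma complex_hilbert_space_fun_space: "complex_hilbert_space (fun_space V ip)"
  unfolding complex_hilbert_space_def
proof (intro conjI allI impI)
  fix X assume "(\<forall>n. X n \<in> carrier (fun_space V ip)) \<and>
    (\<forall>e>0. \<exists>N::nat. \<forall>m\<ge>N. \<forall>n\<ge>N. hnorm (fun_space V ip) (X m \<ominus>\<^bsub>fun_space V ip\<^esub> X n) < e)"
  then have X: "\<And>n. X n \<in> V"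
    and "\<forall>e>0. \<exists>N::nat. \<forall>m\<ge>N. \<forall>n\<ge>N. hnorm (fun_space V ip) (X m \<ominus>\<^bsub>fun_space V ip\<^esub> X n) < e"
    by auto
  then have "\<forall>e>0. \<exists>N::nat. \<forall>m\<ge>N. \<forall>n\<ge>N. nrm (X m - X n) < e"
    by (simp add: fun_space_minus [OF X X] fun_space_hnorm)
  then have "\<exists>x\<in>V. (\<lambda>n. nrm (X n - x)) \<longlonglongrightarrow> 0"
    by (intro complete X) blast
  then show "\<exists>x\<in>carrier (fun_space V ip).
      (\<lambda>n. hnorm (fun_space V ip) (X n \<ominus>\<^bsub>fun_space V ip\<^esub> x)) \<longlonglongrightarrow> 0"
    using X by (auto simp: fun_space_minus fun_space_hnorm)
qed (auto simp: module_fun_space ip_add ip_sc intro: ip_cnj ip_pos)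

lemma positive_operator_fun_space: "pos_op T \<Longrightarrow> positive_operator (fun_space V ip) T"
  by (auto simp: pos_op_def lin_op_def positive_operator_def bounded_operator_def fun_space_hnorm)

end

text \<open>The way back to \<open>quantum_correlation\<close>: the correlation of the first factor
  is built as a \<open>qmodel\<close>, while the hypothesis on \<open>G\<close> speaks of quantum
  correlations.\<close>

lemma qmodel_quantum_correlation:
  fixes p :: "'n::finite correlation" and V :: "('k \<Rightarrow> complex) set"
  assumes "qmodel fscale V ip \<psi> M N p" and "correlation p"
  shows "quantum_correlation TYPE('k \<Rightarrow> complex) p"
proof -
  interpret qmodel fscale V ip \<psi> M N p by fact
  note h = hilb_axioms
  have V: "M i l x \<in> V" "N i l x \<in> V" if "x \<in> V" for i l x
    using that lin_opD(1) [OF pos_op_lin] M_pos N_pos by blast+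
  show ?thesis
    unfolding quantum_correlation_def
    by (intro conjI assms(2) exI [of _ "fun_space V ip"] exI [of _ \<psi>] exI [of _ M] exI [of _ N])
      (use V in \<open>auto simp: complex_hilbert_space_fun_space [OF h] positive_operator_fun_space [OF h]
        M_pos N_pos fun_space_finsum [OF h] M_sum N_sum MN p_eq psi psi1 hnorm_def\<close>)
qed

section \<open>Spectra of graph products\<close>

text \<open>Rayleigh quotient: let x maximise \<open>x \<bullet> f x\<close> on the compact unit
  sphere of \<open>U\<close>, with value c. The form
  \<open>c * (y \<bullet> y) - y \<bullet> f y\<close> is nonnegative on \<open>U\<close> and zero
  at x, so its variation in the direction z = c x - f x vanishes, which forces z = 0.\<close>

lemma selfadjoint_eigenvector_exists:
  fixes f :: "'a::euclidean_space \<Rightarrow> 'a"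
  assumes lin: "linear f" and sa: "\<And>x y. f x \<bullet> y = x \<bullet> f y"
    and U: "subspace U" and inv: "\<And>x. x \<in> U \<Longrightarrow> f x \<in> U" and ne: "\<exists>x\<in>U. x \<noteq> 0"
  shows "\<exists>x\<in>U. x \<noteq> 0 \<and> (\<exists>c. f x = c *\<^sub>R x)"
proof -
  define K where "K = U \<inter> sphere 0 1"
  have K: "compact K"
    unfolding K_def by (intro closed_Int_compact closed_subspace U compact_sphere)
  obtain u where u: "u \<in> U" "u \<noteq> 0" using ne by blast
  then have "u /\<^sub>R norm u \<in> K"
    using U by (auto simp: K_def subspace_scale)
  then have "K \<noteq> {}" by blast
  moreover have "continuous_on K (\<lambda>x. x \<bullet> f x)"
    using lin by (intro continuous_intros linear_continuous_on linear_conv_bounded_linear [THEN iffD1])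
  ultimately obtain x where x: "x \<in> K" "\<And>y. y \<in> K \<Longrightarrow> y \<bullet> f y \<le> x \<bullet> f x"
    using continuous_attains_sup [OF K] by blast
  define c where "c = x \<bullet> f x"
  have xU: "x \<in> U" and nx: "x \<bullet> x = 1"
    using x(1) by (auto simp: K_def dot_square_norm)
  have le: "0 \<le> c * (y \<bullet> y) - y \<bullet> f y" if "y \<in> U" for y
  proof (cases "y = 0")
    case False
    have "(y /\<^sub>R norm y) \<bullet> f (y /\<^sub>R norm y) \<le> c"
      unfolding c_def using that U False by (intro x(2)) (auto simp: K_def subspace_scale)
    then have "y \<bullet> f y / (y \<bullet> y) \<le> c"
      by (simp add: linear_scale [OF lin] dot_square_norm power2_eq_square divide_simps)
    then show ?thesis using False by (simp add: divide_simps split: if_splits)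
  qed (simp add: linear_0 [OF lin])
  define z where "z = c *\<^sub>R x - f x"
  have zU: "z \<in> U" using xU inv U by (simp add: z_def subspace_scale subspace_diff)
  have "z \<bullet> z = 0"
  proof (rule nonneg_quadratic_imp_linear_coeff_0)
    fix t :: real
    have "x + t *\<^sub>R z \<in> U" using xU zU U by (simp add: subspace_add subspace_scale)
    from le [OF this]
    have "0 \<le> 2 * t * (c * (x \<bullet> z) - f x \<bullet> z) + t * t * (c * (z \<bullet> z) - z \<bullet> f z)"
      using sa [of x z]
      by (simp add: linear_add [OF lin] linear_scale [OF lin] inner_add nx c_def [symmetric]
          inner_commute algebra_simps)
    then show "0 \<le> 2 * t * (z \<bullet> z) + t * t * (c * (z \<bullet> z) - z \<bullet> f z)"
      by (simp add: z_def inner_diff_left)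
  qed (use le [OF zU] in auto)
  then have "f x = c *\<^sub>R x" by (simp add: z_def)
  moreover have "x \<noteq> 0" using nx by auto
  ultimately show ?thesis using xU by blast
qed

text \<open>The part of \<open>U\<close> orthogonal to all eigenvectors is invariant; were it
  nonzero, it would contain an eigenvector, which would be orthogonal to itself.\<close>

lemma selfadjoint_invariant_subset_span_eigenvectors:
  fixes f :: "'a::euclidean_space \<Rightarrow> 'a"
  assumes lin: "linear f" and sa: "\<And>x y. f x \<bullet> y = x \<bullet> f y"
    and U: "subspace U" and inv: "\<And>x. x \<in> U \<Longrightarrow> f x \<in> U"
  shows "U \<subseteq> span {x \<in> U. \<exists>c. f x = c *\<^sub>R x}"
proof
  define E where "E = {x \<in> U. \<exists>c. f x = c *\<^sub>R x}"
  fix y assume y: "y \<in> U"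
  obtain v z where v: "v \<in> span E" and z: "\<And>w. w \<in> span E \<Longrightarrow> orthogonal z w" and yvz: "y = v + z"
    using orthogonal_subspace_decomp_exists [of E y] by blast
  have "span E \<subseteq> U" by (intro span_minimal U) (auto simp: E_def)
  then have zU: "z \<in> U" using y v yvz U subspace_diff [of U y v] by auto
  have "z = 0"
  proof (rule ccontr)
    assume "z \<noteq> 0"
    define U' where "U' = {x \<in> U. \<forall>e\<in>E. x \<bullet> e = 0}"
    have "subspace U'"
      using U by (auto simp: U'_def subspace_def inner_add_left)
    moreover have "z \<in> U'"
      using zU z by (auto simp: U'_def orthogonal_def span_base)
    moreover have "f x \<in> U'" if "x \<in> U'" for x
      using that inv sa by (auto simp: U'_def E_def)
    ultimately obtain x where x: "x \<in> U'" "x \<noteq> 0" "\<exists>c. f x = c *\<^sub>R x"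
      using selfadjoint_eigenvector_exists [OF lin sa, of U'] \<open>z \<noteq> 0\<close> by blast
    then have "x \<in> E" by (auto simp: E_def U'_def)
    then have "x \<bullet> x = 0" using x(1) by (simp add: U'_def)
    then show False using x(2) by simp
  qed
  then show "y \<in> span {x \<in> U. \<exists>c. f x = c *\<^sub>R x}" using v yvz by (simp add: E_def)
qed

lemma adj_matrix_nth: "adj_matrix G $ i $ j = (if G i j then 1 else 0)"
  by (simp add: adj_matrix_def)

lemma adj_matrix_sym:
  "simple_graph G \<Longrightarrow> adj_matrix G $ i $ j = (adj_matrix G $ j $ i :: 'a::zero_neq_one)"
  by (auto simp: adj_matrix_nth simple_graph_def symp_def)

lemma adj_matrix_selfadjoint:
  assumes "simple_graph G"
  shows "((adj_matrix G :: real ^ 'v::finite ^ 'v) *v x) \<bullet> y = x \<bullet> (adj_matrix G *v y)"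
proof -
  have "transpose (adj_matrix G) = (adj_matrix G :: real ^ 'v ^ 'v)"
    using adj_matrix_sym [OF assms, where 'a = real] by (simp add: vec_eq_iff transpose_def)
  then show ?thesis
    by (metis dot_lmul_matrix transpose_matrix_vector)
qed

text \<open>Bridges the diagonalisation, carried out over the reals, and the spectral hypotheses,
  stated for complex eigenvalues.\<close>

lemma real_graph_eigenvalue:
  fixes x :: "real ^ 'v::finite"
  assumes "adj_matrix G *v x = c *\<^sub>R x" "x \<noteq> 0"
  shows "complex_of_real c \<in> graph_eigenvalues G"
proof -
  define y :: "complex ^ 'v" where "y = (\<chi> i. of_real (x $ i))"
  have "(\<Sum>j\<in>UNIV. adj_matrix G $ i $ j * y $ j) = of_real c * y $ i" for i
  proof -
    have "(\<Sum>j\<in>UNIV. adj_matrix G $ i $ j * y $ j) =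
        of_real (\<Sum>j\<in>UNIV. adj_matrix G $ i $ j * x $ j)"
      unfolding of_real_sum by (intro sum.cong) (auto simp: adj_matrix_nth y_def)
    also have "(\<Sum>j\<in>UNIV. adj_matrix G $ i $ j * x $ j) = c * x $ i"
      using assms(1) by (simp add: vec_eq_iff matrix_vector_mult_def)
    finally show ?thesis by (simp add: y_def)
  qed
  then have "adj_matrix G *v y = of_real c *s y"
    by (simp add: vec_eq_iff matrix_vector_mult_def)
  moreover have "y \<noteq> 0" using assms(2) by (auto simp: vec_eq_iff y_def)
  ultimately show ?thesis by (auto simp: graph_eigenvalues_def)
qed

lemma adj_matrix_mult_vec: "(adj_matrix G *v x) $ i = (\<Sum>j | G i j. x $ j :: real)"
proof -
  have "(\<Sum>j\<in>UNIV. adj_matrix G $ i $ j * x $ j) = (\<Sum>j\<in>UNIV. if G i j then x $ j else 0)"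
    by (intro sum.cong) (auto simp: adj_matrix_nth)
  then show ?thesis by (simp add: matrix_vector_mult_def sum.If_cases)
qed

text \<open>Maximum principle: at a vertex where x is maximal, the d neighbours sum to d times the
  maximum, so each attains it. Connectedness spreads this to all vertices.\<close>

lemma regular_eigenvector_constant:
  fixes x :: "real ^ 'v::finite"
  assumes conn: "connected_graph G" and d: "\<And>i. card {j. G i j} = d"
    and x: "adj_matrix G *v x = real d *\<^sub>R x"
  shows "x $ i = x $ j"
proof -
  have "Max (range (($) x)) \<in> range (($) x)" by (rule Max_in) auto
  then obtain m where "Max (range (($) x)) = x $ m" by (rule rangeE)
  then have m: "x $ k \<le> x $ m" for k
    using Max_ge [of "range (($) x)" "x $ k"] by simp
  have "x $ k = x $ m" if "G\<^sup>*\<^sup>* m k" for k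
    using that
  proof (induction rule: rtranclp_induct)
    case (step k l)
    have "(\<Sum>j | G k j. x $ j) = real d * x $ m"
      using x step.IH by (simp add: vec_eq_iff flip: adj_matrix_mult_vec)
    then have "(\<Sum>j | G k j. x $ m - x $ j) = 0"
      by (simp add: sum_subtractf d)
    then have "x $ m - x $ l = 0"
      using m step.hyps(2) by (subst (asm) sum_nonneg_eq_0_iff) auto
    then show ?case by simp
  qed simp
  then have "x $ i = x $ m" "x $ j = x $ m"
    using conn unfolding connected_graph_def by blast+
  then show ?thesis by simp
qed

lemma sum_UNIV_pair:
  fixes f :: "'a::finite \<times> 'b::finite \<Rightarrow> 'c::comm_monoid_add"
  shows "(\<Sum>k\<in>UNIV. f k) = (\<Sum>i\<in>UNIV. \<Sum>a\<in>UNIV. f (i, a))"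
  by (simp add: sum.cartesian_product flip: UNIV_Times_UNIV)

text \<open>The double sum is the pairing of g with \<open>T h\<close>. As \<open>B\<close> is
  symmetric and commutes with \<open>T\<close>, the pairing of g with \<open>B T h\<close> can be
  evaluated on either side. For distinct eigenvalues the pairing is therefore 0.\<close>

lemma eigenvalue_intertwined:
  fixes B T :: "'k::finite \<Rightarrow> 'k \<Rightarrow> real"
  assumes sym: "\<And>k l. B k l = B l k"
    and comm: "\<And>k l. (\<Sum>m\<in>UNIV. T k m * B m l) = (\<Sum>m\<in>UNIV. B k m * T m l)"
    and g: "\<And>k. (\<Sum>q\<in>UNIV. B k q * g q) = \<alpha> * g k"
    and h: "\<And>k. (\<Sum>q\<in>UNIV. B k q * h q) = \<beta> * h k"
  shows "\<alpha> * (\<Sum>k\<in>UNIV. \<Sum>r\<in>UNIV. g k * T k r * h r) = \<beta> * (\<Sum>k\<in>UNIV. \<Sum>r\<in>UNIV. g k * T k r * h r)"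
proof -
  have swap: "(\<Sum>k\<in>UNIV. \<Sum>r\<in>UNIV. \<Sum>q\<in>UNIV. f k r q) = (\<Sum>q\<in>UNIV. \<Sum>r\<in>UNIV. \<Sum>k\<in>UNIV. f k r q)"
    for f :: "'k \<Rightarrow> 'k \<Rightarrow> 'k \<Rightarrow> real"
  proof -
    have "(\<Sum>k\<in>UNIV. \<Sum>r\<in>UNIV. \<Sum>q\<in>UNIV. f k r q) = (\<Sum>r\<in>UNIV. \<Sum>k\<in>UNIV. \<Sum>q\<in>UNIV. f k r q)"
      by (rule sum.swap)
    also have "\<dots> = (\<Sum>r\<in>UNIV. \<Sum>q\<in>UNIV. \<Sum>k\<in>UNIV. f k r q)"
      by (intro sum.cong refl sum.swap)
    finally show ?thesis by (simp only: sum.swap [of "\<lambda>r q. \<Sum>k\<in>UNIV. f k r q"])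
  qed
  have "\<alpha> * (\<Sum>k\<in>UNIV. \<Sum>r\<in>UNIV. g k * T k r * h r) = (\<Sum>k\<in>UNIV. \<Sum>r\<in>UNIV. (\<alpha> * g k) * T k r * h r)"
    by (simp add: sum_distrib_left mult.assoc)
  also have "\<dots> = (\<Sum>k\<in>UNIV. \<Sum>r\<in>UNIV. \<Sum>q\<in>UNIV. g q * (B q k * T k r) * h r)"
    unfolding g [symmetric] sum_distrib_right by (intro sum.cong refl) (simp add: sym mult_ac)
  also have "\<dots> = (\<Sum>q\<in>UNIV. \<Sum>r\<in>UNIV. \<Sum>k\<in>UNIV. g q * (B q k * T k r) * h r)"
    by (rule swap)
  also have "\<dots> = (\<Sum>q\<in>UNIV. \<Sum>r\<in>UNIV. g q * (\<Sum>k\<in>UNIV. T q k * B k r) * h r)"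
    unfolding comm by (simp add: sum_distrib_left sum_distrib_right)
  also have "\<dots> = (\<Sum>q\<in>UNIV. \<Sum>r\<in>UNIV. \<Sum>k\<in>UNIV. g q * T q k * (B k r * h r))"
    by (simp add: sum_distrib_left sum_distrib_right mult.assoc)
  also have "\<dots> = (\<Sum>q\<in>UNIV. \<Sum>k\<in>UNIV. g q * T q k * (\<Sum>r\<in>UNIV. B k r * h r))"
    unfolding sum_distrib_left by (intro sum.cong refl sum.swap)
  also have "\<dots> = \<beta> * (\<Sum>k\<in>UNIV. \<Sum>r\<in>UNIV. g k * T k r * h r)"
    unfolding h by (simp add: sum_distrib_left mult_ac)
  finally show ?thesis .
qed

text \<open>
  \<open>T\<close> maps \<open>1 \<otimes> y\<close>, for an eigenvector \<open>y\<close> of \<open>H\<close>, into the eigenspace of \<open>B\<close> for \<open>F d b\<close>, which is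
  orthogonal to all \<open>x \<otimes> y'\<close> with \<open>x \<bottom> 1\<close>.
\<close>

lemma intertwiner_row_sums:
  fixes G :: "'v::finite graph" and H :: "'w::finite graph"
    and B T :: "'v \<times> 'w \<Rightarrow> 'v \<times> 'w \<Rightarrow> real" and F :: "real \<Rightarrow> real \<Rightarrow> real"
  assumes G: "simple_graph G" "connected_graph G" "regular_graph G" and H: "simple_graph H"
    and sym: "\<And>k l. B k l = B l k"
    and eig: "\<And>x y a b k. adj_matrix G *v x = a *\<^sub>R x \<Longrightarrow> adj_matrix H *v y = b *\<^sub>R y \<Longrightarrow>
      (\<Sum>l\<in>UNIV. B k l * (x $ fst l * y $ snd l)) = F a b * (x $ fst k * y $ snd k)"
    and sep: "\<And>a a' b b'. complex_of_real a \<in> graph_eigenvalues G \<Longrightarrow>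
      complex_of_real a' \<in> graph_eigenvalues G \<Longrightarrow> complex_of_real b \<in> graph_eigenvalues H \<Longrightarrow>
      complex_of_real b' \<in> graph_eigenvalues H \<Longrightarrow> F a b = F a' b' \<Longrightarrow> a = a'"
    and comm: "\<And>k l. (\<Sum>m\<in>UNIV. T k m * B m l) = (\<Sum>m\<in>UNIV. B k m * T m l)"
  shows "(\<Sum>k\<in>UNIV. T (i, a) (k, b)) = (\<Sum>k\<in>UNIV. T (j, a) (k, b))"
proof -
  \<comment> \<open>This is the pairing of \<open>x \<otimes> y'\<close> with the image under
    \<open>T\<close> of \<open>1 \<otimes> y\<close>.\<close>
  define Q where "Q x y' y = (\<Sum>k\<in>UNIV. \<Sum>l\<in>UNIV. (x $ fst k * y' $ snd k) * T k l * y $ snd l)"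
    for x :: "real ^ 'v" and y' y :: "real ^ 'w"
  obtain d where d: "\<And>i. card {j. G i j} = d" using G(3) by (auto simp: regular_graph_def)
  define one :: "real ^ 'v" where "one = (\<chi> i. 1)"
  have one: "adj_matrix G *v one = real d *\<^sub>R one"
    by (simp add: vec_eq_iff adj_matrix_mult_vec one_def d)
  have d_eig: "complex_of_real d \<in> graph_eigenvalues G"
    by (rule real_graph_eigenvalue [OF one]) (simp add: one_def vec_eq_iff)
  define U :: "(real ^ 'v) set" where "U = {x. x \<bullet> one = 0}"
  have U: "subspace U" by (auto simp: U_def subspace_def inner_add_left)
  have AU: "adj_matrix G *v x \<in> U" if "x \<in> U" for x
    using that by (simp add: U_def adj_matrix_selfadjoint [OF G(1)] one)
  have Q_eig: "Q x y' y = 0"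
    if xU: "x \<in> U" and x: "adj_matrix G *v x = l *\<^sub>R x"
      and y': "adj_matrix H *v y' = m' *\<^sub>R y'" and y: "adj_matrix H *v y = m *\<^sub>R y" for x y y' l m m'
  proof (cases "x = 0 \<or> y = 0 \<or> y' = 0")
    case True
    then show ?thesis by (auto simp: Q_def)
  next
    case False
    define g h where "g k = x $ fst k * y' $ snd k" and "h k = y $ snd k" for k :: "'v \<times> 'w"
    have g: "(\<Sum>q\<in>UNIV. B k q * g q) = F l m' * g k" for k
      unfolding g_def using x y' by (rule eig)
    have h: "(\<Sum>q\<in>UNIV. B k q * h q) = F (real d) m * h k" for k
      using eig [OF one y, of k] by (simp add: one_def h_def)
    have eq: "F l m' * Q x y' y = F (real d) m * Q x y' y"
      using eigenvalue_intertwined [OF sym comm g h]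
      by (simp add: Q_def g_def h_def)
    \<comment> \<open>An eigenvector for d is constant, and a constant vector orthogonal to the
      all-ones vector is 0.\<close>
    have "l \<noteq> real d"
    proof
      assume "l = real d"
      then have c: "x $ k = x $ i" for k
        using regular_eigenvector_constant [OF G(2) d] x by blast
      have "(\<Sum>k\<in>UNIV. x $ k) = 0"
        using xU by (simp add: U_def one_def inner_vec_def)
      also have "(\<Sum>k\<in>UNIV. x $ k) = (\<Sum>k\<in>(UNIV :: 'v set). x $ i)"
        by (intro sum.cong refl c)
      finally have "x $ i = 0" by simp
      then have "x = 0" using c by (metis vec_eq_iff zero_index)
      then show False using False by simp
    qed
    moreover have "complex_of_real l \<in> graph_eigenvalues G" "complex_of_real m' \<in> graph_eigenvalues H"
      "complex_of_real m \<in> graph_eigenvalues H"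
      using False real_graph_eigenvalue [OF x] real_graph_eigenvalue [OF y] real_graph_eigenvalue [OF y']
      by auto
    ultimately have "F l m' \<noteq> F (real d) m"
      using sep [of l "real d" m' m] d_eig by auto
    then show ?thesis using eq by simp
  qed
  \<comment> \<open>\<open>Q\<close> is linear in each argument, so its vanishing on eigenvectors
    extends to their spans, one argument at a time.\<close>
  have Q_sub: "subspace {x. Q x y' y = 0}" "subspace {y'. Q x y' y = 0}" "subspace {y. Q x y' y = 0}"
    for x y' y
    by (auto simp: Q_def subspace_def algebra_simps sum.distrib simp flip: sum_distrib_left)
  define EG where "EG = {x \<in> U. \<exists>c. adj_matrix G *v x = c *\<^sub>R x}"
  define EH :: "(real ^ 'w) set" where "EH = {x \<in> UNIV. \<exists>c. adj_matrix H *v x = c *\<^sub>R x}"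
  have EG: "U \<subseteq> span EG"
    unfolding EG_def using adj_matrix_selfadjoint [OF G(1)] U AU
    by (intro selfadjoint_invariant_subset_span_eigenvectors) auto
  have EH: "UNIV \<subseteq> span EH"
    unfolding EH_def using adj_matrix_selfadjoint [OF H]
    by (intro selfadjoint_invariant_subset_span_eigenvectors) auto
  have 1: "Q x y' y = 0" if "x \<in> EG" "y' \<in> EH" "y \<in> EH" for x y' y
    using that Q_eig by (auto simp: EG_def EH_def)
  have 2: "Q x y' y = 0" if "x \<in> U" "y' \<in> EH" "y \<in> EH" for x y' y
    using span_minimal [OF _ Q_sub(1), of EG y' y] 1 that EG by blast
  have 3: "Q x y' y = 0" if "x \<in> U" "y \<in> EH" for x y' y
    using span_minimal [OF _ Q_sub(2), of EH x y] 2 that EH by blast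
  have 4: "Q x y' y = 0" if "x \<in> U" for x y' y
    using span_minimal [OF _ Q_sub(3), of EH x y'] 3 that EH by blast
  \<comment> \<open>At this difference of unit vectors, with unit vectors at a and b in the other
    arguments, \<open>Q\<close> is the difference of the two row sums.\<close>
  have "axis i 1 - axis j 1 \<in> U"
    by (simp add: U_def inner_diff_left inner_axis' one_def)
  then have Q0: "Q (axis i 1 - axis j 1) (axis a 1) (axis b 1) = 0" by (rule 4)
  have ax: "(\<Sum>c\<in>UNIV. f c * axis b 1 $ c) = f b" for f :: "'c::finite \<Rightarrow> real" and b
    by (simp add: axis_def if_distrib cong: if_cong)
  have "Q x (axis a 1) (axis b 1) = (\<Sum>i'\<in>UNIV. (\<Sum>k\<in>UNIV. T (i', a) (k, b)) * x $ i')" for x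
  proof -
    have "Q x (axis a 1) (axis b 1) =
        (\<Sum>i'\<in>UNIV. \<Sum>a'\<in>UNIV. \<Sum>k\<in>UNIV. (x $ i' * axis a 1 $ a') * T (i', a') (k, b))"
      by (simp only: Q_def sum_UNIV_pair fst_conv snd_conv ax)
    also have "\<dots> = (\<Sum>i'\<in>UNIV. \<Sum>a'\<in>UNIV. (\<Sum>k\<in>UNIV. T (i', a') (k, b)) * x $ i' * axis a 1 $ a')"
      unfolding sum_distrib_right by (intro sum.cong refl) (simp only: mult_ac)
    finally show ?thesis by (simp only: ax)
  qed
  then have "Q (axis i 1 - axis j 1) (axis a 1) (axis b 1) =
      (\<Sum>k\<in>UNIV. T (i, a) (k, b)) - (\<Sum>k\<in>UNIV. T (j, a) (k, b))"
    by (simp only: vector_minus_component right_diff_distrib sum_subtractf ax)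
  then show ?thesis using Q0 by simp
qed

text \<open>Entrywise commutation of \<open>T\<close> with \<open>J \<otimes> 1\<close>. By symmetry
  of \<open>B\<close> the transpose of \<open>T\<close> commutes with \<open>B\<close> too, so in
  the block of a and b all row sums agree and all column sums agree. Both kinds, multiplied by the
  number of vertices of \<open>G\<close>, give the total of the block.\<close>

lemma intertwiner_row_sum_eq_col_sum:
  fixes G :: "'v::finite graph" and H :: "'w::finite graph"
    and B T :: "'v \<times> 'w \<Rightarrow> 'v \<times> 'w \<Rightarrow> real" and F :: "real \<Rightarrow> real \<Rightarrow> real"
  assumes G: "simple_graph G" "connected_graph G" "regular_graph G" and H: "simple_graph H"
    and sym: "\<And>k l. B k l = B l k"
    and eig: "\<And>x y a b k. adj_matrix G *v x = a *\<^sub>R x \<Longrightarrow> adj_matrix H *v y = b *\<^sub>R y \<Longrightarrow>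
      (\<Sum>l\<in>UNIV. B k l * (x $ fst l * y $ snd l)) = F a b * (x $ fst k * y $ snd k)"
    and sep: "\<And>a a' b b'. complex_of_real a \<in> graph_eigenvalues G \<Longrightarrow>
      complex_of_real a' \<in> graph_eigenvalues G \<Longrightarrow> complex_of_real b \<in> graph_eigenvalues H \<Longrightarrow>
      complex_of_real b' \<in> graph_eigenvalues H \<Longrightarrow> F a b = F a' b' \<Longrightarrow> a = a'"
    and comm: "\<And>k l. (\<Sum>m\<in>UNIV. T k m * B m l) = (\<Sum>m\<in>UNIV. B k m * T m l)"
  shows "(\<Sum>k\<in>UNIV. T (i, a) (k, b)) = (\<Sum>k\<in>UNIV. T (k, a) (j, b))"
proof -
  have row: "(\<Sum>k\<in>UNIV. T (i', a) (k, b)) = (\<Sum>k\<in>UNIV. T (i, a) (k, b))" for i'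
  proof (rule intertwiner_row_sums [where B = B and F = F, OF G H])
    show "B k l = B l k" for k l by (rule sym)
    show "(\<Sum>m\<in>UNIV. T k m * B m l) = (\<Sum>m\<in>UNIV. B k m * T m l)" for k l by (rule comm)
  qed (use eig sep in blast)+
  have comm': "(\<Sum>m\<in>UNIV. T m k * B m l) = (\<Sum>m\<in>UNIV. B k m * T l m)" for k l
    using comm [of l k] sym by (simp add: mult.commute)
  have col: "(\<Sum>k\<in>UNIV. T (k, a) (j', b)) = (\<Sum>k\<in>UNIV. T (k, a) (j, b))" for j'
  proof (rule intertwiner_row_sums [where B = B and F = F and T = "\<lambda>k l. T l k", OF G H])
    show "B k l = B l k" for k l by (rule sym)
    show "(\<Sum>m\<in>UNIV. T m k * B m l) = (\<Sum>m\<in>UNIV. B k m * T l m)" for k l by (rule comm')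
  qed (use eig sep in blast)+
  have "real CARD('v) * (\<Sum>k\<in>UNIV. T (i, a) (k, b)) =
      (\<Sum>i'\<in>(UNIV :: 'v set). \<Sum>k\<in>UNIV. T (i, a) (k, b))"
    by simp
  also have "\<dots> = (\<Sum>i'\<in>UNIV. \<Sum>k\<in>UNIV. T (i', a) (k, b))"
    by (intro sum.cong [OF refl] row [symmetric])
  also have "\<dots> = (\<Sum>k\<in>UNIV. \<Sum>i'\<in>UNIV. T (i', a) (k, b))"
    by (rule sum.swap)
  also have "\<dots> = (\<Sum>k\<in>(UNIV :: 'v set). \<Sum>k\<in>UNIV. T (k, a) (j, b))"
    by (intro sum.cong [OF refl] col)
  finally show ?thesis by simp
qed

section \<open>Representations of quantum automorphism groups\<close>

text \<open>A representation of the relations of \<open>C_Qut G\<close> on a possibly incomplete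
  space, in the form that the game provides: mismatched products vanish. Idempotence, column sums
  and commutation with the adjacency matrix are derived from this.\<close>

locale qaut = ip_space sc D ip
  for sc :: "complex \<Rightarrow> 'x::ab_group_add \<Rightarrow> 'x" and D ip +
  fixes G :: "'n::finite graph" and u :: "'n \<Rightarrow> 'n \<Rightarrow> 'x \<Rightarrow> 'x"
  assumes simple: "simple_graph G"
    and lin: "lin_op (u i l)"
    and sa: "x \<in> D \<Longrightarrow> y \<in> D \<Longrightarrow> ip x (u i l y) = ip (u i l x) y"
    and row_sum: "y \<in> D \<Longrightarrow> (\<Sum>l\<in>UNIV. u i l y) = y"
    and mismatch: "y \<in> D \<Longrightarrow> rel G i j \<noteq> rel G l k \<Longrightarrow> u i l (u j k y) = 0"
begin

lemma uD [simp]: "y \<in> D \<Longrightarrow> u i l y \<in> D"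
  by (rule lin_opD(1) [OF lin])

lemma row_orth: "y \<in> D \<Longrightarrow> l \<noteq> k \<Longrightarrow> u i l (u i k y) = 0"
  by (rule mismatch) (auto simp: rel_def)

lemma col_orth: "y \<in> D \<Longrightarrow> i \<noteq> j \<Longrightarrow> u i l (u j l y) = 0"
  by (rule mismatch) (auto simp: rel_def)

lemma idem: "y \<in> D \<Longrightarrow> u i l (u i l y) = u i l y"
proof -
  assume y: "y \<in> D"
  have "u i l y = (\<Sum>k\<in>UNIV. u i k (u i l y))"
    using row_sum [of "u i l y" i] y by simp
  also have "\<dots> = (\<Sum>k\<in>UNIV. if k = l then u i l (u i l y) else 0)"
    using y by (intro sum.cong) (auto simp: row_orth)
  finally show ?thesis by simp
qed

lemma nrm_u_le: "y \<in> D \<Longrightarrow> nrm (u i l y) \<le> nrm y"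
proof -
  assume y: "y \<in> D"
  have "Re (ip (u i l y) (u i l y)) = Re (ip y (u i l y))"
    using sa [of y "u i l y" i l] y by (simp add: idem)
  moreover have "0 \<le> Re (ip (y - u i l y) (y - u i l y))"
    using y by (intro ip_nonneg) simp
  ultimately have "Re (ip (u i l y) (u i l y)) \<le> Re (ip y y)"
    using y Re_ip_commute [of y "u i l y"] by (simp add: ip_diff ip_diff_left)
  then show ?thesis by (simp add: nrm_def)
qed

text \<open>
  The defects \<open>y - \<Sum>\<^sub>i u i l y\<close> are projections of \<open>y\<close>, and by the row sums they cancel when summed
  over \<open>l\<close>.
\<close>

lemma col_sum:
  assumes y: "y \<in> D"
  shows "(\<Sum>i\<in>UNIV. u i l y) = y"
proof -
  define q where "q l x = (\<Sum>i\<in>UNIV. u i l x)" for l x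
  have qD: "q l x \<in> D" if "x \<in> D" for l x using that by (simp add: q_def)
  have qq: "q l (q l y) = q l y" for l
  proof -
    have "u i l (q l y) = u i l y" for i
    proof -
      have "u i l (q l y) = (\<Sum>j\<in>UNIV. u i l (u j l y))"
        using y by (simp add: q_def lin_op_sum [OF lin])
      also have "\<dots> = (\<Sum>j\<in>UNIV. if j = i then u i l y else 0)"
        using y by (intro sum.cong) (auto simp: col_orth idem)
      finally show ?thesis by simp
    qed
    then show ?thesis by (simp add: q_def)
  qed
  have q_sa: "ip x (q l z) = ip (q l x) z" if "x \<in> D" "z \<in> D" for x z l
    using that by (simp add: q_def ip_sum ip_sum_left sa)
  have defect: "Re (ip (y - q l y) (y - q l y)) = Re (ip y y) - Re (ip y (q l y))" for l
    using y qD q_sa [of y "q l y" l] qq [of l] Re_ip_commute [of y "q l y"]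
    by (simp add: ip_diff ip_diff_left)
  have "(\<Sum>l\<in>UNIV. ip y (q l y)) = (\<Sum>i\<in>UNIV. ip y (\<Sum>l\<in>UNIV. u i l y))"
    using y by (simp add: q_def ip_sum) (rule sum.swap)
  also have "\<dots> = of_nat CARD('n) * ip y y" using y by (simp add: row_sum)
  finally have "Re (\<Sum>l\<in>UNIV. ip y (q l y)) = real CARD('n) * Re (ip y y)" by simp
  then have "(\<Sum>l\<in>UNIV. Re (ip (y - q l y) (y - q l y))) = 0"
    by (simp add: defect sum_subtractf)
  then have "Re (ip (y - q l y) (y - q l y)) = 0"
    using y qD ip_nonneg by (subst (asm) sum_nonneg_eq_0_iff) auto
  then have "y - q l y = 0" using y qD ip_zero_iff by simp
  then show ?thesis by (simp add: q_def)
qed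

lemma rel_Adjacent: "rel G i j = Adjacent \<longleftrightarrow> G i j"
  using simple by (auto simp: rel_def simple_graph_def irreflp_def)

text \<open>Inserting the column sum of \<open>u l j\<close> on the left gives products
  \<open>u i k (u l j y)\<close> with k adjacent to j; mismatch leaves only those with l adjacent to
  i. With l so restricted, the condition on k is automatic in turn, and the row sum removes
  \<open>u i k\<close>.\<close>

lemma adj_commute:
  assumes y: "y \<in> D"
  shows "(\<Sum>k | G k j. u i k y) = (\<Sum>l | G i l. u l j y)"
proof -
  have "(\<Sum>k | G k j. u i k y) = (\<Sum>k | G k j. u i k (\<Sum>l\<in>UNIV. u l j y))"
    by (simp add: col_sum y)
  also have "\<dots> = (\<Sum>k | G k j. \<Sum>l\<in>UNIV. u i k (u l j y))"
    using y by (simp add: lin_op_sum [OF lin])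
  also have "\<dots> = (\<Sum>k | G k j. \<Sum>l | G i l. u i k (u l j y))"
    using y by (intro sum.cong refl sum.mono_neutral_right) (auto intro!: mismatch simp: rel_Adjacent [symmetric])
  also have "\<dots> = (\<Sum>l | G i l. \<Sum>k | G k j. u i k (u l j y))"
    by (rule sum.swap)
  also have "\<dots> = (\<Sum>l | G i l. \<Sum>k\<in>UNIV. u i k (u l j y))"
    using y by (intro sum.cong refl sum.mono_neutral_left) (auto intro!: mismatch simp: rel_Adjacent [symmetric])
  also have "\<dots> = (\<Sum>l | G i l. u l j y)"
    using y by (simp add: row_sum)
  finally show ?thesis .
qed

section \<open>The representation of the free *-algebra induced by a magic unitary\<close>

fun act :: "('n \<times> 'n) letter \<Rightarrow> 'x \<Rightarrow> 'x" where
  "act (Gen (i, l)) = u i l"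
| "act (Adj (i, l)) = u i l"

definition actw :: "('n \<times> 'n) gword \<Rightarrow> 'x \<Rightarrow> 'x" where
  "actw w = foldr act (letters w)"

definition rho :: "('n \<times> 'n) free_star_algebra \<Rightarrow> 'x \<Rightarrow> 'x" where
  "rho x y = (\<Sum>w\<in>Poly_Mapping.keys x. sc (Poly_Mapping.lookup x w) (actw w y))"

text \<open>Starred and unstarred letters act alike since \<open>u i l\<close> is self-adjoint; one
  case then covers both.\<close>

lemma act_cases: obtains i l where "act a = u i l" "act (adj_letter a) = u i l"
  by (cases a) (metis act.simps adj_letter.simps surj_pair)+

lemma lin_act: "lin_op (act a)"
  using lin by (metis act_cases)

lemma actw_0 [simp]: "actw 0 = id"
  by (simp add: actw_def zero_gword_def id_def)

lemma actw_plus: "actw (v + w) = actw v \<circ> actw w"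
  by (simp add: actw_def plus_gword_def fun_eq_iff)

lemma actw_Cons: "actw (GWord (a # as)) = act a \<circ> actw (GWord as)"
  by (simp add: actw_def)

lemma lin_actw: "lin_op (actw w)"
proof -
  have "lin_op (actw (GWord as))" for as
  proof (induction as)
    case Nil
    then show ?case by (simp add: actw_def lin_op_def)
  next
    case (Cons a as)
    then show ?case using lin_op_comp [OF lin_act Cons] by (simp add: actw_Cons comp_def)
  qed
  from this [of "letters w"] show ?thesis by simp
qed

lemma actw_adj:
  assumes "y \<in> D" "z \<in> D"
  shows "ip (actw (adj_word w) y) z = ip y (actw w z)"
proof -
  have "ip (actw (adj_word (GWord as)) y) z = ip y (actw (GWord as) z)" if "y \<in> D" "z \<in> D" for as y z
    using that
  proof (induction as arbitrary: y)
    case Nil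
    then show ?case by (simp add: actw_def adj_word_def)
  next
    case (Cons a as)
    obtain i l where a: "act a = u i l" "act (adj_letter a) = u i l" by (rule act_cases)
    have "actw (adj_word (GWord (a # as))) y = actw (adj_word (GWord as)) (u i l y)"
      by (simp add: actw_def adj_word_def a)
    then show ?case
      using Cons lin_opD(1) [OF lin_actw] by (simp add: actw_Cons a sa)
  qed
  from this [of y z "letters w"] assms show ?thesis by simp
qed

lemma nrm_actw_le: "y \<in> D \<Longrightarrow> nrm (actw w y) \<le> nrm y"
proof -
  assume y: "y \<in> D"
  have "nrm (actw (GWord as) y) \<le> nrm y" for as
  proof (induction as)
    case (Cons a as)
    obtain i l where a: "act a = u i l" by (rule act_cases)
    have "nrm (u i l (actw (GWord as) y)) \<le> nrm (actw (GWord as) y)"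
      using y lin_opD(1) [OF lin_actw] by (intro nrm_u_le) simp
    then show ?case using Cons by (simp add: actw_Cons a)
  qed (simp add: actw_def)
  from this [of "letters w"] show ?thesis by simp
qed

lemma rho_superset:
  assumes "finite A" "Poly_Mapping.keys x \<subseteq> A"
  shows "rho x y = (\<Sum>w\<in>A. sc (Poly_Mapping.lookup x w) (actw w y))"
  unfolding rho_def using assms
  by (intro sum.mono_neutral_left) (auto simp: in_keys_iff)

lemma rho_add: "rho (x + x') y = rho x y + rho x' y"
proof -
  define A where "A = Poly_Mapping.keys x \<union> Poly_Mapping.keys x'"
  have "finite A" "Poly_Mapping.keys (x + x') \<subseteq> A"
    using keys_add [of x x'] by (auto simp: A_def)
  then show ?thesis
    using rho_superset [of A x] rho_superset [of A x'] rho_superset [of A "x + x'"]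
    by (simp add: A_def lookup_add scale_left_distrib sum.distrib)
qed

lemma rho_single: "rho (Poly_Mapping.single w c) y = sc c (actw w y)"
  using rho_superset [of "{w}" "Poly_Mapping.single w c" y] by simp

lemma rho_diff: "rho (x - x') y = rho x y - rho x' y"
  using rho_add [of "x - x'" x' y] by (simp add: algebra_simps)

lemma rho_0: "rho 0 y = 0"
  by (simp add: rho_def)

lemma rho_1: "rho 1 y = y"
  unfolding single_one [symmetric] rho_single by simp

lemma rho_sum: "rho (sum f A) y = (\<Sum>i\<in>A. rho (f i) y)"
  by (induction A rule: infinite_finite_induct) (simp_all add: rho_add rho_0)

lemma rho_gen: "rho (gen (i, l)) y = u i l y"
  by (simp add: gen_def rho_single actw_def)

end

lemma free_star_algebra_induct [case_names single add]:
  fixes x :: "'g free_star_algebra"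
  assumes single: "\<And>w c. P (Poly_Mapping.single w c)" and add: "\<And>x y. P x \<Longrightarrow> P y \<Longrightarrow> P (x + y)"
  shows "P x"
proof -
  have "P (\<Sum>w\<in>A. Poly_Mapping.single w (Poly_Mapping.lookup x w))" if "finite A" for A
    using that
  proof (induction A rule: finite_induct)
    case empty
    then show ?case using single [of 0 0] by simp
  qed (simp add: single add)
  moreover have "(\<Sum>w\<in>Poly_Mapping.keys x. Poly_Mapping.single w (Poly_Mapping.lookup x w)) = x"
    by (rule poly_mapping_eqI) (simp add: lookup_sum lookup_single when_def in_keys_iff)
  ultimately show ?thesis by (metis finite_keys)
qed

lemma star_add: "star (x + y) = star x + star y"
  by (rule poly_mapping_eqI) (simp add: lookup_star lookup_add)

lemma star_star: "star (star x) = x"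
  by (rule poly_mapping_eqI) (simp add: lookup_star)

context qaut
begin

lemma lin_rho: "lin_op (rho x)"
  unfolding rho_def lin_op_def
  using lin_opD [OF lin_actw] by (auto simp: sum.distrib scale_right_distrib scale_sum_right mult.commute)

lemma rho_mult:
  assumes y: "y \<in> D"
  shows "rho (x * x') y = rho x (rho x' y)"
proof (induction x rule: free_star_algebra_induct)
  case (single w c)
  show ?case
  proof (induction x' rule: free_star_algebra_induct)
    case (single w' c')
    then show ?case
      using y lin_opD [OF lin_actw] by (simp add: mult_single rho_single actw_plus)
  next
    case (add a b)
    then show ?case
      using y lin_opD(1) [OF lin_rho] lin_opD(2) [OF lin_rho] by (simp add: distrib_left rho_add)
  qed
qed (simp add: distrib_right rho_add)

lemma rho_star:
  assumes "y \<in> D" "z \<in> D"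
  shows "ip (rho (star x) y) z = ip y (rho x z)"
proof (induction x rule: free_star_algebra_induct)
  case (single w c)
  show ?case
    using assms lin_opD(1) [OF lin_actw]
    by (simp add: star_single rho_single ip_sc ip_sc_left actw_adj)
next
  case (add a b)
  then show ?case
    using assms lin_opD(1) [OF lin_rho] by (simp add: star_add rho_add ip_add ip_add_left)
qed

lemma rho_bounded: "\<exists>B. \<forall>y\<in>D. nrm (rho x y) \<le> B * nrm y"
proof (induction x rule: free_star_algebra_induct)
  case (single w c)
  have "nrm (rho (Poly_Mapping.single w c) y) \<le> cmod c * nrm y" if "y \<in> D" for y
    using that nrm_actw_le [OF that, of w] lin_opD(1) [OF lin_actw that]
    by (simp add: rho_single nrm_sc mult_left_mono)
  then show ?case by blast
next
  case (add a b)
  then obtain A B where "\<forall>y\<in>D. nrm (rho a y) \<le> A * nrm y" "\<forall>y\<in>D. nrm (rho b y) \<le> B * nrm y"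
    by blast
  then have "nrm (rho (a + b) y) \<le> (A + B) * nrm y" if "y \<in> D" for y
    using that nrm_triangle [of "rho a y" "rho b y"] lin_opD(1) [OF lin_rho that]
    by (simp add: rho_add distrib_right) (meson add_mono order_trans)
  then show ?case by blast
qed

section \<open>The operator norm of the representation is a C*-seminorm\<close>

definition rho_norm :: "('n \<times> 'n) free_star_algebra \<Rightarrow> real" where
  "rho_norm x = (SUP y\<in>{y \<in> D. nrm y \<le> 1}. nrm (rho x y))"

lemma rho_norm_bdd: "bdd_above ((\<lambda>y. nrm (rho x y)) ` {y \<in> D. nrm y \<le> 1})"
proof -
  obtain B where B: "\<And>y. y \<in> D \<Longrightarrow> nrm (rho x y) \<le> B * nrm y"
    using rho_bounded by blast
  have "nrm (rho x y) \<le> \<bar>B\<bar>" if "y \<in> D" "nrm y \<le> 1" for y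
  proof -
    have "B * nrm y \<le> \<bar>B\<bar> * 1"
      using that nrm_nonneg by (intro mult_mono) auto
    then show ?thesis using B [OF that(1)] by simp
  qed
  then show ?thesis by (intro bdd_aboveI2) auto
qed

lemma rho_norm_nonneg: "0 \<le> rho_norm x"
proof -
  have "nrm (rho x 0) \<le> rho_norm x"
    unfolding rho_norm_def by (rule cSUP_upper [OF _ rho_norm_bdd]) simp
  then show ?thesis using nrm_nonneg [of "rho x 0"] lin_opD(1) [OF lin_rho] by fastforce
qed

lemma rho_norm_upper:
  assumes y: "y \<in> D"
  shows "nrm (rho x y) \<le> rho_norm x * nrm y"
proof (cases "nrm y = 0")
  case True
  then have "y = 0" using y ip_zero_iff [OF y] by (simp add: nrm_def)
  then show ?thesis by (simp add: lin_op_0 [OF lin_rho])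
next
  case False
  then have n: "nrm y > 0" using nrm_nonneg [OF y] by simp
  define z where "z = sc (of_real (1 / nrm y)) y"
  have z: "z \<in> D" "nrm z = 1" using y n by (auto simp: z_def nrm_sc norm_divide)
  have "nrm (rho x z) \<le> rho_norm x"
    unfolding rho_norm_def using z by (intro cSUP_upper [OF _ rho_norm_bdd]) simp
  moreover have "nrm (rho x z) = nrm (rho x y) / nrm y"
    unfolding z_def using y n lin_opD [OF lin_rho] by (simp add: nrm_sc norm_divide)
  ultimately show ?thesis using n by (simp add: divide_simps)
qed

lemma rho_norm_least:
  assumes "0 \<le> B" "\<And>y. y \<in> D \<Longrightarrow> nrm (rho x y) \<le> B * nrm y"
  shows "rho_norm x \<le> B"
  unfolding rho_norm_def
proof (rule cSUP_least)
  have "0 \<in> {y \<in> D. nrm y \<le> 1}" by simp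
  then show "{y \<in> D. nrm y \<le> 1} \<noteq> {}" by blast
  fix y assume y: "y \<in> {y \<in> D. nrm y \<le> 1}"
  then have "B * nrm y \<le> B * 1" using assms(1) by (intro mult_left_mono) auto
  then show "nrm (rho x y) \<le> B" using assms(2) [of y] y by auto
qed

lemma rho_norm_mult: "rho_norm (x * y) \<le> rho_norm x * rho_norm y"
proof (rule rho_norm_least)
  fix z assume z: "z \<in> D"
  have "nrm (rho x (rho y z)) \<le> rho_norm x * nrm (rho y z)"
    using z lin_opD(1) [OF lin_rho] by (intro rho_norm_upper) auto
  also have "\<dots> \<le> rho_norm x * (rho_norm y * nrm z)"
    using rho_norm_upper [OF z] rho_norm_nonneg by (intro mult_left_mono)
  finally show "nrm (rho (x * y) z) \<le> rho_norm x * rho_norm y * nrm z"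
    using z by (simp add: rho_mult mult.assoc)
qed (simp add: rho_norm_nonneg)

text \<open>The squared norm of \<open>rho x y\<close> is the pairing of
  \<open>rho (star x * x) y\<close> with y, then Cauchy-Schwarz. The adjoint needed here comes from
  \<open>rho_star\<close> and not from completeness.\<close>

lemma rho_norm_square_le: "(rho_norm x)\<^sup>2 \<le> rho_norm (star x * x)"
proof -
  have "rho_norm x \<le> sqrt (rho_norm (star x * x))"
  proof (rule rho_norm_least)
    fix y assume y: "y \<in> D"
    have r: "rho x y \<in> D" "rho (star x * x) y \<in> D" using y lin_opD(1) [OF lin_rho] by auto
    have "(nrm (rho x y))\<^sup>2 = Re (ip (rho (star x * x) y) y)"
      using y r rho_star [of "rho x y" y x] by (simp add: nrm_sq rho_mult)
    also have "\<dots> \<le> nrm (rho (star x * x) y) * nrm y"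
      using Re_ip_le [OF r(2) y] by simp
    also have "\<dots> \<le> rho_norm (star x * x) * nrm y * nrm y"
      using rho_norm_upper [OF y] nrm_nonneg [OF y] by (intro mult_right_mono) auto
    finally have "(nrm (rho x y))\<^sup>2 \<le> (sqrt (rho_norm (star x * x)) * nrm y)\<^sup>2"
      using rho_norm_nonneg [of "star x * x"] by (simp only: power_mult_distrib real_sqrt_pow2) (simp add: power2_eq_square mult_ac)
    then show "nrm (rho x y) \<le> sqrt (rho_norm (star x * x)) * nrm y"
      by (rule power2_le_imp_le) (simp add: nrm_nonneg [OF y] rho_norm_nonneg)
  qed (simp add: rho_norm_nonneg)
  then have "(rho_norm x)\<^sup>2 \<le> (sqrt (rho_norm (star x * x)))\<^sup>2"
    by (intro power_mono rho_norm_nonneg)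
  then show ?thesis by (simp add: rho_norm_nonneg)
qed

text \<open>The previous bound and submultiplicativity give
  \<open>(rho_norm x)\<^sup>2 \<le> rho_norm (star x) * rho_norm x\<close>; cancel one factor, and
  repeat for \<open>star x\<close>.\<close>

lemma rho_norm_star: "rho_norm (star x) = rho_norm x"
proof -
  have "rho_norm x \<le> rho_norm (star x)" for x
  proof -
    have "(rho_norm x)\<^sup>2 \<le> rho_norm (star x) * rho_norm x"
      using rho_norm_square_le rho_norm_mult order_trans by blast
    then show ?thesis
      using rho_norm_nonneg [of x] rho_norm_nonneg [of "star x"]
      by (cases "rho_norm x = 0") (auto simp: power2_eq_square)
  qed
  from this [of x] this [of "star x"] show ?thesis by (simp add: star_star)
qed

lemma cstar_seminorm_opn: "cstar_seminorm rho_norm"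
  unfolding cstar_seminorm_def
proof (intro conjI allI)
  fix x y :: "('n \<times> 'n) free_star_algebra" and c
  show "0 \<le> rho_norm x" by (rule rho_norm_nonneg)
  show "rho_norm (x * y) \<le> rho_norm x * rho_norm y" by (rule rho_norm_mult)
  show "rho_norm (x + y) \<le> rho_norm x + rho_norm y"
  proof (rule rho_norm_least)
    fix z assume z: "z \<in> D"
    then show "nrm (rho (x + y) z) \<le> (rho_norm x + rho_norm y) * nrm z"
      using nrm_triangle [of "rho x z" "rho y z"] rho_norm_upper [OF z] lin_opD(1) [OF lin_rho z]
      by (simp add: rho_add distrib_right) (meson add_mono order_trans)
  qed (simp add: rho_norm_nonneg)
  have r: "rho (scalar c * x) z = sc c (rho x z)" if "z \<in> D" for c x z
    using that by (simp add: rho_mult scalar_def rho_single)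
  have le: "rho_norm (scalar c * x) \<le> cmod c * rho_norm x" for c x
  proof (rule rho_norm_least)
    fix z assume z: "z \<in> D"
    then show "nrm (rho (scalar c * x) z) \<le> cmod c * rho_norm x * nrm z"
      using rho_norm_upper [OF z, of x] lin_opD(1) [OF lin_rho z]
      by (simp add: r nrm_sc mult.assoc mult_left_mono)
  qed (simp add: rho_norm_nonneg)
  show "rho_norm (scalar c * x) = cmod c * rho_norm x"
  proof (cases "c = 0")
    case True
    then show ?thesis using le [of c x] rho_norm_nonneg [of "scalar c * x"] by simp
  next
    case False
    have "scalar (1 / c) * (scalar c * x) = x"
      using False by (simp add: scalar_def mult_single flip: mult.assoc)
    then have "rho_norm x \<le> cmod (1 / c) * rho_norm (scalar c * x)"
      using le [of "1 / c" "scalar c * x"] by simp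
    then have "cmod c * rho_norm x \<le> rho_norm (scalar c * x)"
      using False by (simp add: norm_divide divide_simps mult.commute)
    then show ?thesis using le [of c x] by simp
  qed
  show "rho_norm (star x * x) = (rho_norm x)\<^sup>2"
    using rho_norm_square_le [of x] rho_norm_mult [of "star x" x] by (simp add: rho_norm_star power2_eq_square)
qed

text \<open>This enters \<open>rho_norm\<close> into the supremum defining the universal norm, so an
  element of universal norm 0 acts as 0 on \<open>D\<close>.\<close>

lemma rho_norm_rel_seminorms: "rho_norm \<in> rel_seminorms (qut_relations G)"
proof -
  have 0: "rho_norm r = 0" if "\<And>y. y \<in> D \<Longrightarrow> rho r y = 0" for r
    using rho_norm_least [of 0 r] rho_norm_nonneg [of r] that by simp
  have s: "rho (star (gen (i, l))) y = u i l y" for i l y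
    by (simp add: gen_def star_single rho_single actw_def adj_word_def)
  have "rho_norm r = 0" if "r \<in> qut_relations G" for r
  proof (rule 0)
    fix y assume y: "y \<in> D"
    have r1: "rho ((qut_matrix ** adj_matrix G) $ i $ j) y = (\<Sum>k | G k j. u i k y)" for i j
    proof -
      have "(qut_matrix ** adj_matrix G) $ i $ j = (\<Sum>k\<in>UNIV. if G k j then gen (i, k) else 0)"
        by (auto simp: matrix_matrix_mult_def adj_matrix_nth qut_matrix_def intro!: sum.cong)
      then show ?thesis
        by (simp add: rho_sum rho_gen sum.If_cases)
    qed
    have r2: "rho ((adj_matrix G ** qut_matrix) $ i $ j) y = (\<Sum>k | G i k. u k j y)" for i j
    proof -
      have "(adj_matrix G ** qut_matrix) $ i $ j = (\<Sum>k\<in>UNIV. if G i k then gen (k, j) else 0)"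
        by (auto simp: matrix_matrix_mult_def adj_matrix_nth qut_matrix_def intro!: sum.cong)
      then show ?thesis
        by (simp add: rho_sum rho_gen sum.If_cases)
    qed
    from that show "rho r y = 0"
      using y
      by (auto simp: qut_relations_def qut_matrix_def rho_diff rho_gen s rho_mult idem rho_sum rho_1
          row_sum col_sum r1 [unfolded qut_matrix_def] r2 [unfolded qut_matrix_def] adj_commute)
  qed
  then show ?thesis using cstar_seminorm_opn by (simp add: rel_seminorms_def)
qed

end

text \<open>Cosets of constant sequences commute in the quotient ring, so the constant sequence of
  the commutator is a null sequence.\<close>

lemma qut_norm_commutator:
  assumes "no_quantum_symmetry G"
  shows "universal_norm (qut_relations G) (x * y - y * x) = 0"
proof -
  let ?R = "cauchy_ring (qut_relations G)" and ?I = "null_sequences (qut_relations G)"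
  interpret I: ideal ?I ?R by (rule ideal_null_sequences)
  have "universal_norm (qut_relations G) 0 \<le> 0"
  proof (rule qut_norm_least)
    fix p assume "p \<in> rel_seminorms (qut_relations G)"
    then have "p (scalar 0 * 0) = cmod 0 * p 0"
      unfolding rel_seminorms_def cstar_seminorm_def by blast
    then show "p 0 \<le> 0" by simp
  qed
  then have n0: "universal_norm (qut_relations G) 0 = 0"
    using qut_norm_nonneg [of G 0] by simp
  have const: "(\<lambda>_. c) \<in> carrier ?R" for c
    by (simp add: cauchy_ring_def n0)
  have cos: "?I +>\<^bsub>?R\<^esub> (\<lambda>_. c) \<in> carrier (C_Qut G)" for c
    unfolding C_Qut_def universal_cstar_algebra_def FactRing_def
    using I.a_rcosetsI [OF I.a_subset const] by simp
  have mult: "(?I +>\<^bsub>?R\<^esub> (\<lambda>_. c)) \<otimes>\<^bsub>C_Qut G\<^esub> (?I +>\<^bsub>?R\<^esub> (\<lambda>_. d)) = ?I +>\<^bsub>?R\<^esub> (\<lambda>_. c * d)" for c d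
    unfolding C_Qut_def universal_cstar_algebra_def FactRing_def
    using I.rcoset_mult_add [OF const const] by (simp add: cauchy_ring_def)
  have "?I +>\<^bsub>?R\<^esub> (\<lambda>_. x * y) = ?I +>\<^bsub>?R\<^esub> (\<lambda>_. y * x)"
    using assms cos mult unfolding no_quantum_symmetry_def by metis
  then have "(\<lambda>_. x * y) \<in> ?I +>\<^bsub>?R\<^esub> (\<lambda>_. y * x)"
    using I.a_rcos_self [OF const] by metis
  then obtain h where h: "h \<in> ?I" "(\<lambda>_. x * y) = (\<lambda>n. h n + y * x)"
    by (auto simp: a_r_coset_def' cauchy_ring_def)
  have "h = (\<lambda>_. x * y - y * x)"
    using h(2) by (metis add_diff_cancel_right')
  then show ?thesis
    using h(1) by (simp add: null_sequences_def LIMSEQ_const_iff)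
qed

lemma (in qaut) no_quantum_symmetry_commute:
  assumes "no_quantum_symmetry G" and y: "y \<in> D"
  shows "u i l (u j k y) = u j k (u i l y)"
proof -
  let ?c = "gen (i, l) * gen (j, k) - gen (j, k) * gen (i, l)"
  have "rho_norm ?c \<le> 0"
    using qut_norm_upper [OF rho_norm_rel_seminorms, of ?c] qut_norm_commutator [OF assms(1)] by simp
  then have "rho_norm ?c * nrm y \<le> 0" using nrm_nonneg [OF y] by (simp add: mult_le_0_iff)
  then have "nrm (rho ?c y) \<le> 0" using rho_norm_upper [OF y, of ?c] by simp
  moreover have r: "rho ?c y \<in> D" by (rule lin_opD(1) [OF lin_rho y])
  ultimately have "nrm (rho ?c y) = 0" using nrm_nonneg by fastforce
  then have "rho ?c y = 0" using ip_zero_iff [OF r] by (simp add: nrm_def)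
  then show ?thesis using y by (simp add: rho_diff rho_mult rho_gen)
qed

section \<open>Winning correlations represent the quantum automorphism group\<close>

text \<open>With R = 1 - T one has T - T^2 = TRT + RTR, a sum of two nonnegative forms. In case of
  equality the form of \<open>R\<close> vanishes at \<open>T x\<close>, hence
  \<open>R (T x) = 0\<close> by \<open>pos_op_null\<close>.\<close>

lemma (in ip_space) complemented_pos_op:
  assumes T: "pos_op T" and R: "pos_op R" and TR: "\<And>x. x \<in> V \<Longrightarrow> T x + R x = x" and x: "x \<in> V"
  shows "Re (ip (T x) (T x)) \<le> Re (ip x (T x))"
    and "Re (ip (T x) (T x)) = Re (ip x (T x)) \<Longrightarrow> T (T x) = T x"
proof -
  note l = lin_opD [OF pos_op_lin [OF T]] lin_opD [OF pos_op_lin [OF R]]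
  have Rx: "R x = x - T x" using TR [OF x] by (simp add: eq_diff_eq add.commute)
  have TRx: "T (R x) = T x - T (T x)"
    using x l by (simp add: Rx lin_op_diff [OF pos_op_lin [OF T]])
  have RTx: "R (T x) = T x - T (T x)"
    using TR [of "T x"] x l by (simp add: eq_diff_eq add.commute)
  have "ip x (T x) - ip (T x) (T x) = ip x (T (R x))"
    using x l pos_op_selfadj [OF T x, of "T x"] by (simp add: TRx ip_diff)
  also have "\<dots> = ip (T x + R x) (T (R x))" by (simp add: TR x)
  also have "\<dots> = ip (T x) (T (R x)) + ip (R x) (T (R x))"
    using x l by (simp add: ip_add_left)
  also have "ip (T x) (T (R x)) = ip (T x) (R (T x))" by (simp add: TRx RTx)
  finally have "Re (ip x (T x) - ip (T x) (T x)) = Re (ip (T x) (R (T x)) + ip (R x) (T (R x)))"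
    by (rule arg_cong)
  then have eq: "Re (ip x (T x)) - Re (ip (T x) (T x)) = Re (ip (T x) (R (T x))) + Re (ip (R x) (T (R x)))"
    by simp
  moreover have nn: "0 \<le> Re (ip (T x) (R (T x)))" "0 \<le> Re (ip (R x) (T (R x)))"
    using pos_op_ip(2) [OF R, of "T x"] pos_op_ip(2) [OF T, of "R x"] x l by simp_all
  ultimately show "Re (ip (T x) (T x)) \<le> Re (ip x (T x))" by linarith
  assume "Re (ip (T x) (T x)) = Re (ip x (T x))"
  then have "Re (ip (T x) (R (T x))) = 0" using eq nn by linarith
  then have "R (T x) = 0" using x l by (intro pos_op_null [OF R]) auto
  then show "T (T x) = T x" using RTx by simp
qed

locale winning_qmodel = qmodel sc V ip \<psi> M N p
  for sc :: "complex \<Rightarrow> 'x::ab_group_add \<Rightarrow> 'x" and V ip \<psi>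
    and M N :: "'n::finite \<Rightarrow> 'n \<Rightarrow> 'x \<Rightarrow> 'x" and p +
  fixes G :: "'n graph"
  assumes simple: "simple_graph G" and win: "winning G p"
begin

lemmas M_lin = pos_op_lin [OF M_pos] and N_lin = pos_op_lin [OF N_pos]

lemma MV [simp]: "x \<in> V \<Longrightarrow> M i l x \<in> V" and NV [simp]: "x \<in> V \<Longrightarrow> N i l x \<in> V"
  using lin_opD(1) M_lin N_lin by blast+

lemma M_square_le: "x \<in> V \<Longrightarrow> Re (ip (M i l x) (M i l x)) \<le> Re (ip x (M i l x))"
  and M_square_eq: "x \<in> V \<Longrightarrow> Re (ip (M i l x) (M i l x)) = Re (ip x (M i l x)) \<Longrightarrow> M i l (M i l x) = M i l x"
  and N_square_le: "x \<in> V \<Longrightarrow> Re (ip (N i l x) (N i l x)) \<le> Re (ip x (N i l x))"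
proof -
  have "M i l x + (\<Sum>k\<in>UNIV - {l}. M i k x) = x" "N i l x + (\<Sum>k\<in>UNIV - {l}. N i k x) = x" if "x \<in> V" for x
    using M_sum [OF that, of i] N_sum [OF that, of i] by (simp_all add: sum.remove [of UNIV l])
  note * = complemented_pos_op [OF M_pos pos_op_sum this(1), OF M_pos]
    complemented_pos_op [OF N_pos pos_op_sum this(2), OF N_pos]
  show "x \<in> V \<Longrightarrow> Re (ip (M i l x) (M i l x)) \<le> Re (ip x (M i l x))"
    "x \<in> V \<Longrightarrow> Re (ip (M i l x) (M i l x)) = Re (ip x (M i l x)) \<Longrightarrow> M i l (M i l x) = M i l x"
    "x \<in> V \<Longrightarrow> Re (ip (N i l x) (N i l x)) \<le> Re (ip x (N i l x))"
    using * by blast+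
qed

text \<open>For A = \<open>M i l \<psi>\<close> and B = \<open>N i l \<psi>\<close>, consider the
  squared norm of A - B plus the defects \<open>ip \<psi> A - ip A A\<close> and
  \<open>ip \<psi> B - ip B B\<close>. Summed over l this is 1 + 1 - 2, the last term because equal
  questions receive equal answers. All parts are nonnegative, so each vanishes.\<close>

lemma synchronous: "M i l \<psi> = N i l \<psi>" and M_idem: "M i l (M i l \<psi>) = M i l \<psi>"
proof -
  define A B where "A l = M i l \<psi>" and "B l = N i l \<psi>" for l
  have AV: "A l \<in> V" "B l \<in> V" for l using psi by (simp_all add: A_def B_def)
  have AB: "p l k i i = Re (ip (A l) (B k))" for l k
    using p_eq [of l k i i] pos_op_selfadj [OF M_pos psi AV(2)]
    by (metis A_def B_def Re_complex_of_real)
  have p0: "p l k i i = 0" if "l \<noteq> k" for l k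
    using win that by (auto simp: winning_def rel_def)
  have sA: "(\<Sum>l\<in>UNIV. A l) = \<psi>" and sB: "(\<Sum>l\<in>UNIV. B l) = \<psi>"
    using psi by (simp_all add: A_def B_def M_sum N_sum)
  have "Re (ip (A l) (B l)) = Re (ip (A l) \<psi>)" for l
  proof -
    have "ip (A l) \<psi> = (\<Sum>k\<in>UNIV. ip (A l) (B k))"
      unfolding sB [symmetric] by (rule ip_sum) (simp_all add: AV)
    then have "Re (ip (A l) \<psi>) = (\<Sum>k\<in>UNIV. p l k i i)" by (simp add: AB)
    also have "\<dots> = (\<Sum>k\<in>UNIV. if k = l then p l l i i else 0)"
      by (intro sum.cong) (auto simp: p0)
    finally show ?thesis by (simp add: AB)
  qed
  moreover have "(\<Sum>l\<in>UNIV. ip (A l) \<psi>) = ip \<psi> \<psi>" "(\<Sum>l\<in>UNIV. ip \<psi> (A l)) = ip \<psi> \<psi>"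
    "(\<Sum>l\<in>UNIV. ip \<psi> (B l)) = ip \<psi> \<psi>"
    using ip_sum_left [of \<psi> UNIV A] ip_sum [of \<psi> UNIV A] ip_sum [of \<psi> UNIV B] AV psi sA sB by auto
  ultimately have sums: "(\<Sum>l\<in>UNIV. Re (ip (A l) (B l))) = 1" "(\<Sum>l\<in>UNIV. Re (ip \<psi> (A l))) = 1"
    "(\<Sum>l\<in>UNIV. Re (ip \<psi> (B l))) = 1"
    using psi1 by (simp_all flip: Re_sum)
  have le: "Re (ip (A l) (A l)) \<le> Re (ip \<psi> (A l))" "Re (ip (B l) (B l)) \<le> Re (ip \<psi> (B l))" for l
    using psi by (simp_all add: A_def B_def M_square_le N_square_le)
  define f where "f l = Re (ip (A l - B l) (A l - B l)) +
    (Re (ip \<psi> (A l)) - Re (ip (A l) (A l))) + (Re (ip \<psi> (B l)) - Re (ip (B l) (B l)))" for l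
  have "f l = Re (ip \<psi> (A l)) + Re (ip \<psi> (B l)) - 2 * Re (ip (A l) (B l))" for l
    using AV [of l] Re_ip_commute [of "A l" "B l"] by (simp add: f_def ip_diff ip_diff_left)
  then have "(\<Sum>l\<in>UNIV. f l) = 0"
    using sums by (simp add: sum.distrib sum_subtractf flip: sum_distrib_left)
  moreover have nn: "0 \<le> Re (ip (A l - B l) (A l - B l))" for l
    using AV by (intro ip_nonneg) simp
  then have "0 \<le> f l" for l
    using le [of l] nn [of l] by (simp add: f_def)
  ultimately have "f l = 0" by (simp add: sum_nonneg_eq_0_iff)
  then have "Re (ip (A l - B l) (A l - B l)) = 0" "Re (ip (A l) (A l)) = Re (ip \<psi> (A l))"
    using le [of l] nn [of l] by (auto simp: f_def)
  then show "M i l \<psi> = N i l \<psi>" "M i l (M i l \<psi>) = M i l \<psi>"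
    using ip_zero_iff [of "A l - B l"] AV [of l] M_square_eq [OF psi, of i l]
    by (simp_all add: A_def B_def)
qed

text \<open>Winning only makes the single number \<open>ip \<psi> (M i l (N j k \<psi>))\<close>
  vanish. Idempotence at \<psi> turns it into the squared norm of
  \<open>N j k (M i l \<psi>)\<close>, and synchronicity then trades \<open>N j k\<close> for
  \<open>M j k\<close>.\<close>

lemma psi_mismatch:
  assumes "rel G i j \<noteq> rel G l k"
  shows "M i l (M j k \<psi>) = 0"
proof -
  have NN: "N j k (N j k \<psi>) = N j k \<psi>"
    using psi MN [of \<psi> j k j k] M_idem [of j k] by (simp flip: synchronous)
  have 0: "ip \<psi> (M i l (N j k \<psi>)) = 0"
    using win assms p_eq [of l k i j] by (simp add: winning_def)
  define x where "x = N j k (M i l \<psi>)"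
  have x: "x \<in> V" using psi by (simp add: x_def)
  have "ip x x = ip (M i l \<psi>) (N j k (N j k (M i l \<psi>)))"
    using psi pos_op_selfadj [OF N_pos, of "M i l \<psi>" "N j k (M i l \<psi>)"] by (simp add: x_def)
  also have "\<dots> = ip (M i l \<psi>) (M i l (N j k \<psi>))"
    using psi by (simp add: NN flip: MN)
  also have "\<dots> = ip \<psi> (M i l (M i l (N j k \<psi>)))"
    using psi pos_op_selfadj [OF M_pos, of \<psi> "M i l (N j k \<psi>)"] by simp
  also have "\<dots> = 0"
    using psi 0 by (simp add: MN M_idem)
  finally have "x = 0" using ip_zero_iff [OF x] by simp
  then show ?thesis using psi MN [of \<psi> i l j k] by (simp add: x_def synchronous [of j k])
qed

definition comm_orbit :: "'x set" where
  "comm_orbit = {T \<psi> |T. lin_op T \<and> (\<forall>i l. \<forall>x\<in>V. T (M i l x) = M i l (T x))}"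

lemma comm_orbitE:
  assumes "y \<in> comm_orbit"
  obtains T where "lin_op T" "\<And>i l x. x \<in> V \<Longrightarrow> T (M i l x) = M i l (T x)" "y = T \<psi>"
  using assms unfolding comm_orbit_def by blast

lemma comm_orbitI:
  "lin_op T \<Longrightarrow> (\<And>i l x. x \<in> V \<Longrightarrow> T (M i l x) = M i l (T x)) \<Longrightarrow> T \<psi> \<in> comm_orbit"
  by (auto simp: comm_orbit_def)

lemma comm_orbit_V: "y \<in> comm_orbit \<Longrightarrow> y \<in> V"
  using psi by (auto elim!: comm_orbitE simp: lin_opD)

lemma psi_comm_orbit: "\<psi> \<in> comm_orbit"
  using comm_orbitI [of "\<lambda>x. x"] by (simp add: lin_op_def)

text \<open>\<open>M i l (T \<psi>) = T (M i l \<psi>) = T (N i l \<psi>)\<close>, and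
  \<open>T\<close> composed with \<open>N i l\<close> still commutes with every
  \<open>M j k\<close>.\<close>

lemma M_comm_orbit:
  assumes "y \<in> comm_orbit"
  shows "M i l y \<in> comm_orbit"
proof -
  obtain T where T: "lin_op T" "\<And>i l x. x \<in> V \<Longrightarrow> T (M i l x) = M i l (T x)" "y = T \<psi>"
    using assms by (rule comm_orbitE) (rule that)
  have "M i l y = T (N i l \<psi>)" using T psi by (simp flip: synchronous)
  also have "\<dots> \<in> comm_orbit"
  proof (rule comm_orbitI [of "\<lambda>x. T (N i l x)"])
    show "lin_op (\<lambda>x. T (N i l x))" by (rule lin_op_comp [OF T(1) N_lin])
    fix j k x assume x: "x \<in> V"
    then have "T (N i l (M j k x)) = T (M j k (N i l x))" by (simp only: MN)
    then show "T (N i l (M j k x)) = M j k (T (N i l x))" using x T(2) by simp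
  qed
  finally show ?thesis .
qed

lemma subspace_comm_orbit: "subspace comm_orbit"
  unfolding subspace_def
proof (intro conjI ballI allI)
  show "0 \<in> comm_orbit"
    using comm_orbitI [of "\<lambda>_. 0"] by (simp add: lin_op_def lin_op_0 [OF M_lin])
  fix x y c assume x: "x \<in> comm_orbit"
  obtain T where T: "lin_op T" "\<And>i l x. x \<in> V \<Longrightarrow> T (M i l x) = M i l (T x)" "x = T \<psi>"
    using x by (rule comm_orbitE) (rule that)
  note Tl = lin_opD [OF T(1)]
  show "sc c x \<in> comm_orbit"
    unfolding T(3) using T(2) Tl
    by (intro comm_orbitI [of "\<lambda>z. sc c (T z)"])
      (auto simp: lin_op_def scale_right_distrib mult.commute lin_opD(3) [OF M_lin])
  assume y: "y \<in> comm_orbit"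
  obtain S where S: "lin_op S" "\<And>i l x. x \<in> V \<Longrightarrow> S (M i l x) = M i l (S x)" "y = S \<psi>"
    using y by (rule comm_orbitE) (rule that)
  note Sl = lin_opD [OF S(1)]
  show "x + y \<in> comm_orbit"
    unfolding T(3) S(3) using T(2) Tl S(2) Sl
    by (intro comm_orbitI [of "\<lambda>z. T z + S z"])
      (auto simp: lin_op_def scale_right_distrib add_ac lin_opD(2) [OF M_lin])
qed

text \<open>An operator identity at \<open>\<psi>\<close> between the \<open>M i l\<close> persists at \<open>T \<psi>\<close> when \<open>T\<close> commutes with them.\<close>

lemma qaut_comm_orbit: "qaut sc comm_orbit ip G M"
proof -
  interpret C: ip_space sc comm_orbit ip
    using subspace_comm_orbit comm_orbit_V
    by unfold_locales (auto intro: ip_cnj ip_add ip_sc ip_pos)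
  show ?thesis
  proof unfold_locales
    show "C.lin_op (M i l)" for i l
      using M_comm_orbit comm_orbit_V lin_opD [OF M_lin] by (auto simp: C.lin_op_def)
    show "ip x (M i l y) = ip (M i l x) y" if "x \<in> comm_orbit" "y \<in> comm_orbit" for x y i l
      using that comm_orbit_V by (intro pos_op_selfadj M_pos) auto
    show "(\<Sum>l\<in>UNIV. M i l y) = y" if "y \<in> comm_orbit" for y i
      using that comm_orbit_V by (simp add: M_sum)
    fix y i j k l assume y: "y \<in> comm_orbit" and r: "rel G i j \<noteq> rel G l k"
    obtain T where T: "lin_op T" "\<And>i l x. x \<in> V \<Longrightarrow> T (M i l x) = M i l (T x)" "y = T \<psi>"
      using y by (rule comm_orbitE) (rule that)
    have "M i l (M j k y) = T (M i l (M j k \<psi>))" using T psi by simp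
    then show "M i l (M j k y) = 0" using psi_mismatch [OF r] lin_op_0 [OF T(1)] by simp
  qed (rule simple)
qed

end

section \<open>Factorisation over a product graph\<close>

text \<open>The value \<open>undefined\<close> picks one row coordinate;
  \<open>qaut_fst_factor\<close> shows the choice to be immaterial on \<open>D\<close> when u
  commutes with \<open>1 \<otimes> J\<close>.\<close>

definition fst_factor :: "('v::finite \<times> 'w::finite \<Rightarrow> 'v \<times> 'w \<Rightarrow> 'x \<Rightarrow> 'x::comm_monoid_add) \<Rightarrow> 'v \<Rightarrow> 'v \<Rightarrow> 'x \<Rightarrow> 'x" where
  "fst_factor u i j y = (\<Sum>b\<in>UNIV. u (i, undefined) (j, b) y)"

definition snd_factor :: "('v::finite \<times> 'w::finite \<Rightarrow> 'v \<times> 'w \<Rightarrow> 'x \<Rightarrow> 'x::comm_monoid_add) \<Rightarrow> 'w \<Rightarrow> 'w \<Rightarrow> 'x \<Rightarrow> 'x" where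
  "snd_factor u a b y = (\<Sum>j\<in>UNIV. u (undefined, a) (j, b) y)"

text \<open>Polymorphic in the entries so that it exchanges the coordinates of graphs and of
  operator matrices alike; each claim about one factor then gives the one about the other.\<close>

definition flip :: "('v \<times> 'w \<Rightarrow> 'v \<times> 'w \<Rightarrow> 'a) \<Rightarrow> 'w \<times> 'v \<Rightarrow> 'w \<times> 'v \<Rightarrow> 'a" where
  "flip u k l = u (prod.swap k) (prod.swap l)"

lemma snd_factor_flip: "snd_factor u = fst_factor (flip u)"
  by (simp add: fun_eq_iff snd_factor_def fst_factor_def flip_def)

lemma sum_UNIV_swap: "(\<Sum>k\<in>UNIV. f (prod.swap k)) = (\<Sum>k\<in>UNIV. f k)"
  by (rule sum.reindex_bij_betw) (rule bij_swap)

lemma rel_flip: "rel (flip K) k l = rel K (prod.swap k) (prod.swap l)"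
  by (simp add: rel_def flip_def inj_eq)

lemma simple_graph_flip: "simple_graph K \<Longrightarrow> simple_graph (flip K)"
  by (auto simp: simple_graph_def flip_def symp_def irreflp_def)

lemma qaut_flip:
  assumes "qaut sc D ip K u"
  shows "qaut sc D ip (flip K) (flip u)"
proof -
  interpret qaut sc D ip K u by fact
  show ?thesis
    by unfold_locales
      (auto simp: simple_graph_flip simple flip_def lin sa row_sum rel_flip sum_UNIV_swap [of "\<lambda>l. u _ l _"]
        intro: mismatch)
qed

text \<open>By \<open>J\<close> an entry of the factor is a sum along any row coordinate or any
  column coordinate. A product of two entries can thus be expanded with both row coordinates, or
  both column coordinates, chosen freely; \<open>rel\<close> supplies a choice for which every term
  is mismatched.\<close>

lemma qaut_fst_factor:
  fixes K :: "('v::finite \<times> 'w::finite) graph" and G :: "'v graph"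
  assumes q: "qaut sc D ip K u" and G: "simple_graph G"
    and J: "\<And>i j a b y. y \<in> D \<Longrightarrow> (\<Sum>c\<in>UNIV. u (i, a) (j, c) y) = (\<Sum>c\<in>UNIV. u (i, c) (j, b) y)"
    and rel: "\<And>i k j l. rel G i k \<noteq> rel G j l \<Longrightarrow>
      (\<exists>a c. \<forall>b d. rel K (i, a) (k, c) \<noteq> rel K (j, b) (l, d)) \<or>
      (\<exists>b d. \<forall>a c. rel K (i, a) (k, c) \<noteq> rel K (j, b) (l, d))"
  shows "qaut sc D ip G (fst_factor u)"
    and "\<And>i j a y. y \<in> D \<Longrightarrow> fst_factor u i j y = (\<Sum>b\<in>UNIV. u (i, a) (j, b) y)"
    and "\<And>i j b y. y \<in> D \<Longrightarrow> fst_factor u i j y = (\<Sum>a\<in>UNIV. u (i, a) (j, b) y)"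
proof -
  interpret qaut sc D ip K u by (rule q)
  show col: "fst_factor u i j y = (\<Sum>a\<in>UNIV. u (i, a) (j, b) y)" if "y \<in> D" for i j b y
    unfolding fst_factor_def by (rule J [OF that])
  show row: "fst_factor u i j y = (\<Sum>b\<in>UNIV. u (i, a) (j, b) y)" if "y \<in> D" for i j a y
    unfolding col [OF that, of i j undefined] by (rule J [OF that, symmetric])
  have fD: "fst_factor u i j y \<in> D" if "y \<in> D" for i j y
    using that by (simp add: fst_factor_def)
  show "qaut sc D ip G (fst_factor u)"
  proof unfold_locales
    show "lin_op (fst_factor u i l)" for i l
      unfolding fst_factor_def by (rule lin_op_sumI) (rule lin)
    show "ip x (fst_factor u i l y) = ip (fst_factor u i l x) y" if "x \<in> D" "y \<in> D" for x y i l
      using that by (simp add: fst_factor_def ip_sum ip_sum_left sa)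
    show "(\<Sum>l\<in>UNIV. fst_factor u i l y) = y" if "y \<in> D" for y i
      using row_sum [OF that, of "(i, undefined)"] by (simp add: fst_factor_def sum_UNIV_pair)
    fix y i j k l assume y: "y \<in> D" and "rel G i j \<noteq> rel G l k"
    from rel [OF this(2)]
    show "fst_factor u i l (fst_factor u j k y) = 0"
    proof (elim disjE exE)
      fix a c assume *: "\<forall>b d. rel K (i, a) (j, c) \<noteq> rel K (l, b) (k, d)"
      have "fst_factor u i l (fst_factor u j k y) = (\<Sum>b\<in>UNIV. \<Sum>d\<in>UNIV. u (i, a) (l, b) (u (j, c) (k, d) y))"
        using y fD by (simp add: row [of _ i l a] row [of y j k c] lin_op_sum [OF lin])
      also have "\<dots> = 0" using * y by (simp add: mismatch)
      finally show ?thesis .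
    next
      fix b d assume *: "\<forall>a c. rel K (i, a) (j, c) \<noteq> rel K (l, b) (k, d)"
      have "fst_factor u i l (fst_factor u j k y) = (\<Sum>a\<in>UNIV. \<Sum>c\<in>UNIV. u (i, a) (l, b) (u (j, c) (k, d) y))"
        using y fD by (simp add: col [of _ i l b] col [of y j k d] lin_op_sum [OF lin])
      also have "\<dots> = 0" using * y by (simp add: mismatch)
      finally show ?thesis .
    qed
  qed (rule G)
qed

lemma bij_map_prod: "bij \<sigma> \<Longrightarrow> bij \<pi> \<Longrightarrow> bij (map_prod \<sigma> \<pi>)"
  using map_prod_inj_on [of \<sigma> UNIV \<pi> UNIV] map_prod_surj [of \<sigma> \<pi>] by (simp add: bij_def)

text \<open>Common ground of the two products. \<open>sep\<close> makes every eigenspace of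
  \<open>K\<close> a tensor product of eigenspaces; \<open>rel_fst\<close> and
  \<open>rel_snd\<close> say that a violated relation in a factor shows up in \<open>K\<close> for a
  suitable choice of the other coordinates on one side.\<close>

locale spectral_product =
  fixes G :: "'v::finite graph" and H :: "'w::finite graph" and K :: "('v \<times> 'w) graph"
    and F :: "real \<Rightarrow> real \<Rightarrow> real"
  assumes G: "simple_graph G" "connected_graph G" "regular_graph G"
    and H: "simple_graph H" "connected_graph H" "regular_graph H"
    and K: "simple_graph K"
    and eig: "\<And>x y a b k. adj_matrix G *v x = a *\<^sub>R x \<Longrightarrow> adj_matrix H *v y = b *\<^sub>R y \<Longrightarrow>
      (\<Sum>l | K k l. x $ fst l * y $ snd l) = F a b * (x $ fst k * y $ snd k)"
    and sep: "\<And>a a' b b'. complex_of_real a \<in> graph_eigenvalues G \<Longrightarrow> complex_of_real a' \<in> graph_eigenvalues G \<Longrightarrow>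
      complex_of_real b \<in> graph_eigenvalues H \<Longrightarrow> complex_of_real b' \<in> graph_eigenvalues H \<Longrightarrow>
      F a b = F a' b' \<Longrightarrow> a = a' \<and> b = b'"
    and rel_fst: "\<And>i k j l. rel G i k \<noteq> rel G j l \<Longrightarrow>
      (\<exists>a c. \<forall>b d. rel K (i, a) (k, c) \<noteq> rel K (j, b) (l, d)) \<or>
      (\<exists>b d. \<forall>a c. rel K (i, a) (k, c) \<noteq> rel K (j, b) (l, d))"
    and rel_snd: "\<And>a c b d. rel H a c \<noteq> rel H b d \<Longrightarrow>
      (\<exists>i k. \<forall>j l. rel K (i, a) (k, c) \<noteq> rel K (j, b) (l, d)) \<or>
      (\<exists>j l. \<forall>i k. rel K (i, a) (k, c) \<noteq> rel K (j, b) (l, d))"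
    and aut: "\<And>\<sigma> \<pi>. \<sigma> \<in> graph_aut G \<Longrightarrow> \<pi> \<in> graph_aut H \<Longrightarrow> map_prod \<sigma> \<pi> \<in> graph_aut K"

lemma spectral_product_flip:
  assumes "spectral_product G H K F"
  shows "spectral_product H G (flip K) (\<lambda>a b. F b a)"
proof -
  interpret spectral_product G H K F by fact
  show ?thesis
  proof unfold_locales
    show "(\<Sum>l | flip K k l. x $ fst l * y $ snd l) = F b a * (x $ fst k * y $ snd k)"
      if "adj_matrix H *v x = a *\<^sub>R x" "adj_matrix G *v y = b *\<^sub>R y" for x y a b k
    proof -
      have "(\<Sum>l | flip K k l. x $ fst l * y $ snd l) =
          (\<Sum>l\<in>UNIV. if K (prod.swap k) (prod.swap l) then x $ snd (prod.swap l) * y $ fst (prod.swap l) else 0)"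
        by (simp add: flip_def sum.If_cases)
      also have "\<dots> = (\<Sum>l\<in>UNIV. if K (prod.swap k) l then x $ snd l * y $ fst l else 0)"
        by (rule sum_UNIV_swap)
      also have "\<dots> = (\<Sum>l | K (prod.swap k) l. y $ fst l * x $ snd l)"
        by (simp add: sum.If_cases mult.commute)
      finally show ?thesis
        using eig [OF that(2,1), of "prod.swap k"] by (simp add: mult.commute)
    qed
    show "a = a' \<and> b = b'"
      if "complex_of_real a \<in> graph_eigenvalues H" "complex_of_real a' \<in> graph_eigenvalues H"
        "complex_of_real b \<in> graph_eigenvalues G" "complex_of_real b' \<in> graph_eigenvalues G"
        "F b a = F b' a'" for a a' b b'
      using sep [OF that(3,4,1,2,5)] by simp
    show "map_prod \<pi> \<sigma> \<in> graph_aut (flip K)" if "\<pi> \<in> graph_aut H" "\<sigma> \<in> graph_aut G" for \<pi> \<sigma>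
    proof -
      have "bij (map_prod \<pi> \<sigma>)"
        using that by (intro bij_map_prod) (auto simp: graph_aut_def)
      then show ?thesis
        using aut [OF that(2,1)] by (auto simp: graph_aut_def flip_def)
    qed
  qed (use G H K simple_graph_flip rel_fst rel_snd in \<open>auto simp: rel_flip\<close>)
qed

context spectral_product
begin

text \<open>For fixed y and z the real numbers \<open>Re (ip z (u k l y))\<close> form a matrix
  commuting with the adjacency matrix of \<open>K\<close>, to which the scalar result
  applies.\<close>

lemma row_sum_eq_col_sum:
  assumes "qaut sc D ip K u" and y: "y \<in> D"
  shows "(\<Sum>k\<in>UNIV. u (i, a) (k, b) y) = (\<Sum>k\<in>UNIV. u (k, a) (j, b) y)"
proof -
  interpret qaut sc D ip K u by fact
  show ?thesis
  proof (rule eq_by_ip)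
    fix z assume z: "z \<in> D"
    define T where "T k l = Re (ip z (u k l y))" for k l
    define B where "B k l = (if K k l then 1 else 0 :: real)" for k l
    have "(\<Sum>k\<in>UNIV. T (i, a) (k, b)) = (\<Sum>k\<in>UNIV. T (k, a) (j, b))"
    proof (rule intertwiner_row_sum_eq_col_sum [where B = B and F = F, OF G H(1)])
      show "B k l = B l k" for k l
        using K unfolding simple_graph_def by (auto simp: B_def dest: sympD)
      show "(\<Sum>l\<in>UNIV. B k l * (x $ fst l * y $ snd l)) = F a b * (x $ fst k * y $ snd k)"
        if "adj_matrix G *v x = a *\<^sub>R x" "adj_matrix H *v y = b *\<^sub>R y" for x y a b k
      proof -
        have "(\<Sum>l\<in>UNIV. B k l * (x $ fst l * y $ snd l)) =
            (\<Sum>l\<in>UNIV. if K k l then x $ fst l * y $ snd l else 0)"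
          by (intro sum.cong) (auto simp: B_def)
        then show ?thesis using eig [OF that, of k] by (simp add: sum.If_cases)
      qed
      show "(\<Sum>m\<in>UNIV. T k m * B m l) = (\<Sum>m\<in>UNIV. B k m * T m l)" for k l
      proof -
        have "(\<Sum>m\<in>UNIV. T k m * B m l) = (\<Sum>m\<in>UNIV. if K m l then T k m else 0)"
          by (intro sum.cong) (auto simp: B_def)
        also have "\<dots> = Re (ip z (\<Sum>m | K m l. u k m y))"
          using y z by (simp add: sum.If_cases T_def ip_sum)
        also have "\<dots> = Re (ip z (\<Sum>m | K k m. u m l y))"
          by (simp only: adj_commute [OF y])
        also have "\<dots> = (\<Sum>m\<in>UNIV. if K k m then T m l else 0)"
          using y z by (simp add: sum.If_cases T_def ip_sum)
        also have "\<dots> = (\<Sum>m\<in>UNIV. B k m * T m l)"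
          by (intro sum.cong) (auto simp: B_def)
        finally show ?thesis .
      qed
      show "a = a'" if "complex_of_real a \<in> graph_eigenvalues G" "complex_of_real a' \<in> graph_eigenvalues G"
        "complex_of_real b \<in> graph_eigenvalues H" "complex_of_real b' \<in> graph_eigenvalues H"
        "F a b = F a' b'" for a a' b b'
        using sep [OF that] by simp
    qed
    then show "Re (ip z (\<Sum>k\<in>UNIV. u (i, a) (k, b) y)) = Re (ip z (\<Sum>k\<in>UNIV. u (k, a) (j, b) y))"
      using y z by (simp add: T_def ip_sum)
  qed (use y in simp_all)
qed

context
  fixes sc :: "complex \<Rightarrow> 'x::ab_group_add \<Rightarrow> 'x" and D ip u
  assumes q: "qaut sc D ip K u"
begin

interpretation qaut sc D ip K u by (rule q)

lemma fst_sums: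
  assumes "y \<in> D"
  shows "(\<Sum>c\<in>UNIV. u (i, a) (j, c) y) = (\<Sum>c\<in>UNIV. u (i, c) (j, b) y)"
  using spectral_product.row_sum_eq_col_sum [OF spectral_product_flip qaut_flip [OF q] assms,
      OF spectral_product_axioms, of a i j b]
  by (simp add: flip_def)

lemma qaut_fst: "qaut sc D ip G (fst_factor u)"
  and fst_row: "y \<in> D \<Longrightarrow> fst_factor u i j y = (\<Sum>b\<in>UNIV. u (i, a) (j, b) y)"
  using qaut_fst_factor [OF q G(1) fst_sums rel_fst] by blast+

lemma qaut_snd: "qaut sc D ip H (snd_factor u)"
  and snd_row: "y \<in> D \<Longrightarrow> snd_factor u a b y = (\<Sum>j\<in>UNIV. u (i, a) (j, b) y)"
proof -
  have "(\<Sum>c\<in>UNIV. flip u (a, i) (b, c) y) = (\<Sum>c\<in>UNIV. flip u (a, c) (b, j) y)" if "y \<in> D" for a b i j y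
    using row_sum_eq_col_sum [OF q that] by (simp add: flip_def)
  moreover have "(\<exists>i k. \<forall>j l. rel (flip K) (a, i) (c, k) \<noteq> rel (flip K) (b, j) (d, l)) \<or>
      (\<exists>j l. \<forall>i k. rel (flip K) (a, i) (c, k) \<noteq> rel (flip K) (b, j) (d, l))"
    if "rel H a c \<noteq> rel H b d" for a c b d
    using rel_snd [OF that] by (simp add: rel_flip)
  ultimately show "qaut sc D ip H (snd_factor u)"
    and "y \<in> D \<Longrightarrow> snd_factor u a b y = (\<Sum>j\<in>UNIV. u (i, a) (j, b) y)"
    using qaut_fst_factor [OF qaut_flip [OF q] H(1)] unfolding snd_factor_flip
    by (auto simp: flip_def)
qed

text \<open>Both factors are expanded along the same row (i, a); row orthogonality leaves just the
  term at (j, b).\<close>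

lemma fst_snd_factor:
  assumes y: "y \<in> D"
  shows "fst_factor u i j (snd_factor u a b y) = u (i, a) (j, b) y"
    and "snd_factor u a b (fst_factor u i j y) = u (i, a) (j, b) y"
proof -
  have D: "fst_factor u i j y \<in> D" "snd_factor u a b y \<in> D"
    using y by (simp_all add: fst_factor_def snd_factor_def)
  have "fst_factor u i j (snd_factor u a b y) = (\<Sum>b'\<in>UNIV. u (i, a) (j, b') (snd_factor u a b y))"
    by (rule fst_row [OF D(2)])
  also have "\<dots> = (\<Sum>b'\<in>UNIV. \<Sum>j'\<in>UNIV. u (i, a) (j, b') (u (i, a) (j', b) y))"
    using y by (simp add: snd_row [OF y, of a b i] lin_op_sum [OF lin])
  also have "\<dots> = (\<Sum>b'\<in>UNIV. \<Sum>j'\<in>UNIV. if j' = j then if b' = b then u (i, a) (j, b) y else 0 else 0)"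
    using y by (intro sum.cong refl) (auto simp: row_orth idem)
  finally show "fst_factor u i j (snd_factor u a b y) = u (i, a) (j, b) y" by simp
  have "snd_factor u a b (fst_factor u i j y) = (\<Sum>j'\<in>UNIV. u (i, a) (j', b) (fst_factor u i j y))"
    by (rule snd_row [OF D(1)])
  also have "\<dots> = (\<Sum>j'\<in>UNIV. \<Sum>b'\<in>UNIV. u (i, a) (j', b) (u (i, a) (j, b') y))"
    using y by (simp add: fst_row [OF y, of i j a] lin_op_sum [OF lin])
  also have "\<dots> = (\<Sum>j'\<in>UNIV. \<Sum>b'\<in>UNIV. if b' = b then if j' = j then u (i, a) (j, b) y else 0 else 0)"
    using y by (intro sum.cong refl) (auto simp: row_orth idem)
  finally show "snd_factor u a b (fst_factor u i j y) = u (i, a) (j, b) y" by simp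
qed

end

end

section \<open>Decomposition of winning correlations\<close>

text \<open>Classical correlations without normalisation, because the pieces into which \<psi> is
  split are not unit vectors and their contributions have to be added.\<close>

definition aut_cone :: "'v::finite graph \<Rightarrow> 'v correlation \<Rightarrow> bool" where
  "aut_cone G q \<longleftrightarrow> (\<exists>c. (\<forall>\<pi>\<in>graph_aut G. 0 \<le> c \<pi>) \<and>
      (\<forall>l k i j. q l k i j = (\<Sum>\<pi>\<in>graph_aut G. c \<pi> * aut_correlation \<pi> l k i j)))"

lemma aut_cone_0: "aut_cone G (\<lambda>l k i j. 0)"
  unfolding aut_cone_def by (intro exI [of _ "\<lambda>_. 0"]) simp

lemma aut_cone_add:
  assumes "aut_cone G q" "aut_cone G r"
  shows "aut_cone G (\<lambda>l k i j. q l k i j + r l k i j)"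
proof -
  obtain c d where "\<forall>\<pi>\<in>graph_aut G. 0 \<le> c \<pi>" "\<forall>\<pi>\<in>graph_aut G. 0 \<le> d \<pi>"
    "\<forall>l k i j. q l k i j = (\<Sum>\<pi>\<in>graph_aut G. c \<pi> * aut_correlation \<pi> l k i j)"
    "\<forall>l k i j. r l k i j = (\<Sum>\<pi>\<in>graph_aut G. d \<pi> * aut_correlation \<pi> l k i j)"
    using assms unfolding aut_cone_def by blast
  then show ?thesis
    unfolding aut_cone_def
    by (intro exI [of _ "\<lambda>\<pi>. c \<pi> + d \<pi>"]) (simp add: distrib_right sum.distrib)
qed

lemma aut_cone_sum:
  assumes "finite A" "\<And>a. a \<in> A \<Longrightarrow> aut_cone G (q a)"
  shows "aut_cone G (\<lambda>l k i j. \<Sum>a\<in>A. q a l k i j)"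
  using assms by (induction A rule: finite_induct) (simp_all add: aut_cone_0 aut_cone_add)

lemma aut_cone_aut:
  assumes "\<pi> \<in> graph_aut G" "0 \<le> r"
  shows "aut_cone G (\<lambda>l k i j. r * aut_correlation \<pi> l k i j)"
  unfolding aut_cone_def
proof (intro exI [of _ "\<lambda>\<sigma>. if \<sigma> = \<pi> then r else 0"] conjI allI)
  fix l k i j
  have "(\<Sum>\<sigma>\<in>graph_aut G. (if \<sigma> = \<pi> then r else 0) * aut_correlation \<sigma> l k i j) =
      (\<Sum>\<sigma>\<in>graph_aut G. if \<sigma> = \<pi> then r * aut_correlation \<pi> l k i j else 0)"
    by (intro sum.cong) auto
  then show "r * aut_correlation \<pi> l k i j =
      (\<Sum>\<sigma>\<in>graph_aut G. (if \<sigma> = \<pi> then r else 0) * aut_correlation \<sigma> l k i j)"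
    using assms(1) by simp
qed (use assms in auto)

lemma aut_cone_winning_classical:
  assumes "aut_cone G p" "correlation p"
  shows "winning_classical G p"
proof -
  obtain c where c: "\<forall>\<pi>\<in>graph_aut G. 0 \<le> c \<pi>"
    and p: "\<And>l k i j. p l k i j = (\<Sum>\<pi>\<in>graph_aut G. c \<pi> * aut_correlation \<pi> l k i j)"
    using assms(1) unfolding aut_cone_def by blast
  \<comment> \<open>Any question pair serves: each automorphism has total mass 1 there, so
    normalisation of p makes the weights sum to 1.\<close>
  fix i
  have a: "(\<Sum>l\<in>UNIV. \<Sum>k\<in>UNIV. aut_correlation \<pi> l k i i) = 1" for \<pi> :: "'a \<Rightarrow> 'a"
  proof -
    have "aut_correlation \<pi> l k i i = (if k = \<pi> i then if l = \<pi> i then 1 else 0 else 0)" for l k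
      by (simp add: aut_correlation_def)
    then show ?thesis by simp
  qed
  have "1 = (\<Sum>l\<in>UNIV. \<Sum>k\<in>UNIV. p l k i i)"
    using assms(2) by (simp add: correlation_def)
  also have "\<dots> = (\<Sum>l\<in>UNIV. \<Sum>\<pi>\<in>graph_aut G. \<Sum>k\<in>UNIV. c \<pi> * aut_correlation \<pi> l k i i)"
    unfolding p by (intro sum.cong refl sum.swap)
  also have "\<dots> = (\<Sum>\<pi>\<in>graph_aut G. c \<pi> * (\<Sum>l\<in>UNIV. \<Sum>k\<in>UNIV. aut_correlation \<pi> l k i i))"
    unfolding sum_distrib_left by (rule sum.swap)
  also have "\<dots> = (\<Sum>\<pi>\<in>graph_aut G. c \<pi>)" by (simp add: a)
  finally show ?thesis
    unfolding winning_classical_def using c p by (intro exI [of _ c]) simp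
qed

text \<open>The product of \<open>u a (\<pi> a)\<close> and \<open>u b (\<pi> b)\<close> fixes the
  nonzero y, so the pairs cannot be mismatched; the case of equality gives injectivity.\<close>

lemma (in qaut) fixed_vector_automorphism:
  assumes y: "y \<in> D" "y \<noteq> 0" and \<pi>: "\<And>a. u a (\<pi> a) y = y"
  shows "\<pi> \<in> graph_aut G"
proof -
  have rel: "rel G a b = rel G (\<pi> a) (\<pi> b)" for a b
    using mismatch [OF y(1), of a b "\<pi> a" "\<pi> b"] \<pi> y(2) by metis
  have "inj \<pi>"
  proof (rule injI)
    fix a b assume "\<pi> a = \<pi> b"
    then show "a = b" using rel [of a b] by (auto simp: rel_def split: if_splits)
  qed
  then have "bij \<pi>" by (simp add: bij_def finite_UNIV_inj_surj)
  moreover have "G (\<pi> a) (\<pi> b) \<longleftrightarrow> G a b" for a b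
    using rel [of a b] by (simp flip: rel_Adjacent)
  ultimately show ?thesis by (simp add: graph_aut_def)
qed

locale product_game =
  spectral_product G H K F + winning_qmodel fscale V ip \<psi> M N p K
  for G :: "'v::finite graph" and H :: "'w::finite graph" and K :: "('v \<times> 'w) graph" and F
    and V :: "(nat \<Rightarrow> complex) set" and ip \<psi> M N p +
  assumes no_nonlocal: "\<not> nonlocal_symmetry TYPE(nat \<Rightarrow> complex) G"
    and no_quantum: "no_quantum_symmetry H"
begin

abbreviation "D \<equiv> comm_orbit"
abbreviation "v \<equiv> fst_factor M"
abbreviation "w \<equiv> snd_factor M"
abbreviation "v' \<equiv> fst_factor N"

sublocale Q: qaut fscale D ip K M by (rule qaut_comm_orbit)
sublocale v: qaut fscale D ip G v by (rule qaut_fst) (rule qaut_comm_orbit)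
sublocale w: qaut fscale D ip H w by (rule qaut_snd) (rule qaut_comm_orbit)

lemmas vw = fst_snd_factor [OF qaut_comm_orbit]

lemma wv: "y \<in> D \<Longrightarrow> w a b (v i j y) = v i j (w a b y)"
  by (simp add: vw)

lemma ww: "y \<in> D \<Longrightarrow> w a b (w c d y) = w c d (w a b y)"
  by (rule w.no_quantum_symmetry_commute [OF no_quantum])

lemma wM: "y \<in> D \<Longrightarrow> w a b (M i l y) = M i l (w a b y)"
  by (cases i; cases l) (simp add: wv ww flip: vw(1))

lemma v_pos: "pos_op (v i j)" and v'_pos: "pos_op (v' i j)"
  unfolding fst_factor_def by (intro pos_op_sum M_pos N_pos)+

lemma v_V [simp]: "x \<in> V \<Longrightarrow> v i j x \<in> V" and v'_V [simp]: "x \<in> V \<Longrightarrow> v' i j x \<in> V"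
  using lin_opD(1) pos_op_lin v_pos v'_pos by blast+

lemma MN_sum:
  "x \<in> V \<Longrightarrow> (\<Sum>k\<in>A. M (f k) (f' k) (\<Sum>l\<in>B. N (g l) (g' l) x)) = (\<Sum>l\<in>B. N (g l) (g' l) (\<Sum>k\<in>A. M (f k) (f' k) x))"
  by (simp add: lin_op_sum [OF M_lin] lin_op_sum [OF N_lin] MN) (rule sum.swap)

lemma vv': "x \<in> V \<Longrightarrow> v i j (v' k l x) = v' k l (v i j x)"
  unfolding fst_factor_def by (rule MN_sum)

lemma wv': "x \<in> V \<Longrightarrow> w a b (v' k l x) = v' k l (w a b x)"
  unfolding fst_factor_def snd_factor_def by (rule MN_sum)

text \<open>The property of \<psi> that the reduction to \<open>G\<close> relies on: the two
  players' first factors agree at \<phi>. It survives splitting because w commutes with v and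
  \<open>v'\<close>.\<close>

definition sync :: "(nat \<Rightarrow> complex) \<Rightarrow> bool" where
  "sync \<phi> \<longleftrightarrow> \<phi> \<in> D \<and> (\<forall>j k. v' j k \<phi> = v j k \<phi>)"

lemma sync_psi: "sync \<psi>"
  by (simp add: sync_def psi_comm_orbit fst_factor_def synchronous)

lemma sync_w: "sync \<phi> \<Longrightarrow> sync (w a b \<phi>)"
  using comm_orbit_V [of \<phi>] by (auto simp: sync_def wv simp flip: wv')

text \<open>
  Compressed to a vector \<open>\<phi>\<close>, the first factor is a winning quantum correlation for \<open>G\<close> up to
  normalisation.
\<close>

lemma sync_aut_cone_G:
  assumes \<phi>: "sync \<phi>" and nz: "\<phi> \<noteq> 0"
  shows "aut_cone G (\<lambda>l k i j. Re (ip \<phi> (v i l (v j k \<phi>))))"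
proof -
  have \<phi>D: "\<phi> \<in> D" and v'\<phi>: "v' j k \<phi> = v j k \<phi>" for j k
    using \<phi> by (auto simp: sync_def)
  have \<phi>V: "\<phi> \<in> V" by (rule comm_orbit_V [OF \<phi>D])
  define r where "r = Re (ip \<phi> \<phi>)"
  have r: "r > 0" using ip_pos [OF \<phi>V nz] by (simp add: r_def)
  define q where "q l k i j = Re (ip \<phi> (v i l (v j k \<phi>))) / r" for l k i j
  \<comment> \<open>In this form the positivity of \<open>v'\<close> makes the value real and
    nonnegative.\<close>
  have ip_eq: "ip \<phi> (v i l (v j k \<phi>)) = ip (v i l \<phi>) (v' j k (v i l \<phi>))" for l k i j
  proof -
    have "ip \<phi> (v i l (v j k \<phi>)) = ip \<phi> (v i l (v i l (v j k \<phi>)))"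
      using \<phi>D by (simp add: v.idem)
    also have "\<dots> = ip (v i l \<phi>) (v i l (v j k \<phi>))"
      using \<phi>D by (simp add: v.sa)
    also have "\<dots> = ip (v i l \<phi>) (v i l (v' j k \<phi>))" by (simp only: v'\<phi>)
    also have "\<dots> = ip (v i l \<phi>) (v' j k (v i l \<phi>))" by (simp only: vv' [OF \<phi>V])
    finally show ?thesis .
  qed
  have real: "of_real (Re (ip \<phi> (v i l (v j k \<phi>)))) = ip \<phi> (v i l (v j k \<phi>))"
    and nonneg: "0 \<le> Re (ip \<phi> (v i l (v j k \<phi>)))" for l k i j
    unfolding ip_eq using pos_op_ip [OF v'_pos, of "v i l \<phi>"] \<phi>V by simp_all
  have sum1: "(\<Sum>l\<in>UNIV. \<Sum>k\<in>UNIV. q l k i j) = 1" for i j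
  proof -
    have "(\<Sum>l\<in>UNIV. \<Sum>k\<in>UNIV. ip \<phi> (v i l (v j k \<phi>))) = (\<Sum>k\<in>UNIV. ip \<phi> (\<Sum>l\<in>UNIV. v i l (v j k \<phi>)))"
      using \<phi>D Q.ip_sum [of \<phi>] by (simp add: Q.ip_sum) (rule sum.swap)
    also have "\<dots> = ip \<phi> \<phi>"
      using \<phi>D Q.ip_sum [of \<phi> UNIV "\<lambda>k. v j k \<phi>"] by (simp add: v.row_sum)
    finally have "(\<Sum>l\<in>UNIV. \<Sum>k\<in>UNIV. Re (ip \<phi> (v i l (v j k \<phi>)))) = r"
      by (simp add: r_def flip: Re_sum)
    then show ?thesis using r by (simp add: q_def flip: sum_divide_distrib)
  qed
  have "correlation q"
    unfolding correlation_def
  proof (intro conjI allI)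
    fix l k i j
    have q0: "0 \<le> q l k i j" for l k using nonneg r by (simp add: q_def)
    have "q l k i j \<le> (\<Sum>k\<in>UNIV. q l k i j)" by (rule member_le_sum) (simp_all add: q0)
    also have "\<dots> \<le> (\<Sum>l\<in>UNIV. \<Sum>k\<in>UNIV. q l k i j)"
      by (rule member_le_sum [of l UNIV "\<lambda>l. \<Sum>k\<in>UNIV. q l k i j"]) (simp_all add: q0 sum_nonneg)
    finally show "q l k i j \<in> {0..1}" using q0 sum1 by simp
  qed (rule sum1)
  define s where "s = complex_of_real (1 / sqrt r)"
  have ss: "s * s = of_real (1 / r)"
    using r by (simp add: s_def flip: of_real_mult)
  have sreal: "cnj s = s" by (simp add: s_def)
  have "qmodel fscale V ip (fscale s \<phi>) v v' q"
  proof unfold_locales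
    show "fscale s \<phi> \<in> V" using \<phi>V by simp
    have "ip (fscale s \<phi>) (fscale s \<phi>) = (s * s) * ip \<phi> \<phi>"
      using \<phi>V by (simp add: ip_sc ip_sc_left sreal)
    then show "Re (ip (fscale s \<phi>) (fscale s \<phi>)) = 1"
      using r by (simp add: ss r_def)
    show "(\<Sum>l\<in>UNIV. v i l x) = x" "(\<Sum>l\<in>UNIV. v' i l x) = x" if "x \<in> V" for i x
      using M_sum [OF that, of "(i, undefined)"] N_sum [OF that, of "(i, undefined)"]
      by (simp_all add: fst_factor_def sum_UNIV_pair)
    show "of_real (q l k i j) = ip (fscale s \<phi>) (v i l (v' j k (fscale s \<phi>)))" for l k i j
    proof -
      note lin = lin_opD(3) [OF pos_op_lin [OF v_pos]] lin_opD(3) [OF pos_op_lin [OF v'_pos]]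
      have "ip (fscale s \<phi>) (v i l (v' j k (fscale s \<phi>))) = (s * s) * ip \<phi> (v i l (v j k \<phi>))"
        using \<phi>V by (simp add: lin ip_sc ip_sc_left sreal v'\<phi>)
      then show ?thesis using real [of i l j k] by (simp add: q_def ss)
    qed
  qed (simp_all add: v_pos v'_pos vv')
  then have "quantum_correlation TYPE(nat \<Rightarrow> complex) q"
    using \<open>correlation q\<close> by (rule qmodel_quantum_correlation)
  moreover have "winning G q"
    using \<phi>D by (auto simp: winning_def q_def v.mismatch)
  ultimately obtain c where c: "\<forall>\<sigma>\<in>graph_aut G. 0 \<le> c \<sigma>"
    and q: "\<And>l k i j. q l k i j = (\<Sum>\<sigma>\<in>graph_aut G. c \<sigma> * aut_correlation \<sigma> l k i j)"
    using no_nonlocal unfolding nonlocal_symmetry_def winning_classical_def by blast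
  have "Re (ip \<phi> (v i l (v j k \<phi>))) = r * q l k i j" for l k i j
    using r by (simp add: q_def)
  then have "Re (ip \<phi> (v i l (v j k \<phi>))) = (\<Sum>\<sigma>\<in>graph_aut G. (r * c \<sigma>) * aut_correlation \<sigma> l k i j)" for l k i j
    by (simp add: q sum_distrib_left mult.assoc)
  then show ?thesis
    unfolding aut_cone_def using c r by (intro exI [of _ "\<lambda>\<sigma>. r * c \<sigma>"]) simp
qed

text \<open>On \<phi> the operator \<open>w a b\<close> is 1 or 0 according to b = \<pi> a. Since
  \<open>M\<close> is a product of v and w, the correlation is that of \<open>G\<close> with the
  second coordinate moved by \<pi>, which is an automorphism of \<open>H\<close> unless \<phi> =
  0.\<close>

lemma resolved_aut_cone:
  assumes \<phi>: "sync \<phi>" and \<pi>: "\<And>a. w a (\<pi> a) \<phi> = \<phi>"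
  shows "aut_cone K (\<lambda>l k i j. Re (ip \<phi> (M i l (M j k \<phi>))))"
proof (cases "\<phi> = 0")
  case True
  then show ?thesis
    by (simp add: lin_op_0 [OF M_lin] aut_cone_0)
next
  case False
  have \<phi>D: "\<phi> \<in> D" using \<phi> by (simp add: sync_def)
  have \<pi>_aut: "\<pi> \<in> graph_aut H" by (rule w.fixed_vector_automorphism [OF \<phi>D False \<pi>])
  obtain c where c: "\<forall>\<sigma>\<in>graph_aut G. 0 \<le> c \<sigma>" and
    eq: "\<And>l k i j. Re (ip \<phi> (v i l (v j k \<phi>))) = (\<Sum>\<sigma>\<in>graph_aut G. c \<sigma> * aut_correlation \<sigma> l k i j)"
    using sync_aut_cone_G [OF \<phi> False] unfolding aut_cone_def by blast
  have w\<phi>: "w a b \<phi> = (if b = \<pi> a then \<phi> else 0)" for a b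
    using w.row_orth [OF \<phi>D, of b "\<pi> a" a] \<pi> by simp
  have zero: "M i l 0 = 0" "v i1 l1 0 = 0" for i l i1 l1
    using lin_op_0 [OF M_lin] Q.lin_op_0 [OF v.lin] by auto
  have "Re (ip \<phi> (M i l (M j k \<phi>))) =
      (\<Sum>\<sigma>\<in>graph_aut G. c \<sigma> * aut_correlation (map_prod \<sigma> \<pi>) l k i j)" for l k i j
  proof -
    obtain i1 i2 l1 l2 j1 j2 k1 k2 where s: "i = (i1, i2)" "l = (l1, l2)" "j = (j1, j2)" "k = (k1, k2)"
      by (metis surj_pair)
    have "M i l (M j k \<phi>) = v i1 l1 (w i2 l2 (v j1 k1 (w j2 k2 \<phi>)))"
      using \<phi>D by (simp add: s vw(1))
    also have "\<dots> = v i1 l1 (v j1 k1 (w i2 l2 (w j2 k2 \<phi>)))"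
      using \<phi>D by (simp add: wv)
    also have "\<dots> = (if l2 = \<pi> i2 \<and> k2 = \<pi> j2 then v i1 l1 (v j1 k1 \<phi>) else 0)"
      using Q.lin_op_0 [OF w.lin] zero by (simp add: w\<phi>)
    finally have "Re (ip \<phi> (M i l (M j k \<phi>))) =
        (if l2 = \<pi> i2 \<and> k2 = \<pi> j2 then Re (ip \<phi> (v i1 l1 (v j1 k1 \<phi>))) else 0)"
      using \<phi>D by simp
    also have "\<dots> = (\<Sum>\<sigma>\<in>graph_aut G. c \<sigma> * aut_correlation (map_prod \<sigma> \<pi>) l k i j)"
      by (auto simp: eq s aut_correlation_def intro!: sum.cong)
    finally show ?thesis .
  qed
  moreover have "aut_cone K (\<lambda>l k i j. \<Sum>\<sigma>\<in>graph_aut G. c \<sigma> * aut_correlation (map_prod \<sigma> \<pi>) l k i j)"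
    using c aut \<pi>_aut by (intro aut_cone_sum aut_cone_aut) auto
  ultimately show ?thesis by simp
qed

text \<open>Split \<open>\<phi> = \<Sum>\<^sub>b w a b \<phi>\<close> for one vertex \<open>a\<close> of \<open>H\<close> after the other.\<close>

lemma sync_aut_cone:
  assumes "finite B" and "sync \<phi>" and "\<And>a. a \<notin> B \<Longrightarrow> \<exists>b. w a b \<phi> = \<phi>"
  shows "aut_cone K (\<lambda>l k i j. Re (ip \<phi> (M i l (M j k \<phi>))))"
  using assms
proof (induction B arbitrary: \<phi> rule: finite_induct)
  case empty
  then obtain \<pi> where "\<And>a. w a (\<pi> a) \<phi> = \<phi>" by (metis empty_iff)
  then show ?case using resolved_aut_cone empty.prems(1) by blast
next
  case (insert a B)
  have \<phi>D: "\<phi> \<in> D" using insert.prems(1) by (simp add: sync_def)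
  have "aut_cone K (\<lambda>l k i j. Re (ip (w a b \<phi>) (M i l (M j k (w a b \<phi>)))))" for b
  proof (rule insert.IH)
    show "sync (w a b \<phi>)" by (rule sync_w [OF insert.prems(1)])
    fix c assume c: "c \<notin> B"
    \<comment> \<open>Vertices resolved before stay resolved because the w commute with each
      other.\<close>
    show "\<exists>d. w c d (w a b \<phi>) = w a b \<phi>"
    proof (cases "c = a")
      case True
      then show ?thesis using w.idem [OF \<phi>D] by blast
    next
      case False
      then obtain d where "w c d \<phi> = \<phi>" using insert.prems(2) c by blast
      then show ?thesis using ww [OF \<phi>D, of c d a b] by auto
    qed
  qed
  then have "aut_cone K (\<lambda>l k i j. \<Sum>b\<in>UNIV. Re (ip (w a b \<phi>) (M i l (M j k (w a b \<phi>)))))"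
    by (intro aut_cone_sum) simp_all
  moreover have "(\<Sum>b\<in>UNIV. Re (ip (w a b \<phi>) (M i l (M j k (w a b \<phi>))))) = Re (ip \<phi> (M i l (M j k \<phi>)))" for l k i j
  proof -
    \<comment> \<open>As \<open>w a b\<close> is a projection commuting with \<open>M\<close>, its
      two copies merge into one; the row sum over b then restores the value at \<phi>, with no cross
      terms.\<close>
    have "ip (w a b \<phi>) (M i l (M j k (w a b \<phi>))) = ip \<phi> (w a b (M i l (M j k \<phi>)))" for b
    proof -
      have "M i l (M j k (w a b \<phi>)) = w a b (M i l (M j k \<phi>))"
        using \<phi>D by (simp add: wM)
      then have "ip (w a b \<phi>) (M i l (M j k (w a b \<phi>))) = ip \<phi> (w a b (w a b (M i l (M j k \<phi>))))"
        using \<phi>D by (simp add: w.sa)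
      then show ?thesis using \<phi>D by (simp add: w.idem)
    qed
    moreover have "(\<Sum>b\<in>UNIV. ip \<phi> (w a b (M i l (M j k \<phi>)))) = ip \<phi> (M i l (M j k \<phi>))"
      using \<phi>D Q.ip_sum [of \<phi> UNIV "\<lambda>b. w a b (M i l (M j k \<phi>))"] by (simp add: w.row_sum)
    ultimately show ?thesis by (simp flip: Re_sum)
  qed
  ultimately show ?case by simp
qed

lemma classical:
  assumes "correlation p"
  shows "winning_classical K p"
proof (rule aut_cone_winning_classical [OF _ assms])
  have "p = (\<lambda>l k i j. Re (ip \<psi> (M i l (M j k \<psi>))))"
    using p_eq by (intro ext) (metis Re_complex_of_real synchronous)
  moreover have "aut_cone K (\<lambda>l k i j. Re (ip \<psi> (M i l (M j k \<psi>))))"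
    by (rule sync_aut_cone [OF finite_class.finite_UNIV sync_psi]) simp
  ultimately show "aut_cone K p" by simp
qed

end

theorem (in spectral_product) no_nonlocal_symmetry:
  assumes "\<not> nonlocal_symmetry TYPE(nat \<Rightarrow> complex) G" and "no_quantum_symmetry H"
  shows "\<not> nonlocal_symmetry TYPE('h) K"
proof
  assume "nonlocal_symmetry TYPE('h) K"
  then obtain p where p: "quantum_correlation TYPE('h) p" "winning K p" "\<not> winning_classical K p"
    unfolding nonlocal_symmetry_def by blast
  obtain V ip \<psi> M N where "qmodel (fscale :: _ \<Rightarrow> ('h \<Rightarrow> complex) \<Rightarrow> _) V ip \<psi> M N p"
    using quantum_correlation_qmodel [OF p(1)] by blast
  \<comment> \<open>The model is moved from \<open>'h\<close> to the type at which the hypothesis on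
    \<open>G\<close> is available.\<close>
  then obtain V ip \<psi> M N where "qmodel (fscale :: _ \<Rightarrow> (nat \<Rightarrow> complex) \<Rightarrow> _) V ip \<psi> M N p"
    using qmodel.qmodel_coeffs by blast
  then interpret qmodel fscale V ip \<psi> M N p .
  interpret product_game G H K F V ip \<psi> M N p
    by unfold_locales (use assms K p in auto)
  have "correlation p" using p(1) by (simp add: quantum_correlation_def)
  then show False using classical p(3) by blast
qed

section \<open>Cartesian and tensor products\<close>

lemma simple_graph_cart_product:
  "simple_graph G \<Longrightarrow> simple_graph H \<Longrightarrow> simple_graph (cart_product G H)"
  by (auto simp: simple_graph_def cart_product_def symp_def irreflp_def)

lemma simple_graph_tensor_product:
  "simple_graph G \<Longrightarrow> simple_graph H \<Longrightarrow> simple_graph (tensor_product G H)"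
  by (auto simp: simple_graph_def tensor_product_def symp_def irreflp_def)

lemma eigenvector_sum:
  fixes x :: "real ^ 'v::finite"
  shows "adj_matrix G *v x = a *\<^sub>R x \<Longrightarrow> (\<Sum>j | G i j. x $ j) = a * x $ i"
  by (simp add: vec_eq_iff flip: adj_matrix_mult_vec)

lemma spectral_product_cart_product:
  assumes G: "simple_graph G" "connected_graph G" "regular_graph G"
    and H: "simple_graph H" "connected_graph H" "regular_graph H"
    and sep: "{a - a' |a a'. a \<in> graph_eigenvalues G \<and> a' \<in> graph_eigenvalues G} \<inter>
      {b - b' |b b'. b \<in> graph_eigenvalues H \<and> b' \<in> graph_eigenvalues H} = {0}"
  shows "spectral_product G H (cart_product G H) (+)"
proof
  note irr = G(1) H(1)
  show "(\<Sum>l | cart_product G H k l. x $ fst l * y $ snd l) = (a + b) * (x $ fst k * y $ snd k)"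
    if "adj_matrix G *v x = a *\<^sub>R x" "adj_matrix H *v y = b *\<^sub>R y" for x y a b k
  proof -
    obtain i c where k: "k = (i, c)" by (cases k)
    have "{l. cart_product G H k l} = (\<lambda>j. (j, c)) ` {j. G i j} \<union> (\<lambda>d. (i, d)) ` {d. H c d}"
      by (auto simp: k cart_product_def)
    moreover have "(\<lambda>j. (j, c)) ` {j. G i j} \<inter> (\<lambda>d. (i, d)) ` {d. H c d} = {}"
      using irr by (auto simp: simple_graph_def irreflp_def)
    ultimately have "(\<Sum>l | cart_product G H k l. x $ fst l * y $ snd l) =
        (\<Sum>l\<in>(\<lambda>j. (j, c)) ` {j. G i j}. x $ fst l * y $ snd l) + (\<Sum>l\<in>(\<lambda>d. (i, d)) ` {d. H c d}. x $ fst l * y $ snd l)"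
      by (simp add: sum.union_disjoint)
    also have "\<dots> = (\<Sum>j | G i j. x $ j) * y $ c + x $ i * (\<Sum>d | H c d. y $ d)"
      by (simp add: sum.reindex inj_on_def sum_distrib_left sum_distrib_right)
    finally show ?thesis
      by (simp add: k eigenvector_sum [OF that(1)] eigenvector_sum [OF that(2)] algebra_simps)
  qed
  show "a = a' \<and> b = b'"
    if "complex_of_real a \<in> graph_eigenvalues G" "complex_of_real a' \<in> graph_eigenvalues G"
      "complex_of_real b \<in> graph_eigenvalues H" "complex_of_real b' \<in> graph_eigenvalues H"
      "a + b = a' + b'" for a a' b b'
  proof -
    \<comment> \<open>This number lies in both difference sets, hence is 0.\<close>
    have "complex_of_real a - of_real a' = of_real b' - of_real b"
      using that(5) by (simp flip: of_real_diff)
    then have "complex_of_real a - of_real a' \<in> {0}"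
      using that(1-4) unfolding sep [symmetric] by blast
    then show ?thesis using that(5) by simp
  qed
  show "(\<exists>a c. \<forall>b d. rel (cart_product G H) (i, a) (k, c) \<noteq> rel (cart_product G H) (j, b) (l, d)) \<or>
      (\<exists>b d. \<forall>a c. rel (cart_product G H) (i, a) (k, c) \<noteq> rel (cart_product G H) (j, b) (l, d))"
    if "rel G i k \<noteq> rel G j l" for i k j l
  proof -
    \<comment> \<open>With equal second coordinates the product shows the relation of
      \<open>G\<close>. Fixing them works on the side whose relation comes first among
      \<open>Equal\<close>, \<open>Adjacent\<close>, \<open>Nonadjacent\<close>.\<close>
    have "(\<forall>b d. rel (cart_product G H) (i, undefined) (k, undefined) \<noteq> rel (cart_product G H) (j, b) (l, d)) \<or>
      (\<forall>a c. rel (cart_product G H) (i, a) (k, c) \<noteq> rel (cart_product G H) (j, undefined) (l, undefined))"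
      using that irr by (auto simp: rel_def cart_product_def simple_graph_def irreflp_def split: if_splits)
    then show ?thesis by blast
  qed
  show "(\<exists>i k. \<forall>j l. rel (cart_product G H) (i, a) (k, c) \<noteq> rel (cart_product G H) (j, b) (l, d)) \<or>
      (\<exists>j l. \<forall>i k. rel (cart_product G H) (i, a) (k, c) \<noteq> rel (cart_product G H) (j, b) (l, d))"
    if "rel H a c \<noteq> rel H b d" for a c b d
  proof -
    have "(\<forall>j l. rel (cart_product G H) (undefined, a) (undefined, c) \<noteq> rel (cart_product G H) (j, b) (l, d)) \<or>
      (\<forall>i k. rel (cart_product G H) (i, a) (k, c) \<noteq> rel (cart_product G H) (undefined, b) (undefined, d))"
      using that irr by (auto simp: rel_def cart_product_def simple_graph_def irreflp_def split: if_splits)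
    then show ?thesis by blast
  qed
  show "map_prod \<sigma> \<pi> \<in> graph_aut (cart_product G H)" if "\<sigma> \<in> graph_aut G" "\<pi> \<in> graph_aut H" for \<sigma> \<pi>
    using that bij_map_prod [of \<sigma> \<pi>] by (auto simp: graph_aut_def cart_product_def bij_def inj_eq)
qed (use G H simple_graph_cart_product in auto)

text \<open>By regularity one isolated vertex makes the adjacency matrix 0. In a tensor product an
  edge of one factor is visible only next to an edge of the other, so neighbours must exist.\<close>

lemma exists_neighbour:
  fixes G :: "'v::finite graph"
  assumes "regular_graph G" and "0 \<notin> graph_eigenvalues G"
  shows "\<exists>j. G i j"
proof (rule ccontr)
  assume "\<nexists>j. G i j"
  then have "card {j. G i j} = 0" by simp
  moreover obtain d where d: "\<And>i. card {j. G i j} = d"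
    using assms(1) by (auto simp: regular_graph_def)
  ultimately have "card {k. G j k} = 0" for j by simp
  then have "\<not> G j k" for j k by simp
  then have "adj_matrix G *v (1 :: real ^ 'v) = 0 *\<^sub>R 1"
    by (simp add: vec_eq_iff adj_matrix_mult_vec)
  then have "complex_of_real 0 \<in> graph_eigenvalues G"
    by (rule real_graph_eigenvalue) simp
  then show False using assms(2) by simp
qed

lemma spectral_product_tensor_product:
  assumes G: "simple_graph G" "connected_graph G" "regular_graph G"
    and H: "simple_graph H" "connected_graph H" "regular_graph H"
    and nz: "0 \<notin> graph_eigenvalues G" "0 \<notin> graph_eigenvalues H"
    and sep: "{a / a' |a a'. a \<in> graph_eigenvalues G \<and> a' \<in> graph_eigenvalues G} \<inter>
      {b / b' |b b'. b \<in> graph_eigenvalues H \<and> b' \<in> graph_eigenvalues H} = {1}"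
  shows "spectral_product G H (tensor_product G H) (*)"
proof
  have irr: "\<not> G i i" "\<not> H a a" for i a
    using G(1) H(1) by (auto simp: simple_graph_def irreflp_def)
  show "(\<Sum>l | tensor_product G H k l. x $ fst l * y $ snd l) = (a * b) * (x $ fst k * y $ snd k)"
    if "adj_matrix G *v x = a *\<^sub>R x" "adj_matrix H *v y = b *\<^sub>R y" for x y a b k
  proof -
    obtain i c where k: "k = (i, c)" by (cases k)
    have "{l. tensor_product G H k l} = {j. G i j} \<times> {d. H c d}"
      by (auto simp: k tensor_product_def)
    then have "(\<Sum>l | tensor_product G H k l. x $ fst l * y $ snd l) =
        (\<Sum>j | G i j. x $ j) * (\<Sum>d | H c d. y $ d)"
      by (simp add: sum_product sum.cartesian_product case_prod_beta)
    then show ?thesis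
      by (simp add: k eigenvector_sum [OF that(1)] eigenvector_sum [OF that(2)])
  qed
  show "a = a' \<and> b = b'"
    if "complex_of_real a \<in> graph_eigenvalues G" "complex_of_real a' \<in> graph_eigenvalues G"
      "complex_of_real b \<in> graph_eigenvalues H" "complex_of_real b' \<in> graph_eigenvalues H"
      "a * b = a' * b'" for a a' b b'
  proof -
    have n: "a \<noteq> 0" "a' \<noteq> 0" "b \<noteq> 0" "b' \<noteq> 0" using that nz by auto
    then have "a / a' = b' / b" using that(5) by (simp add: field_simps)
    then have "complex_of_real a / of_real a' = of_real b' / of_real b"
      by (simp flip: of_real_divide)
    then have "complex_of_real a / of_real a' \<in> {1}"
      using that(1-4) unfolding sep [symmetric] by blast
    then have "a = a'" using n by simp
    then show ?thesis using that(5) n by simp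
  qed
  obtain g h where g: "\<And>i. G i (g i)" and h: "\<And>a. H a (h a)"
    using exists_neighbour [OF G(3) nz(1)] exists_neighbour [OF H(3) nz(2)] by metis
  show "(\<exists>a c. \<forall>b d. rel (tensor_product G H) (i, a) (k, c) \<noteq> rel (tensor_product G H) (j, b) (l, d)) \<or>
      (\<exists>b d. \<forall>a c. rel (tensor_product G H) (i, a) (k, c) \<noteq> rel (tensor_product G H) (j, b) (l, d))"
    if "rel G i k \<noteq> rel G j l" for i k j l
  proof -
    let ?a = "undefined :: 'b"
    have "\<exists>c. (\<forall>b d. rel (tensor_product G H) (i, ?a) (k, c) \<noteq> rel (tensor_product G H) (j, b) (l, d)) \<or>
      (\<forall>a c'. rel (tensor_product G H) (i, a) (k, c') \<noteq> rel (tensor_product G H) (j, ?a) (l, c))"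
    \<comment> \<open>An edge of \<open>G\<close> paired with an edge of \<open>H\<close> is an edge
      of the product, and no lift of the other, non-adjacent pair is one. Otherwise the relations
      are \<open>Equal\<close> and \<open>Nonadjacent\<close>, which equal second coordinates tell
      apart.\<close>
    proof (cases "G i k \<or> G j l")
      case True
      then show ?thesis
        using that h [of ?a] irr
        by (intro exI [of _ "h ?a"]) (auto simp: rel_def tensor_product_def split: if_splits)
    next
      case False
      then show ?thesis
        using that irr
        by (intro exI [of _ ?a]) (auto simp: rel_def tensor_product_def split: if_splits)
    qed
    then show ?thesis by blast
  qed
  show "(\<exists>i k. \<forall>j l. rel (tensor_product G H) (i, a) (k, c) \<noteq> rel (tensor_product G H) (j, b) (l, d)) \<or>
      (\<exists>j l. \<forall>i k. rel (tensor_product G H) (i, a) (k, c) \<noteq> rel (tensor_product G H) (j, b) (l, d))"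
    if "rel H a c \<noteq> rel H b d" for a c b d
  proof -
    let ?i = "undefined :: 'a"
    have "\<exists>k. (\<forall>j l. rel (tensor_product G H) (?i, a) (k, c) \<noteq> rel (tensor_product G H) (j, b) (l, d)) \<or>
      (\<forall>i k'. rel (tensor_product G H) (i, a) (k', c) \<noteq> rel (tensor_product G H) (?i, b) (k, d))"
    proof (cases "H a c \<or> H b d")
      case True
      then show ?thesis
        using that g [of ?i] irr
        by (intro exI [of _ "g ?i"]) (auto simp: rel_def tensor_product_def split: if_splits)
    next
      case False
      then show ?thesis
        using that irr
        by (intro exI [of _ ?i]) (auto simp: rel_def tensor_product_def split: if_splits)
    qed
    then show ?thesis by blast
  qed
  show "map_prod \<sigma> \<pi> \<in> graph_aut (tensor_product G H)" if "\<sigma> \<in> graph_aut G" "\<pi> \<in> graph_aut H" for \<sigma> \<pi>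
    using that bij_map_prod [of \<sigma> \<pi>] by (auto simp: graph_aut_def tensor_product_def)
qed (use G H simple_graph_tensor_product in auto)

theorem corollary5p17:
  fixes G :: "'v::finite graph" and H :: "'w::finite graph"
  assumes "simple_graph G" "connected_graph G" "regular_graph G"
    and "simple_graph H" "connected_graph H" "regular_graph H"
    and "\<not> nonlocal_symmetry TYPE(nat \<Rightarrow> complex) G"
    and "no_quantum_symmetry H"
  shows "({a - a' |a a'. a \<in> graph_eigenvalues G \<and> a' \<in> graph_eigenvalues G} \<inter>
          {b - b' |b b'. b \<in> graph_eigenvalues H \<and> b' \<in> graph_eigenvalues H} = {0}
            \<longrightarrow> \<not> nonlocal_symmetry TYPE('h) (cart_product G H)) \<and>
         (0 \<notin> graph_eigenvalues G \<and> 0 \<notin> graph_eigenvalues H \<and>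
          {a / a' |a a'. a \<in> graph_eigenvalues G \<and> a' \<in> graph_eigenvalues G} \<inter>
          {b / b' |b b'. b \<in> graph_eigenvalues H \<and> b' \<in> graph_eigenvalues H} = {1}
            \<longrightarrow> \<not> nonlocal_symmetry TYPE('h) (tensor_product G H))"
  using spectral_product.no_nonlocal_symmetry [OF spectral_product_cart_product [OF assms(1-6)] assms(7-8)]
    spectral_product.no_nonlocal_symmetry [OF spectral_product_tensor_product [OF assms(1-6)] assms(7-8)]
  by blast

end
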